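(* Let $\dot x = Ax + \sum_{i=1}^m B_i u_i$, $y_i = C_i x$ ($i \in \{1,\dots,m\}$) be an $n$-dimensional continuous-time $m$-channel linear system with $u_i\in\mathbb{R}^{p_i}$, $y_i\in\mathbb{R}^{q_i}$, which is jointly controllable and jointly observable, with $B_i\neq 0$, $C_i\neq 0$ for all $i$, and whose neighbor graph is strongly connected. Let $F_i\in\mathbb{R}^{p_i\times n}$, $i\in\{1,\dots,m\}$, be any feedback matrices, let $q\in\{1,\dots,m\}$, and let $\Lambda$ be any symmetric set (closed under complex conjugation, counted with multiplicity) of $mn+m-1$ complex numbers. Then there exist real matrices $K_i\in\mathbb{R}^{n\times q_i}$, $H_{ij}\in\mathbb{R}^{n\times n}$ ($i\in\{1,\dots,m\}$, $j\in\mathcal{N}_i$), $\bar A\in\mathbb{R}^{(m-1)\times(m-1)}$, $\bar C\in\mathbb{R}^{n\times(m-1)}$, $\bar K\in\mathbb{R}^{(m-1)\times q_q}$, $\bar H_j\in\mathbb{R}^{(m-1)\times n}$ ($j\in\mathcal{N}_q$) such that the spectrum of the $(mn+m-1)$-dimensional linear system $$\dot e_i = (A+K_iC_i)e_i + \sum_{j\in\mathcal{N}_i}H_{ij}(e_i-e_j) + \delta_{iq}\bar C z + \sum_{j=1}^m B_jF_j(e_i-e_j),\quad i\in\{1,\dots,m\},$$ $$\dot z = \bar A z + \bar K C_q e_q + \sum_{j\in\mathcal{N}_q}\bar H_j(e_q-e_j),$$ with state $(e_1,\dots,e_m,z)\in(\mathbb{R}^n)^m\times\mathbb{R}^{m-1}$,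 is $\Lambda$.
   Context: Jointly controllable means $(A,[B_1\ \cdots\ B_m])$ is controllable; jointly observable means $(\mathrm{column}\{C_1,\dots,C_m\},A)$ is observable. The neighbor graph is a directed graph on vertices $\{1,\dots,m\}$ with an arc from $j$ to $i$ iff agent $j$ is a neighbor of agent $i$; $\mathcal{N}_i$ is the set of neighbors of $i$ including $i$. Strongly connected: a directed path exists between every ordered pair of vertices. $\delta_{iq}$ is the Kronecker delta. *)

theory Defs
  imports "Jordan_Normal_Form.Matrix" "Jordan_Normal_Form.Char_Poly" "Jordan_Normal_Form.DL_Rank"
begin

(* Agents/channels are indexed 0..<m. Matrices are JNF matrices with explicit dimensions. *)

definition rank_real :: "nat \<Rightarrow> real mat \<Rightarrow> nat" where
  "rank_real nr M = vec_space.rank nr (M :: real mat)"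

(* Kalman controllability matrix [B_1 .. B_m, A B_1 .. A B_m, .., A^(n-1) B_1 .. A^(n-1) B_m] *)
definition ctrb_mat :: "nat \<Rightarrow> nat \<Rightarrow> real mat \<Rightarrow> (nat \<Rightarrow> real mat) \<Rightarrow> real mat" where
  "ctrb_mat n m A B = mat_of_cols n (concat [cols (A ^\<^sub>m k * B i). k \<leftarrow> [0..<n], i \<leftarrow> [0..<m]])"

(* Kalman observability matrix: stacked rows of C_i A^k *)
definition obsv_mat :: "nat \<Rightarrow> nat \<Rightarrow> real mat \<Rightarrow> (nat \<Rightarrow> real mat) \<Rightarrow> real mat" where
  "obsv_mat n m A C = mat_of_rows n (concat [rows (C i * A ^\<^sub>m k). k \<leftarrow> [0..<n], i \<leftarrow> [0..<m]])"

definition jointly_controllable :: "nat \<Rightarrow> nat \<Rightarrow> real mat \<Rightarrow> (nat \<Rightarrow> real mat) \<Rightarrow> bool" where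
  "jointly_controllable n m A B \<longleftrightarrow> rank_real n (ctrb_mat n m A B) = n"

(* row rank of the observability matrix = column rank of its transpose *)
definition jointly_observable :: "nat \<Rightarrow> nat \<Rightarrow> real mat \<Rightarrow> (nat \<Rightarrow> real mat) \<Rightarrow> bool" where
  "jointly_observable n m A C \<longleftrightarrow> rank_real n (transpose_mat (obsv_mat n m A C)) = n"

(* neighbor graph: arc j -> i iff j is a neighbor of i, vertices 0..<m *)
definition neighbor_arcs :: "nat \<Rightarrow> (nat \<Rightarrow> nat set) \<Rightarrow> (nat \<times> nat) set" where
  "neighbor_arcs m N = {(j, i). i < m \<and> j < m \<and> j \<in> N i \<and> j \<noteq> i}"

definition strongly_connected_graph :: "nat \<Rightarrow> (nat \<times> nat) set \<Rightarrow> bool" where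
  "strongly_connected_graph m E \<longleftrightarrow> (\<forall>i<m. \<forall>j<m. (i, j) \<in> E\<^sup>*)"

definition vsum :: "nat \<Rightarrow> ('c \<Rightarrow> real vec) \<Rightarrow> 'c set \<Rightarrow> real vec" where
  "vsum n f S = finsum_vec TYPE(real) n f S"

(* the right-hand side of the closed-loop error system, evaluated at the stacked state
   x = (e_0, ..., e_{m-1}, z) of dimension m*n + (m-1) *)
definition closed_loop_rhs ::
  "nat \<Rightarrow> nat \<Rightarrow> nat \<Rightarrow> real mat \<Rightarrow> (nat \<Rightarrow> real mat) \<Rightarrow> (nat \<Rightarrow> real mat) \<Rightarrow> (nat \<Rightarrow> real mat)
   \<Rightarrow> (nat \<Rightarrow> nat set) \<Rightarrow> (nat \<Rightarrow> real mat) \<Rightarrow> (nat \<Rightarrow> nat \<Rightarrow> real mat)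
   \<Rightarrow> real mat \<Rightarrow> real mat \<Rightarrow> real mat \<Rightarrow> (nat \<Rightarrow> real mat) \<Rightarrow> real vec \<Rightarrow> real vec" where
  "closed_loop_rhs n m q A B C F N K H Abar Cbar Kbar Hbar x =
    (let e = (\<lambda>i. vec n (\<lambda>a. x $ (i * n + a)));
         z = vec (m - 1) (\<lambda>a. x $ (m * n + a));
         de = (\<lambda>i. (A + K i * C i) *\<^sub>v e i
                  + vsum n (\<lambda>j. H i j *\<^sub>v (e i - e j)) (N i)
                  + (if i = q then Cbar *\<^sub>v z else 0\<^sub>v n)
                  + vsum n (\<lambda>j. (B j * F j) *\<^sub>v (e i - e j)) {0..<m});
         dz = Abar *\<^sub>v z + (Kbar * C q) *\<^sub>v e q
                  + vsum (m - 1) (\<lambda>j. Hbar j *\<^sub>v (e q - e j)) (N q)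
     in vec (m * n + (m - 1)) (\<lambda>r. if r < m * n then de (r div n) $ (r mod n)
                                  else dz $ (r - m * n)))"

end

theory Submission
  imports Defs
begin

text \<open>Give every agent a high gain \<open>t\<close> on its disagreement with its neighbours. The disagreement then
  becomes fast, while the consensus component evolves as \<open>A + \<Sum>\<^sub>i J\<^sub>i C\<^sub>i\<close>: the terms \<open>B\<^sub>j F\<^sub>j (e\<^sub>i - e\<^sub>j)\<close>
  vanish on consensus. By the dual of Heymann's lemma the \<open>J\<^sub>i\<close> can be chosen such that this slow part is
  observable from a single scalar output of agent \<open>q\<close>, and by a hierarchical choice of row weights the
  fast part is observable from the same scalar, so for large \<open>t\<close> the whole error system is. A weighted
  Laplacian that is controllable from vertex \<open>q\<close> makes \<open>[B, M B, \<dots>, M\<^sup>m\<^sup>-\<^sup>1 B]\<close> nonsingular at infinite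
  gain. Both properties are nonvanishing of determinants that are polynomial in the added gain, so they
  hold simultaneously for some gains. A compensator of order \<open>m - 1\<close> at agent \<open>q\<close> then places all
  poles, as in the theorem of Brasch and Pearson.\<close>

section \<open>Iterated linear maps and limits of row spaces\<close>

text \<open>Observability through one scalar and a small controllability index pull the gains apart:
  the first needs gain blocks that tell the components of an agent apart and yet feed all of them
  into one output, the second wants a single scalar weight per vertex. Hence each property is
  established at its own gain and carried along a one-parameter family. High-gain limits are treated
  without eigenvalues: one collects the rows that annihilate the unobservable subspace and depend
  polynomially on \<open>\<delta> = 1/t\<close>. Their values at \<open>\<delta> = 0\<close> form a
  space closed under the fast matrix and, on the left kernel of that matrix, under a slow step. So
  both the elimination of a vertex and the reduction to the consensus component become algebra with
  row vectors. The order \<open>m - 1\<close> comes from a count: the compensator acts on all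
  \<open>n\<close> components of agent \<open>q\<close>, so \<open>B\<close> is the full coordinate
  block of \<open>q\<close>, and \<open>B, M B, ..., M^(m-1) B\<close> have exactly
  \<open>m * n\<close> columns, a square matrix whose determinant can be followed along the
  family.\<close>

definition dotp :: "'i set \<Rightarrow> ('i \<Rightarrow> 'a::comm_ring_1) \<Rightarrow> ('i \<Rightarrow> 'a) \<Rightarrow> 'a" where
  "dotp I r v = (\<Sum>i\<in>I. r i * v i)"

text \<open>Vectors are functions and the index set is explicit. Eliminating a coordinate is then
  deleting an element of the set, and the same maps serve product index sets and polynomial
  entries.\<close>

definition mv :: "'i set \<Rightarrow> ('i \<Rightarrow> 'i \<Rightarrow> 'a::comm_ring_1) \<Rightarrow> ('i \<Rightarrow> 'a) \<Rightarrow> ('i \<Rightarrow> 'a)" where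
  "mv I M v = (\<lambda>i. \<Sum>j\<in>I. M i j * v j)"

definition rm :: "'i set \<Rightarrow> ('i \<Rightarrow> 'i \<Rightarrow> 'a::comm_ring_1) \<Rightarrow> ('i \<Rightarrow> 'a) \<Rightarrow> ('i \<Rightarrow> 'a)" where
  "rm I M r = (\<lambda>j. \<Sum>i\<in>I. r i * M i j)"

lemma dotp_rm: "dotp I (rm I M r) v = dotp I r (mv I M v)"
proof -
  have "dotp I (rm I M r) v = (\<Sum>j\<in>I. \<Sum>i\<in>I. r i * M i j * v j)"
    by (simp add: dotp_def rm_def sum_distrib_right)
  also have "\<dots> = (\<Sum>i\<in>I. \<Sum>j\<in>I. r i * M i j * v j)" by (rule sum.swap)
  finally show ?thesis by (simp add: dotp_def mv_def sum_distrib_left mult.assoc)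
qed

lemma dotp_rm_pow: "dotp I ((rm I M ^^ k) r) v = dotp I r ((mv I M ^^ k) v)"
proof (induction k arbitrary: v)
  case (Suc k)
  have "dotp I ((rm I M ^^ Suc k) r) v = dotp I r ((mv I M ^^ k) (mv I M v))"
    by (simp add: dotp_rm Suc)
  then show ?case by (simp only: funpow_Suc_right o_apply)
qed simp

lemma dotp_cong: "(\<And>i. i \<in> I \<Longrightarrow> r i = r' i) \<Longrightarrow> (\<And>i. i \<in> I \<Longrightarrow> v i = v' i) \<Longrightarrow> dotp I r v = dotp I r' v'"
  by (auto simp: dotp_def intro!: sum.cong)

lemma mv_cong: "(\<And>i. i \<in> I \<Longrightarrow> v i = v' i) \<Longrightarrow> mv I M v = mv I M v'"
  by (auto simp: mv_def intro!: sum.cong)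

lemma rm_cong: "(\<And>i. i \<in> I \<Longrightarrow> r i = r' i) \<Longrightarrow> rm I M r = rm I M r'"
  by (auto simp: rm_def intro!: sum.cong)

lemma mv_pow_cong:
  assumes "\<And>i. i \<in> I \<Longrightarrow> v i = v' i" "i \<in> I"
  shows "(mv I M ^^ k) v i = (mv I M ^^ k) v' i"
  using assms(2)
proof (induction k arbitrary: i)
  case (Suc k)
  then show ?case by (simp add: mv_cong[of I "(mv I M ^^ k) v" "(mv I M ^^ k) v'"])
qed (use assms(1) in simp)

lemma mv_scale: "mv I (\<lambda>i j. s * M i j) v = (\<lambda>i. s * mv I M v i)"
  by (simp add: mv_def sum_distrib_left mult.assoc)

lemma mv_vscale: "mv I M (\<lambda>i. s * v i) = (\<lambda>i. s * mv I M v i)"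
  by (simp add: mv_def sum_distrib_left mult.left_commute)

lemma mv_pow_scale: "(mv I (\<lambda>i j. s * M i j) ^^ k) v = (\<lambda>i. s ^ k * (mv I M ^^ k) v i)"
proof (induction k)
  case (Suc k)
  show ?case by (simp only: funpow.simps o_apply Suc) (simp only: mv_scale mv_vscale power_Suc mult.assoc)
qed simp

lemma dotp_scale_right: "dotp I r (\<lambda>i. s * v i) = s * dotp I r v"
  by (simp add: dotp_def sum_distrib_left mult.left_commute)

lemma dotp_scale_left: "dotp I (\<lambda>i. s * r i) v = s * dotp I r v"
  by (simp add: dotp_def sum_distrib_left mult.assoc)

lemma dotp_add_left: "dotp I (\<lambda>i. r i + s i) v = dotp I r v + dotp I s v"
  by (simp add: dotp_def sum.distrib algebra_simps)

lemma dotp_diff_right: "dotp I r (\<lambda>i. v i - w i) = dotp I r v - dotp I r w"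
  by (simp add: dotp_def sum_subtractf algebra_simps)

lemma dotp_unit: "finite I \<Longrightarrow> l \<in> I \<Longrightarrow> dotp I r (\<lambda>i. if i = l then 1 else 0) = r l"
  unfolding dotp_def by (subst sum.cong[OF refl, of _ _ "\<lambda>i. if i = l then r i else 0"]) auto

lemma dotp_unit_left: "finite I \<Longrightarrow> l \<in> I \<Longrightarrow> dotp I (\<lambda>i. if i = l then 1 else 0) r = r l"
  unfolding dotp_def by (subst sum.cong[OF refl, of _ _ "\<lambda>i. if i = l then r i else 0"]) auto

section \<open>Duality and limits of annihilating functionals\<close>

text \<open>The double annihilator theorem, by eliminating one coordinate at a time. It is the
  solvability criterion of the whole proof: a right-hand side is attainable if every vector
  orthogonal to all attainable ones is orthogonal to it.\<close>

lemma annihilator_dual: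
  fixes U :: "('i \<Rightarrow> 'a::field) set"
  assumes "finite I"
    and "(\<lambda>i. 0) \<in> U"
    and "\<And>u w. u \<in> U \<Longrightarrow> w \<in> U \<Longrightarrow> (\<lambda>i. u i + w i) \<in> U"
    and "\<And>s u. u \<in> U \<Longrightarrow> (\<lambda>i. s * u i) \<in> U"
    and "\<And>v. (\<And>u. u \<in> U \<Longrightarrow> dotp I u v = 0) \<Longrightarrow> dotp I r v = 0"
  shows "\<exists>u\<in>U. \<forall>i\<in>I. u i = r i"
  using assms
proof (induction I arbitrary: U r rule: finite_induct)
  case empty
  then show ?case by auto
next
  case (insert l I)
  have split: "dotp (insert l I) u v = u l * v l + dotp I u v" for u v :: "'i \<Rightarrow> 'a"
    using insert.hyps by (simp add: dotp_def)
  show ?case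
  proof (cases "\<exists>\<rho>\<in>U. \<rho> l \<noteq> 0")
    case True
    then obtain \<rho> where \<rho>: "\<rho> \<in> U" "\<rho> l \<noteq> 0" by blast
    define U' where "U' = {u \<in> U. u l = 0}"
    define r' where "r' = (\<lambda>i. r i + (- (r l / \<rho> l)) * \<rho> i)"
    have "\<exists>u\<in>U'. \<forall>i\<in>I. u i = r' i"
    proof (rule insert.IH)
      show "(\<lambda>i. 0) \<in> U'" using insert.prems by (simp add: U'_def)
      show "(\<lambda>i. u i + w i) \<in> U'" if "u \<in> U'" "w \<in> U'" for u w
        using that insert.prems by (simp add: U'_def)
      show "(\<lambda>i. s * u i) \<in> U'" if "u \<in> U'" for s u
        using that insert.prems by (simp add: U'_def)
      fix v assume v: "\<And>u. u \<in> U' \<Longrightarrow> dotp I u v = 0"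
      \<comment> \<open>The value at \<open>l\<close> is chosen such that the pivot
        \<open>\<rho>\<close> annihilates \<open>v'\<close>. Then all of \<open>U\<close> does,
        since each \<open>u\<close> is a member of \<open>U'\<close> plus a multiple of
        \<open>\<rho>\<close>.\<close>
      define v' where "v' = v(l := - dotp I \<rho> v / \<rho> l)"
      have v'I: "dotp I u v' = dotp I u v" for u
        using insert.hyps by (intro dotp_cong) (auto simp: v'_def)
      have v'l: "\<rho> l * v' l = - dotp I \<rho> v" using \<rho> by (simp add: v'_def)
      have "dotp (insert l I) u v' = 0" if "u \<in> U" for u
      proof -
        have "(\<lambda>i. u i + (- (u l / \<rho> l)) * \<rho> i) \<in> U'"
          using that \<rho> insert.prems(2)[OF that insert.prems(3)[OF \<rho>(1)], of "- (u l / \<rho> l)"]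
          by (simp add: U'_def)
        from v[OF this] have "dotp I u v = (u l / \<rho> l) * dotp I \<rho> v"
          unfolding dotp_add_left dotp_scale_left by simp
        then show ?thesis using v'l \<rho>(2) unfolding split v'I
          by (simp add: v'_def)
      qed
      then have "dotp (insert l I) r v' = 0" using insert.prems(4) by blast
      then show "dotp I r' v = 0" using v'l \<rho>(2) unfolding split v'I r'_def dotp_add_left dotp_scale_left
        by (simp add: v'_def)
    qed
    then obtain u where u: "u \<in> U" "u l = 0" "\<forall>i\<in>I. u i = r' i" by (auto simp: U'_def)
    have "(\<lambda>i. u i + (r l / \<rho> l) * \<rho> i) \<in> U" using u \<rho> insert.prems by blast
    then show ?thesis using u \<rho> by (intro bexI) (auto simp: r'_def)
  next
    case False
    then have z: "u l = 0" if "u \<in> U" for u using that by blast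
    have rl: "r l = 0"
      using insert.prems(4)[of "\<lambda>i. if i = l then 1 else 0"] insert.hyps z by (simp add: dotp_unit)
    have "\<exists>u\<in>U. \<forall>i\<in>I. u i = r i"
    proof (rule insert.IH)
      fix v assume "\<And>u. u \<in> U \<Longrightarrow> dotp I u v = 0"
      then show "dotp I r v = 0" using insert.prems(4)[of v] z rl by (simp add: split)
    qed (use insert.prems in auto)
    then show ?thesis using z rl by auto
  qed
qed

text \<open>The functionals that arise as values at \<open>\<delta> = 0\<close> of polynomial functionals vanishing on
  \<open>V \<delta>\<close> for all \<open>\<delta> > 0\<close>.\<close>
definition lims :: "'i set \<Rightarrow> (real \<Rightarrow> ('i \<Rightarrow> real) set) \<Rightarrow> ('i \<Rightarrow> real) \<Rightarrow> bool" where
  "lims I V r \<longleftrightarrow> (\<exists>\<rho>. (\<forall>i\<in>I. poly (\<rho> i) 0 = r i) \<and>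
     (\<forall>\<delta>. \<delta> > 0 \<longrightarrow> (\<forall>v\<in>V \<delta>. dotp I (\<lambda>i. poly (\<rho> i) \<delta>) v = 0)))"

lemma lims_const: "(\<And>\<delta> v. \<delta> > 0 \<Longrightarrow> v \<in> V \<delta> \<Longrightarrow> dotp I r v = 0) \<Longrightarrow> lims I V r"
  unfolding lims_def by (intro exI[of _ "\<lambda>i. [:r i:]"]) auto

lemma lims_add: assumes "lims I V r" "lims I V s" shows "lims I V (\<lambda>i. r i + s i)"
proof -
  from assms obtain \<rho> \<sigma> where "\<forall>i\<in>I. poly (\<rho> i) 0 = r i" "\<forall>i\<in>I. poly (\<sigma> i) 0 = s i"
    "\<forall>\<delta>. \<delta> > 0 \<longrightarrow> (\<forall>v\<in>V \<delta>. dotp I (\<lambda>i. poly (\<rho> i) \<delta>) v = 0)"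
    "\<forall>\<delta>. \<delta> > 0 \<longrightarrow> (\<forall>v\<in>V \<delta>. dotp I (\<lambda>i. poly (\<sigma> i) \<delta>) v = 0)"
    unfolding lims_def by blast
  then show ?thesis unfolding lims_def
    by (intro exI[of _ "\<lambda>i. \<rho> i + \<sigma> i"]) (simp add: dotp_add_left)
qed

lemma lims_scale: assumes "lims I V r" shows "lims I V (\<lambda>i. c * r i)"
proof -
  from assms obtain \<rho> where "\<forall>i\<in>I. poly (\<rho> i) 0 = r i"
    "\<forall>\<delta>. \<delta> > 0 \<longrightarrow> (\<forall>v\<in>V \<delta>. dotp I (\<lambda>i. poly (\<rho> i) \<delta>) v = 0)"
    unfolding lims_def by blast
  then show ?thesis unfolding lims_def
    by (intro exI[of _ "\<lambda>i. Polynomial.smult c (\<rho> i)"]) (simp add: dotp_scale_left)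
qed

lemma lims_cong: "(\<And>i. i \<in> I \<Longrightarrow> r i = s i) \<Longrightarrow> lims I V r \<Longrightarrow> lims I V s"
proof -
  assume eq: "\<And>i. i \<in> I \<Longrightarrow> r i = s i" and "lims I V r"
  then obtain \<rho> where "\<forall>i\<in>I. poly (\<rho> i) 0 = r i"
    "\<forall>\<delta>. \<delta> > 0 \<longrightarrow> (\<forall>v\<in>V \<delta>. dotp I (\<lambda>i. poly (\<rho> i) \<delta>) v = 0)"
    unfolding lims_def by blast
  then show ?thesis unfolding lims_def by (intro exI[of _ \<rho>]) (simp add: eq)
qed

text \<open>The limits form a subspace, so it suffices to test \<open>r\<close> on the vectors that
  all limits kill. These vectors are usually known well enough to replace a limit by a more
  convenient one.\<close>

lemma lims_dual:
  assumes "finite I" and "\<And>v. (\<And>u. lims I V u \<Longrightarrow> dotp I u v = 0) \<Longrightarrow> dotp I r v = 0"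
  shows "lims I V r"
proof -
  have "\<exists>u\<in>Collect (lims I V). \<forall>i\<in>I. u i = r i"
    by (rule annihilator_dual) (use assms in \<open>auto intro: lims_const lims_add lims_scale simp: dotp_def\<close>)
  then obtain u where "lims I V u" "\<forall>i\<in>I. u i = r i" by auto
  then show ?thesis by (intro lims_cong[of I u r V]) auto
qed

context
  fixes I :: "'i set" and V :: "real \<Rightarrow> ('i \<Rightarrow> real) set" and L G :: "'i \<Rightarrow> 'i \<Rightarrow> real"
  assumes invariant: "\<And>\<delta> v. \<delta> > 0 \<Longrightarrow> v \<in> V \<delta> \<Longrightarrow> mv I (\<lambda>i j. L i j + \<delta> * G i j) v \<in> V \<delta>"
begin

text \<open>A polynomial annihilator times \<open>L + \<delta> G\<close> is again polynomial, and it
  still annihilates because \<open>V \<delta>\<close> is invariant; at \<open>\<delta> = 0\<close>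
  only \<open>L\<close> remains.\<close>

lemma lims_fast:
  assumes "lims I V r"
  shows "lims I V (rm I L r)"
proof -
  from assms obtain \<rho> where \<rho>: "\<forall>i\<in>I. poly (\<rho> i) 0 = r i"
    "\<And>\<delta> v. \<delta> > 0 \<Longrightarrow> v\<in>V \<delta> \<Longrightarrow> dotp I (\<lambda>i. poly (\<rho> i) \<delta>) v = 0"
    unfolding lims_def by blast
  define \<tau> where "\<tau> = (\<lambda>j. \<Sum>i\<in>I. \<rho> i * [:L i j, G i j:])"
  have \<tau>: "(\<lambda>j. poly (\<tau> j) \<delta>) = rm I (\<lambda>i j. L i j + \<delta> * G i j) (\<lambda>i. poly (\<rho> i) \<delta>)" for \<delta>
    by (simp add: \<tau>_def rm_def poly_sum algebra_simps)
  show ?thesis unfolding lims_def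
  proof (intro exI[of _ \<tau>] conjI allI impI ballI)
    fix i assume "i \<in> I"
    show "poly (\<tau> i) 0 = rm I L r i" using fun_cong[OF \<tau>[of 0], of i] \<rho>(1) by (simp add: rm_def)
  next
    fix \<delta> v assume "\<delta> > (0::real)" "v \<in> V \<delta>"
    then show "dotp I (\<lambda>i. poly (\<tau> i) \<delta>) v = 0" unfolding \<tau> dotp_rm
      by (intro \<rho>(2) invariant)
  qed
qed

text \<open>Since \<open>r L = 0\<close>, the row \<open>\<rho> (L + \<delta> G)\<close> has zero
  constant term and can be divided by \<open>\<delta>\<close>. This is the slow motion of singular
  perturbation theory. The row \<open>s\<close> is the linear coefficient of \<open>\<rho>\<close>
  and is not under control, so each application has to dispose of \<open>s L\<close>.\<close>

lemma lims_slow: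
  assumes "lims I V r" and "\<And>j. j \<in> I \<Longrightarrow> rm I L r j = 0"
  shows "\<exists>s. lims I V (\<lambda>j. rm I G r j + rm I L s j)"
proof -
  from assms(1) obtain \<rho> where \<rho>: "\<forall>i\<in>I. poly (\<rho> i) 0 = r i"
    "\<And>\<delta> v. \<delta> > 0 \<Longrightarrow> v\<in>V \<delta> \<Longrightarrow> dotp I (\<lambda>i. poly (\<rho> i) \<delta>) v = 0"
    unfolding lims_def by blast
  have "\<exists>s. \<rho> i = pCons (r i) s" if "i \<in> I" for i
    using \<rho>(1) that by (cases "\<rho> i") auto
  then obtain \<sigma> where \<sigma>: "\<And>i. i \<in> I \<Longrightarrow> \<rho> i = pCons (r i) (\<sigma> i)" by metis
  define \<tau> where "\<tau> = (\<lambda>j. (\<Sum>i\<in>I. \<rho> i * [:G i j:]) + (\<Sum>i\<in>I. \<sigma> i * [:L i j:]))"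
  have \<tau>: "\<delta> * poly (\<tau> j) \<delta> = rm I (\<lambda>i j. L i j + \<delta> * G i j) (\<lambda>i. poly (\<rho> i) \<delta>) j" if "j \<in> I" for \<delta> j
  proof -
    have "rm I (\<lambda>i j. L i j + \<delta> * G i j) (\<lambda>i. poly (\<rho> i) \<delta>) j
      = (\<Sum>i\<in>I. (r i + \<delta> * poly (\<sigma> i) \<delta>) * L i j) + \<delta> * (\<Sum>i\<in>I. poly (\<rho> i) \<delta> * G i j)"
      by (simp add: rm_def sum_distrib_left sum.distrib \<sigma> algebra_simps)
    also have "\<dots> = rm I L r j + \<delta> * (\<Sum>i\<in>I. poly (\<sigma> i) \<delta> * L i j) + \<delta> * (\<Sum>i\<in>I. poly (\<rho> i) \<delta> * G i j)"
      by (simp add: rm_def sum_distrib_left sum.distrib algebra_simps)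
    finally show ?thesis using assms(2)[OF that] by (simp add: \<tau>_def poly_sum algebra_simps)
  qed
  show ?thesis unfolding lims_def
  proof (intro exI[of _ "\<lambda>i. poly (\<sigma> i) 0"] exI[of _ \<tau>] conjI allI impI ballI)
    fix i assume "i \<in> I"
    show "poly (\<tau> i) 0 = rm I G r i + rm I L (\<lambda>i. poly (\<sigma> i) 0) i"
      using \<rho>(1) by (simp add: rm_def \<tau>_def poly_sum mult.commute)
  next
    fix \<delta> v assume \<delta>: "\<delta> > (0::real)" "v \<in> V \<delta>"
    have "\<delta> * dotp I (\<lambda>i. poly (\<tau> i) \<delta>) v = dotp I (rm I (\<lambda>i j. L i j + \<delta> * G i j) (\<lambda>i. poly (\<rho> i) \<delta>)) v"
      unfolding dotp_scale_left[symmetric] by (rule dotp_cong) (use \<tau> in auto)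
    also have "\<dots> = 0" unfolding dotp_rm by (intro \<rho>(2) invariant \<delta>)
    finally show "dotp I (\<lambda>i. poly (\<tau> i) \<delta>) v = 0" using \<delta> by simp
  qed
qed

end

text \<open>The assumption makes every unit row a limit. The corresponding polynomial rows form a
  matrix that is close to the identity for small \<open>\<delta>\<close>, hence injective by
  diagonal dominance.\<close>

lemma lims_full:
  assumes "finite I" and "\<And>v i. (\<And>u. lims I V u \<Longrightarrow> dotp I u v = 0) \<Longrightarrow> i \<in> I \<Longrightarrow> v i = 0"
  shows "\<exists>\<delta>. \<delta> > 0 \<and> (\<forall>v\<in>V \<delta>. \<forall>i\<in>I. v i = 0)"
proof -
  have "lims I V (\<lambda>j. if j = i then 1 else 0)" if "i \<in> I" for i
  proof (rule lims_dual[OF assms(1)])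
    fix v assume "\<And>u. lims I V u \<Longrightarrow> dotp I u v = 0"
    then have "v i = 0" using assms(2) that by blast
    then show "dotp I (\<lambda>j. if j = i then 1 else 0) v = 0" using assms(1) that by (simp add: dotp_unit_left)
  qed
  then have "\<forall>i\<in>I. \<exists>\<rho>. (\<forall>j\<in>I. poly (\<rho> j) 0 = (if j = i then 1 else 0)) \<and>
     (\<forall>\<delta>. \<delta> > 0 \<longrightarrow> (\<forall>v\<in>V \<delta>. dotp I (\<lambda>i. poly (\<rho> i) \<delta>) v = 0))"
    unfolding lims_def by blast
  from bchoice[OF this] obtain \<rho> where
    "\<forall>i\<in>I. (\<forall>j\<in>I. poly (\<rho> i j) 0 = (if j = i then 1 else 0)) \<and>
     (\<forall>\<delta>. \<delta> > 0 \<longrightarrow> (\<forall>v\<in>V \<delta>. dotp I (\<lambda>j. poly (\<rho> i j) \<delta>) v = 0))" ..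
  then have \<rho>: "\<And>i j. i \<in> I \<Longrightarrow> j \<in> I \<Longrightarrow> poly (\<rho> i j) 0 = (if j = i then 1 else 0)"
    "\<And>i \<delta> v. i \<in> I \<Longrightarrow> \<delta> > 0 \<Longrightarrow> v \<in> V \<delta> \<Longrightarrow> dotp I (\<lambda>j. poly (\<rho> i j) \<delta>) v = 0"
    by blast+
  \<comment> \<open>With this value \<open>card I * \<epsilon> = 1 - \<epsilon> < 1\<close>, so the
    deviations from the identity cannot balance the entry of largest modulus.\<close>
  define \<epsilon> where "\<epsilon> = 1 / (real (card I) + 1)"
  have "\<epsilon> > 0" by (simp add: \<epsilon>_def)
  have "\<forall>\<^sub>F \<delta> in at_right 0. \<forall>i\<in>I. \<forall>j\<in>I. dist (poly (\<rho> i j) \<delta>) (poly (\<rho> i j) 0) < \<epsilon>"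
  proof (rule eventually_ball_finite[OF assms(1)], rule ballI, rule eventually_ball_finite[OF assms(1)], rule ballI)
    fix i j
    have "(poly (\<rho> i j) \<longlongrightarrow> poly (\<rho> i j) 0) (at_right 0)"
      by (rule filterlim_mono[OF isContD[OF poly_isCont] order_refl at_le]) auto
    then show "\<forall>\<^sub>F \<delta> in at_right 0. dist (poly (\<rho> i j) \<delta>) (poly (\<rho> i j) 0) < \<epsilon>"
      by (rule tendstoD) fact
  qed
  moreover have "\<forall>\<^sub>F \<delta> in at_right 0. \<delta> > (0::real)" by (rule eventually_at_right_less)
  ultimately have "\<forall>\<^sub>F \<delta> in at_right (0::real). \<delta> > 0 \<and> (\<forall>i\<in>I. \<forall>j\<in>I. dist (poly (\<rho> i j) \<delta>) (poly (\<rho> i j) 0) < \<epsilon>)"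
    by eventually_elim auto
  then obtain \<delta> where \<delta>: "\<delta> > 0" "\<And>i j. i \<in> I \<Longrightarrow> j \<in> I \<Longrightarrow> dist (poly (\<rho> i j) \<delta>) (poly (\<rho> i j) 0) < \<epsilon>"
    using eventually_happens'[OF trivial_limit_at_right_real[of "0::real"]] by blast
  show ?thesis
  proof (intro exI[of _ \<delta>] conjI \<delta>(1) ballI)
    fix v k assume v: "v \<in> V \<delta>" and k: "k \<in> I"
    define S where "S = (\<lambda>i. \<bar>v i\<bar>) ` I"
    have S: "finite S" "S \<noteq> {}" using assms(1) k by (auto simp: S_def)
    from Max_in[OF S] obtain i where i: "i \<in> I" "\<bar>v i\<bar> = Max S" by (auto simp: S_def)
    have imax: "\<bar>v j\<bar> \<le> \<bar>v i\<bar>" if "j \<in> I" for j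
      unfolding i(2) using S(1) that by (intro Max_ge) (auto simp: S_def)
    have "0 = (\<Sum>j\<in>I. poly (\<rho> i j) \<delta> * v j)" using \<rho>(2)[OF i(1) \<delta>(1) v] by (simp add: dotp_def)
    also have "\<dots> = (\<Sum>j\<in>I. (poly (\<rho> i j) \<delta> - poly (\<rho> i j) 0) * v j + poly (\<rho> i j) 0 * v j)"
      by (intro sum.cong refl) (simp add: left_diff_distrib)
    also have "\<dots> = (\<Sum>j\<in>I. (poly (\<rho> i j) \<delta> - poly (\<rho> i j) 0) * v j) + (\<Sum>j\<in>I. poly (\<rho> i j) 0 * v j)"
      by (rule sum.distrib)
    also have "(\<Sum>j\<in>I. poly (\<rho> i j) 0 * v j) = (\<Sum>j\<in>I. if j = i then v j else 0)"
      by (intro sum.cong) (auto simp: \<rho>(1) i)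
    also have "\<dots> = v i" using assms(1) i by simp
    finally have "\<bar>v i\<bar> = \<bar>\<Sum>j\<in>I. (poly (\<rho> i j) \<delta> - poly (\<rho> i j) 0) * v j\<bar>" by simp
    also have "\<dots> \<le> (\<Sum>j\<in>I. \<bar>(poly (\<rho> i j) \<delta> - poly (\<rho> i j) 0) * v j\<bar>)" by (rule sum_abs)
    also have "\<dots> \<le> (\<Sum>j\<in>I. \<epsilon> * \<bar>v i\<bar>)"
      unfolding abs_mult
    proof (rule sum_mono)
      fix j assume j: "j \<in> I"
      have "\<bar>poly (\<rho> i j) \<delta> - poly (\<rho> i j) 0\<bar> \<le> \<epsilon>"
        using \<delta>(2)[OF i(1) j] by (simp add: dist_real_def)
      then show "\<bar>poly (\<rho> i j) \<delta> - poly (\<rho> i j) 0\<bar> * \<bar>v j\<bar> \<le> \<epsilon> * \<bar>v i\<bar>"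
        by (rule mult_mono) (use imax[OF j] \<open>\<epsilon> > 0\<close> in auto)
    qed
    also have "\<dots> = real (card I) * \<epsilon> * \<bar>v i\<bar>" by simp
    also have "real (card I) * \<epsilon> = 1 - \<epsilon>" by (simp add: \<epsilon>_def field_simps)
    finally have "\<epsilon> * \<bar>v i\<bar> \<le> 0" by (simp add: algebra_simps)
    then have "v i = 0" using \<open>\<epsilon> > 0\<close> by (simp add: mult_le_0_iff)
    then show "v k = 0" using imax[OF k] by simp
  qed
qed

lemma lims_mono: "lims I V r \<Longrightarrow> (\<And>\<delta>. V' \<delta> \<subseteq> V \<delta>) \<Longrightarrow> lims I V' r"
  unfolding lims_def by (meson subsetD)

text \<open>High gain at a single vertex \<open>l\<close> visible in \<open>\<beta>\<close> eliminates \<open>l\<close> in the limit, which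
  replaces \<open>g\<close> by its Schur complement; the sign conditions on the \<open>J\<close>-block survive and
  keep all pivots positive.\<close>
lemma observable_row_scaling:
  fixes g :: "'i \<Rightarrow> 'i \<Rightarrow> real"
  assumes "finite Q" "finite J" "Q \<inter> J = {}"
    and "\<And>j. j \<in> J \<Longrightarrow> \<beta> j \<le> 0"
    and "\<And>i j. i \<in> J \<Longrightarrow> j \<in> J \<Longrightarrow> i \<noteq> j \<Longrightarrow> g i j \<le> 0"
    and "\<And>i. i \<in> J \<Longrightarrow> (\<Sum>j\<in>J. g i j) \<ge> 0"
    and "\<And>S. S \<subseteq> J \<Longrightarrow> S \<noteq> {} \<Longrightarrow> (\<exists>j\<in>S. \<beta> j \<noteq> 0) \<or> (\<exists>i\<in>J - S. \<exists>j\<in>S. g i j \<noteq> 0)"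
    and "\<And>S. S \<subseteq> J \<Longrightarrow> S \<noteq> {} \<Longrightarrow> \<exists>i\<in>S. (\<Sum>j\<in>S. g i j) > 0"
  shows "\<exists>a. (\<forall>i. a i > 0) \<and> (\<forall>i\<in>Q. a i = 1) \<and>
    (\<forall>v. (\<forall>i\<in>Q. v i = 0) \<longrightarrow>
      (\<forall>k. dotp (Q \<union> J) \<beta> ((mv (Q \<union> J) (\<lambda>i j. a i * g i j) ^^ k) v) = 0) \<longrightarrow> (\<forall>i\<in>J. v i = 0))"
  using assms(2-)
proof (induction "card J" arbitrary: J g \<beta>)
  case 0
  then show ?case by (intro exI[of _ "\<lambda>_. 1"]) auto
next
  case (Suc n)
  note fin = \<open>finite J\<close> and disj = \<open>Q \<inter> J = {}\<close>
  note \<beta>np = Suc.prems(3) and off = Suc.prems(4) and row = Suc.prems(5)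
    and infl = Suc.prems(6) and grd = Suc.prems(7)
  define I where "I = Q \<union> J"
  have finI: "finite I" using fin assms(1) by (simp add: I_def)
  have "J \<noteq> {}" using Suc.hyps(2) by auto
  \<comment> \<open>For \<open>S = J\<close> no vertex of \<open>J\<close> is left outside, so
    \<open>\<beta>\<close> itself must see a vertex.\<close>
  with infl[of J] obtain l where l: "l \<in> J" "\<beta> l \<noteq> 0" by auto
  have lI: "l \<in> I" and lQ: "l \<notin> Q" using l disj by (auto simp: I_def)
  define p where "p = g l l"
  have p: "p > 0" using grd[of "{l}"] l by (simp add: p_def)
  define J' where "J' = J - {l}"
  define I' where "I' = Q \<union> J'"
  have I': "I' = I - {l}" using lQ by (auto simp: I'_def I_def J'_def)
  have J': "J = insert l J'" "l \<notin> J'" "finite J'" using l fin by (auto simp: J'_def)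
  have split: "(\<Sum>j\<in>I. f j) = f l + (\<Sum>j\<in>I'. f j)" for f :: "'i \<Rightarrow> real"
    unfolding I' by (rule sum.remove[OF finI lI])
  define g' where "g' = (\<lambda>i j. g i j - g i l * g l j / p)"
  define \<beta>' where "\<beta>' = (\<lambda>j. \<beta> j - \<beta> l * g l j / p)"
  have gl: "g' i l = 0" for i using p by (simp add: g'_def p_def)
  have \<beta>l: "\<beta>' l = 0" using p by (simp add: \<beta>'_def p_def)
  have le: "g' i j \<le> g i j" if "i \<in> J'" "j \<in> J'" for i j
  proof -
    have "g i l \<le> 0" "g l j \<le> 0" using off that l by (auto simp: J'_def)
    then have "0 \<le> g i l * g l j / p" using p by (intro divide_nonneg_pos mult_nonpos_nonpos)
    then show ?thesis by (simp add: g'_def)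
  qed
  have \<beta>le: "\<beta>' j \<le> \<beta> j" if "j \<in> J'" for j
  proof -
    have "\<beta> l \<le> 0" "g l j \<le> 0" using off \<beta>np that l by (auto simp: J'_def)
    then have "0 \<le> \<beta> l * g l j / p" using p by (intro divide_nonneg_pos mult_nonpos_nonpos)
    then show ?thesis by (simp add: \<beta>'_def)
  qed
  \<comment> \<open>Column \<open>l\<close> of \<open>g'\<close> vanishes, so \<open>l\<close> may
    be added to the range of summation. Row sums of the Schur complement thus come from row sums of
    \<open>g\<close> by the same elimination.\<close>
  have sumS: "(\<Sum>j\<in>S. g' i j) = (\<Sum>j\<in>insert l S. g i j) - g i l * (\<Sum>j\<in>insert l S. g l j) / p"
    if "S \<subseteq> J'" for S i
  proof -
    have S: "finite S" "l \<notin> S" using that J' by (auto intro: finite_subset)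
    have "(\<Sum>j\<in>S. g' i j) = (\<Sum>j\<in>insert l S. g' i j)" using S gl by simp
    also have "\<dots> = (\<Sum>j\<in>insert l S. g i j) - g i l * (\<Sum>j\<in>insert l S. g l j) / p"
      unfolding g'_def sum_subtractf sum_distrib_left sum_divide_distrib ..
    finally show ?thesis .
  qed
  have rowS: "(\<Sum>j\<in>S. g i j) \<ge> 0" if "S \<subseteq> J" "i \<in> S" for S i
  proof -
    have "(\<Sum>j\<in>J. g i j) = (\<Sum>j\<in>S. g i j) + (\<Sum>j\<in>J - S. g i j)"
      using that fin by (metis add.commute sum.subset_diff)
    moreover have "(\<Sum>j\<in>J - S. g i j) \<le> 0" using off that by (intro sum_nonpos) auto
    ultimately show ?thesis using row[of i] that by force
  qed
  have sumS0: "g i l * (\<Sum>j\<in>insert l S. g l j) / p \<le> 0" if "S \<subseteq> J'" "i \<in> J'" for S i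
  proof -
    have "0 \<le> (\<Sum>j\<in>insert l S. g l j)" using that l by (intro rowS) (auto simp: J'_def)
    moreover have "g i l \<le> 0" using off that l by (auto simp: J'_def)
    ultimately show ?thesis using p by (intro divide_nonpos_pos mult_nonpos_nonneg)
  qed
  have "\<exists>a. (\<forall>i. a i > 0) \<and> (\<forall>i\<in>Q. a i = 1) \<and>
    (\<forall>v. (\<forall>i\<in>Q. v i = 0) \<longrightarrow>
      (\<forall>k. dotp (Q \<union> J') \<beta>' ((mv (Q \<union> J') (\<lambda>i j. a i * g' i j) ^^ k) v) = 0) \<longrightarrow> (\<forall>i\<in>J'. v i = 0))"
  proof (rule Suc.hyps(1))
    show "n = card J'" using Suc.hyps(2) J' by simp
    show "finite J'" by fact
    show "Q \<inter> J' = {}" using disj J' by auto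
    show "\<beta>' j \<le> 0" if "j \<in> J'" for j using \<beta>le[OF that] \<beta>np[of j] that J' by force
    show "g' i j \<le> 0" if "i \<in> J'" "j \<in> J'" "i \<noteq> j" for i j
      using le[OF that(1,2)] off[of i j] that J' by force
    show "0 \<le> (\<Sum>j\<in>J'. g' i j)" if "i \<in> J'" for i
      using sumS[of J' i] sumS0[of J' i] rowS[of J i] that J' by auto
    fix S assume S: "S \<subseteq> J'" "S \<noteq> {}"
    show "\<exists>i\<in>S. 0 < (\<Sum>j\<in>S. g' i j)"
    proof (cases "\<exists>i\<in>S. 0 < (\<Sum>j\<in>insert l S. g i j)")
      case True
      then obtain i where "i \<in> S" "0 < (\<Sum>j\<in>insert l S. g i j)" by blast
      then show ?thesis using sumS[OF S(1), of i] sumS0[OF S(1), of i] S by force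
    next
      case False
      \<comment> \<open>No row of \<open>S\<close> is strict on \<open>insert l S\<close>, so row
        \<open>l\<close> is. A row \<open>i\<close> that is strict on \<open>S\<close> lost this
        through \<open>g i l < 0\<close>, which makes its Schur correction strictly
        positive.\<close>
      have lS: "0 < (\<Sum>j\<in>insert l S. g l j)" using grd[of "insert l S"] False S J' by auto
      obtain i where i: "i \<in> S" "0 < (\<Sum>j\<in>S. g i j)" using grd[of S] S J' by auto
      have "finite S" "l \<notin> S" using S J' by (auto intro: finite_subset)
      then have "(\<Sum>j\<in>insert l S. g i j) = g i l + (\<Sum>j\<in>S. g i j)" by simp
      then have "g i l < 0" using False i by force
      then have "g i l * (\<Sum>j\<in>insert l S. g l j) / p < 0" using lS p
        by (intro divide_neg_pos mult_neg_pos)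
      moreover have "0 \<le> (\<Sum>j\<in>insert l S. g i j)" using i S J' by (intro rowS) auto
      ultimately show ?thesis using sumS[OF S(1), of i] i by (intro bexI[of _ i]) auto
    qed
    show "(\<exists>j\<in>S. \<beta>' j \<noteq> 0) \<or> (\<exists>i\<in>J' - S. \<exists>j\<in>S. g' i j \<noteq> 0)"
    proof (cases "\<exists>j\<in>S. g l j \<noteq> 0")
      case True
      \<comment> \<open>If \<open>l\<close> sees \<open>S\<close>, elimination passes this on to
        \<open>\<beta>'\<close>: the correction has the same sign as \<open>\<beta> j\<close>, so
        nothing cancels.\<close>
      then obtain j where j: "j \<in> S" "g l j < 0" using off[of l] S l J'
        by (metis insertCI less_eq_real_def subsetD)
      then have "\<beta> l * g l j / p > 0" using l \<beta>np[of l] p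
        by (intro divide_pos_pos mult_neg_neg) auto
      moreover have "\<beta> j \<le> 0" using \<beta>np j S J' by auto
      ultimately have "\<beta>' j \<noteq> 0" by (simp add: \<beta>'_def)
      then show ?thesis using j by auto
    next
      case False
      then have "g' i j = g i j" "\<beta>' j = \<beta> j" if "j \<in> S" for i j
        using that by (auto simp: g'_def \<beta>'_def)
      moreover have "(\<exists>j\<in>S. \<beta> j \<noteq> 0) \<or> (\<exists>i\<in>J' - S. \<exists>j\<in>S. g i j \<noteq> 0)"
        using infl[of S] S False J' by auto
      ultimately show ?thesis by auto
    qed
  qed
  then obtain a where a: "\<forall>i. a i > 0" "\<forall>i\<in>Q. a i = 1"
    and obs: "\<And>v. (\<forall>i\<in>Q. v i = 0) \<Longrightarrow>
      (\<forall>k. dotp I' \<beta>' ((mv I' (\<lambda>i j. a i * g' i j) ^^ k) v) = 0) \<Longrightarrow> (\<forall>i\<in>J'. v i = 0)"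
    unfolding I'_def by blast
  \<comment> \<open>Gain \<open>1 / \<delta>\<close> at \<open>l\<close> and the gains
    \<open>a\<close> elsewhere, multiplied by \<open>\<delta>\<close>, give
    \<open>L + \<delta> G\<close>: only row \<open>l\<close> is fast.\<close>
  define L where "L = (\<lambda>i j. if i = l then g l j else 0)"
  define G where "G = (\<lambda>i j. if i = l then 0 else a i * g i j)"
  define V where "V = (\<lambda>\<delta>. {v. \<forall>k. dotp I \<beta> ((mv I (\<lambda>i j. L i j + \<delta> * G i j) ^^ k) v) = 0})"
  \<comment> \<open>Vanishing on \<open>Q\<close> is not preserved by the dynamics. The fast and
    slow steps are therefore taken for the invariant \<open>V\<close>, and the restriction is
    imposed only at the end.\<close>
  define V' where "V' = (\<lambda>\<delta>. {v \<in> V \<delta>. \<forall>i\<in>Q. v i = 0})"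
  have inv: "mv I (\<lambda>i j. L i j + \<delta> * G i j) v \<in> V \<delta>" if "v \<in> V \<delta>" for \<delta> v
  proof -
    have "dotp I \<beta> ((mv I (\<lambda>i j. L i j + \<delta> * G i j) ^^ Suc k) v) = 0" for k
      using that unfolding V_def by blast
    then show ?thesis by (simp add: V_def funpow_Suc_right del: funpow.simps)
  qed
  have rmL: "rm I L r = (\<lambda>j. r l * g l j)" for r
    using finI lI by (auto simp: rm_def L_def if_distrib[of "\<lambda>x. _ * x"] cong: if_cong)
  have "lims I V \<beta>"
  proof (rule lims_const)
    fix \<delta> v assume "v \<in> V \<delta>"
    then have "dotp I \<beta> ((mv I (\<lambda>i j. L i j + \<delta> * G i j) ^^ 0) v) = 0" unfolding V_def by blast
    then show "dotp I \<beta> v = 0" by simp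
  qed
  have "lims I V (rm I L \<beta>)" by (rule lims_fast[where G = G and L = L, OF inv \<open>lims I V \<beta>\<close>])
  from lims_scale[OF this, of "1 / \<beta> l"] have liml: "lims I V (g l)"
    using l by (simp add: rmL)
  have reduce: "lims I V (\<lambda>j. r j - r l * g l j / p)" if "lims I V r" for r
    using lims_add[OF that lims_scale[OF liml, of "- r l / p"]] by simp
  \<comment> \<open>A row with entry 0 at \<open>l\<close> lies in the left kernel of
    \<open>L\<close>, so a slow step applies. The unknown \<open>s L\<close> is a multiple of
    \<open>g l\<close>, and subtracting the right multiple of \<open>g l\<close> restores entry 0 at
    \<open>l\<close>. The outcome is one step of the Schur complement system.\<close>
  have limk: "lims I V ((rm I' (\<lambda>i j. a i * g' i j) ^^ k) \<beta>')
      \<and> (rm I' (\<lambda>i j. a i * g' i j) ^^ k) \<beta>' l = 0" for k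
  proof (induction k)
    case 0
    then show ?case using reduce[OF \<open>lims I V \<beta>\<close>] \<beta>l by (simp add: \<beta>'_def)
  next
    case (Suc k)
    define r where "r = (rm I' (\<lambda>i j. a i * g' i j) ^^ k) \<beta>'"
    have r: "lims I V r" "r l = 0" using Suc by (auto simp: r_def)
    obtain s where "lims I V (\<lambda>j. rm I G r j + rm I L s j)"
      using lims_slow[where G = G and L = L, OF inv r(1)] r(2) by (auto simp: rmL)
    from reduce[OF lims_add[OF this lims_scale[OF liml, of "- s l"]]]
    have "lims I V (\<lambda>j. rm I G r j - rm I G r l * g l j / p)" by (simp add: rmL)
    moreover have "rm I G r j - rm I G r l * g l j / p = rm I' (\<lambda>i j. a i * g' i j) r j" for j
    proof -
      have G: "rm I G r j = (\<Sum>i\<in>I'. r i * (a i * g i j))" for j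
        unfolding rm_def split by (auto simp: r I' G_def intro!: sum.cong)
      have "rm I' (\<lambda>i j. a i * g' i j) r j
          = (\<Sum>i\<in>I'. r i * (a i * g i j) - r i * (a i * g i l) * (g l j / p))"
        by (simp add: rm_def g'_def algebra_simps)
      then show ?thesis unfolding G by (simp add: sum_subtractf sum_distrib_right sum_divide_distrib)
    qed
    ultimately have "lims I V (rm I' (\<lambda>i j. a i * g' i j) r)" by simp
    moreover have "rm I' (\<lambda>i j. a i * g' i j) r l = 0" by (simp add: rm_def gl)
    ultimately show ?case by (simp add: r_def)
  qed
  have sub: "lims I V u \<Longrightarrow> lims I V' u" for u by (erule lims_mono) (auto simp: V'_def)
  have "\<exists>\<delta>>0. \<forall>v\<in>V' \<delta>. \<forall>i\<in>I. v i = 0"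
  proof (rule lims_full[OF finI])
    fix v i assume v: "\<And>u. lims I V' u \<Longrightarrow> dotp I u v = 0" and i: "i \<in> I"
    have vQ: "\<forall>j\<in>Q. v j = 0"
    proof
      fix j assume j: "j \<in> Q"
      have "lims I V' (\<lambda>i. if i = j then 1 else 0)"
        by (rule lims_const) (use j finI in \<open>auto simp: I_def V'_def dotp_unit_left\<close>)
      from v[OF this] show "v j = 0" using j finI by (simp add: I_def dotp_unit_left)
    qed
    have "dotp I' \<beta>' ((mv I' (\<lambda>i j. a i * g' i j) ^^ k) v) = 0" for k
      using v[OF sub[OF conjunct1[OF limk[of k]]]] conjunct2[OF limk[of k]]
      unfolding dotp_rm_pow[symmetric] by (simp add: dotp_def split)
    then have vJ: "\<forall>i\<in>J'. v i = 0" using obs vQ by blast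
    then have "dotp I (g l) v = p * v l" using vQ
      unfolding dotp_def split by (auto simp: p_def I'_def intro!: sum.neutral)
    then have "v l = 0" using v[OF sub[OF liml]] p by simp
    then show "v i = 0" using i vQ vJ J' by (auto simp: I_def)
  qed
  then obtain \<delta> where \<delta>: "\<delta> > 0" "\<And>v i. v \<in> V' \<delta> \<Longrightarrow> i \<in> I \<Longrightarrow> v i = 0" by blast
  define b where "b = a(l := 1 / \<delta>)"
  have LG: "(\<lambda>i j. L i j + \<delta> * G i j) = (\<lambda>i j. \<delta> * (b i * g i j))"
    using \<delta> by (auto simp: L_def G_def b_def fun_eq_iff)
  show ?case
  proof (intro exI[of _ b] conjI allI impI ballI)
    show "b i > 0" for i using a \<delta> by (simp add: b_def)
    show "b i = 1" if "i \<in> Q" for i using a lQ that by (auto simp: b_def)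
    fix v i assume v: "\<forall>i\<in>Q. v i = 0"
      "\<forall>k. dotp (Q \<union> J) \<beta> ((mv (Q \<union> J) (\<lambda>i j. b i * g i j) ^^ k) v) = 0" and i: "i \<in> J"
    have "v \<in> V' \<delta>" using v unfolding V'_def V_def LG I_def mv_pow_scale dotp_scale_right by simp
    then show "v i = 0" using \<delta>(2) i by (auto simp: I_def)
  qed
qed

section \<open>Determinants, linear dependence and Krylov sequences\<close>

lemma det_nonzero_iff_kernel_trivial:
  fixes M :: "nat \<Rightarrow> nat \<Rightarrow> 'a::field"
  shows "det (mat d d (\<lambda>(i, j). M i j)) \<noteq> 0 \<longleftrightarrow>
    (\<forall>v. (\<forall>i<d. (\<Sum>j<d. M i j * v j) = 0) \<longrightarrow> (\<forall>j<d. v j = 0))" (is "det ?A \<noteq> 0 \<longleftrightarrow> ?R")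
proof -
  have A: "?A \<in> carrier_mat d d" by simp
  have entry: "(?A *\<^sub>v vec d v) $ i = (\<Sum>j<d. M i j * v j)" if "i < d" for v i
    using that by (simp add: scalar_prod_def lessThan_atLeast0)
  have mult: "?A *\<^sub>v vec d v = 0\<^sub>v d \<longleftrightarrow> (\<forall>i<d. (\<Sum>j<d. M i j * v j) = 0)" for v
    unfolding vec_eq_iff using entry[of _ v] by simp
  have zero: "vec d v = 0\<^sub>v d \<longleftrightarrow> (\<forall>j<d. v j = 0)" for v :: "nat \<Rightarrow> 'a" by (auto simp: vec_eq_iff)
  have "det ?A = 0 \<longleftrightarrow> (\<exists>v. v \<in> carrier_vec d \<and> v \<noteq> 0\<^sub>v d \<and> ?A *\<^sub>v v = 0\<^sub>v d)"
    by (rule det_0_iff_vec_prod_zero[OF A])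
  also have "\<dots> \<longleftrightarrow> (\<exists>v. vec d v \<noteq> 0\<^sub>v d \<and> ?A *\<^sub>v vec d v = 0\<^sub>v d)"
  proof
    assume "\<exists>v. v \<in> carrier_vec d \<and> v \<noteq> 0\<^sub>v d \<and> ?A *\<^sub>v v = 0\<^sub>v d"
    then obtain v where v: "v \<in> carrier_vec d" "v \<noteq> 0\<^sub>v d" "?A *\<^sub>v v = 0\<^sub>v d" by blast
    have "vec d (\<lambda>i. v $ i) = v" using v(1) by auto
    then show "\<exists>v. vec d v \<noteq> 0\<^sub>v d \<and> ?A *\<^sub>v vec d v = 0\<^sub>v d" using v by metis
  qed (meson vec_carrier)
  finally show ?thesis unfolding mult zero by blast
qed

lemma left_kernel_if_right_kernel:
  fixes M :: "nat \<Rightarrow> nat \<Rightarrow> 'a::field"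
  assumes "\<forall>i<d. (\<Sum>j<d. M i j * v j) = 0" "\<exists>j<d. v j \<noteq> 0"
  shows "\<exists>w. (\<exists>i<d. w i \<noteq> 0) \<and> (\<forall>j<d. (\<Sum>i<d. w i * M i j) = 0)"
proof -
  have "det (mat d d (\<lambda>(i, j). M i j)) = 0"
    using assms det_nonzero_iff_kernel_trivial[of d M] by blast
  moreover have "det (mat d d (\<lambda>(i, j). M j i)) = det (mat d d (\<lambda>(i, j). M i j))"
    by (subst det_transpose[symmetric]) (auto intro!: arg_cong[of _ _ det])
  ultimately show ?thesis
    using det_nonzero_iff_kernel_trivial[of d "\<lambda>i j. M j i"] by (auto simp: mult.commute)
qed

text \<open>Padding the \<open>n + 1\<close> rows by a zero column gives a square matrix with the
  last unit vector in its right kernel; a left kernel vector is the dependence.\<close>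

lemma linear_dependence:
  fixes r :: "nat \<Rightarrow> nat \<Rightarrow> 'a::field"
  shows "\<exists>c. (\<exists>j\<le>n. c j \<noteq> 0) \<and> (\<forall>i<n. (\<Sum>j\<le>n. c j * r j i) = 0)"
proof -
  define M where "M = (\<lambda>j i. if i < n then r j i else 0)"
  have "\<exists>w. (\<exists>i<Suc n. w i \<noteq> 0) \<and> (\<forall>j<Suc n. (\<Sum>i<Suc n. w i * M i j) = 0)"
    by (rule left_kernel_if_right_kernel[where v = "\<lambda>i. if i = n then 1 else 0"])
      (auto simp: M_def intro!: sum.neutral)
  then obtain w where w: "\<exists>i<Suc n. w i \<noteq> 0" "\<forall>j<Suc n. (\<Sum>i<Suc n. w i * M i j) = 0" by blast
  have "(\<Sum>j\<le>n. w j * r j i) = 0" if "i < n" for i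
    using w(2)[rule_format, of i] that by (simp add: M_def lessThan_Suc_atMost)
  moreover have "\<exists>j\<le>n. w j \<noteq> 0" using w(1) less_Suc_eq_le by blast
  ultimately show ?thesis by blast
qed

text \<open>The rows \<open>c, c M, ..., c M^n\<close> are dependent, so the output sequence obeys a
  linear recurrence of order at most \<open>n\<close>.\<close>

lemma krylov_stable:
  fixes M :: "nat \<Rightarrow> nat \<Rightarrow> 'a::field"
  assumes "\<And>k. k < n \<Longrightarrow> dotp {..<n} c ((mv {..<n} M ^^ k) v) = 0"
  shows "dotp {..<n} c ((mv {..<n} M ^^ k) v) = 0"
proof -
  obtain \<alpha> where \<alpha>: "\<exists>j\<le>n. \<alpha> j \<noteq> 0" "\<forall>i<n. (\<Sum>j\<le>n. \<alpha> j * (rm {..<n} M ^^ j) c i) = 0"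
    using linear_dependence[of n "\<lambda>j. (rm {..<n} M ^^ j) c"] by blast
  define f where "f = (\<lambda>k. dotp {..<n} c ((mv {..<n} M ^^ k) v))"
  have rec: "(\<Sum>j\<le>n. \<alpha> j * f (j + t)) = 0" for t
  proof -
    have "(\<Sum>j\<le>n. \<alpha> j * f (j + t)) = (\<Sum>j\<le>n. \<alpha> j * dotp {..<n} ((rm {..<n} M ^^ j) c) ((mv {..<n} M ^^ t) v))"
      by (simp add: f_def dotp_rm_pow funpow_add)
    also have "\<dots> = (\<Sum>j\<le>n. \<Sum>i<n. \<alpha> j * (rm {..<n} M ^^ j) c i * (mv {..<n} M ^^ t) v i)"
      by (simp add: dotp_def sum_distrib_left mult.assoc)
    also have "\<dots> = (\<Sum>i<n. (\<Sum>j\<le>n. \<alpha> j * (rm {..<n} M ^^ j) c i) * (mv {..<n} M ^^ t) v i)"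
      by (subst sum.swap) (simp add: sum_distrib_right)
    also have "\<dots> = 0" using \<alpha>(2) by simp
    finally show ?thesis .
  qed
  \<comment> \<open>The recurrence is solved for its last term with nonzero coefficient, whose index
    may be below \<open>n\<close>.\<close>
  define J where "J = Max {j. j \<le> n \<and> \<alpha> j \<noteq> 0}"
  have "J \<in> {j. j \<le> n \<and> \<alpha> j \<noteq> 0}" unfolding J_def using \<alpha>(1) by (intro Max_in) auto
  then have J: "J \<le> n" "\<alpha> J \<noteq> 0" by auto
  have Jmax: "\<alpha> j = 0" if "j \<le> n" "j > J" for j
  proof (rule ccontr)
    assume "\<alpha> j \<noteq> 0"
    then have "j \<le> J" unfolding J_def using that by (intro Max_ge) auto
    then show False using that by simp
  qed
  have "f k = 0"
  proof (induction k rule: less_induct)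
    case (less k)
    show ?case
    proof (cases "k < n")
      case True
      then show ?thesis using assms by (simp add: f_def)
    next
      case False
      define t where "t = k - J"
      have kt: "k = J + t" using False J by (simp add: t_def)
      have "0 = (\<Sum>j\<le>n. \<alpha> j * f (j + t))" using rec by simp
      also have "\<dots> = (\<Sum>j\<in>{J}. \<alpha> j * f (j + t))"
      proof (rule sum.mono_neutral_right)
        show "\<forall>j\<in>{..n} - {J}. \<alpha> j * f (j + t) = 0"
        proof
          fix j assume j: "j \<in> {..n} - {J}"
          show "\<alpha> j * f (j + t) = 0"
          proof (cases "j < J")
            case True
            then show ?thesis using less[of "j + t"] kt by simp
          next
            case False
            then show ?thesis using j Jmax[of j] by simp
          qed
        qed
      qed (use J in auto)
      finally show ?thesis using J kt by simp
    qed
  qed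
  then show ?thesis by (simp add: f_def)
qed

text \<open>Dual of Heymann's lemma. A maximal independent chain \<open>r\<^sub>0 = c\<close>, \<open>r\<^sub>j\<^sub>+\<^sub>1 = r\<^sub>j A + \<kappa>\<^sub>j C\<close> spans
  everything, and \<open>K\<close> is chosen with \<open>r\<^sub>j K = \<kappa>\<^sub>j\<close>, so that \<open>r\<^sub>j = c (A + K C)\<^sup>j\<close>.\<close>
lemma output_injection_observable:
  fixes A :: "nat \<Rightarrow> nat \<Rightarrow> real" and C :: "'p \<Rightarrow> nat \<Rightarrow> real"
  assumes I_def: "I = {..<n}" and P: "finite P" and c: "\<exists>i\<in>I. c i \<noteq> 0"
    and obs: "\<And>v. (\<And>p t. p \<in> P \<Longrightarrow> dotp I (C p) ((mv I A ^^ t) v) = 0) \<Longrightarrow> (\<forall>i\<in>I. v i = 0)"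
  shows "\<exists>K. \<forall>v. (\<forall>t. dotp I c ((mv I (\<lambda>a b. A a b + (\<Sum>p\<in>P. K a p * C p b)) ^^ t) v) = 0)
    \<longrightarrow> (\<forall>i\<in>I. v i = 0)"
proof -
  have finI: "finite I" by (simp add: I_def)
  define chain where "chain = (\<lambda>k r \<kappa>. r 0 = c \<and>
    (\<forall>j<k. \<forall>i\<in>I. r (Suc j) i = rm I A (r j) i + (\<Sum>p\<in>P. \<kappa> j p * C p i)) \<and>
    (\<forall>x. (\<forall>i\<in>I. (\<Sum>j\<le>k. x j * r j i) = 0) \<longrightarrow> (\<forall>j\<le>k. x j = (0::real))))"
  have bound: "k < n" if "chain k r \<kappa>" for k r \<kappa>
  proof (rule ccontr)
    assume "\<not> k < n"
    then have nk: "n \<le> k" by simp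
    from linear_dependence[of n r] obtain x where
      x: "\<exists>j\<le>n. x j \<noteq> 0" "\<forall>i<n. (\<Sum>j\<le>n. x j * r j i) = 0" by blast
    define x' where "x' = (\<lambda>j. if j \<le> n then x j else 0)"
    have "(\<Sum>j\<le>k. x' j * r j i) = (\<Sum>j\<le>n. x j * r j i)" for i
      by (rule sum.mono_neutral_cong_right) (use nk in \<open>auto simp: x'_def\<close>)
    then have "\<forall>i\<in>I. (\<Sum>j\<le>k. x' j * r j i) = 0" using x(2) by (simp add: I_def)
    moreover have "\<forall>x. (\<forall>i\<in>I. (\<Sum>j\<le>k. x j * r j i) = 0) \<longrightarrow> (\<forall>j\<le>k. x j = 0)"
      using that unfolding chain_def by blast
    ultimately have "\<forall>j\<le>k. x' j = 0" by blast
    moreover obtain j where "j \<le> n" "x j \<noteq> 0" using x(1) by blast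
    ultimately show False using nk by (auto simp: x'_def dest!: spec[of _ j])
  qed
  have "chain 0 (\<lambda>_. c) (\<lambda>_ _. 0)" unfolding chain_def using c by auto
  then have ex: "\<exists>k r \<kappa>. chain k r \<kappa>" by blast
  define k where "k = (GREATEST k. \<exists>r \<kappa>. chain k r \<kappa>)"
  have "\<exists>r \<kappa>. chain k r \<kappa>" unfolding k_def
    by (rule GreatestI_ex_nat[OF ex, of n]) (use bound less_imp_le in blast)
  then obtain r \<kappa> where rk: "chain k r \<kappa>" by blast
  have nochain: "\<not> chain (Suc k) r' \<kappa>'" for r' \<kappa>'
    using Greatest_le_nat[of "\<lambda>k. \<exists>r \<kappa>. chain k r \<kappa>" "Suc k" n] bound less_imp_le
    unfolding k_def[symmetric] by (metis Suc_n_not_le_n)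
  have r0: "r 0 = c"
    and rS: "\<And>j i. j < k \<Longrightarrow> i \<in> I \<Longrightarrow> r (Suc j) i = rm I A (r j) i + (\<Sum>p\<in>P. \<kappa> j p * C p i)"
    and indep: "\<And>x. (\<forall>i\<in>I. (\<Sum>j\<le>k. x j * r j i) = 0) \<Longrightarrow> (\<forall>j\<le>k. x j = 0)"
    using rk unfolding chain_def by blast+
  define U where "U = {u. \<exists>x. \<forall>i\<in>I. u i = (\<Sum>j\<le>k. x j * r j i)}"
  have Uadd: "(\<lambda>i. u i + w i) \<in> U" if "u \<in> U" "w \<in> U" for u w
  proof -
    from that obtain x y where "\<forall>i\<in>I. u i = (\<Sum>j\<le>k. x j * r j i)" "\<forall>i\<in>I. w i = (\<Sum>j\<le>k. y j * r j i)"
      by (auto simp: U_def)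
    then show ?thesis unfolding U_def
      by (auto intro!: exI[of _ "\<lambda>j. x j + y j"] simp: sum.distrib distrib_right)
  qed
  have Uscale: "(\<lambda>i. s * u i) \<in> U" if "u \<in> U" for u s
  proof -
    from that obtain x where "\<forall>i\<in>I. u i = (\<Sum>j\<le>k. x j * r j i)" by (auto simp: U_def)
    then show ?thesis unfolding U_def
      by (auto intro!: exI[of _ "\<lambda>j. s * x j"] simp: sum_distrib_left mult.assoc)
  qed
  have Ucong: "u \<in> U" if "w \<in> U" "\<forall>i\<in>I. u i = w i" for u w using that by (auto simp: U_def)
  have Ur: "r j \<in> U" if "j \<le> k" for j
    unfolding U_def using that
    by (auto intro!: exI[of _ "\<lambda>i. if i = j then 1 else 0"] simp: if_distrib[of "\<lambda>x. x * _"] cong: if_cong)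
  \<comment> \<open>By maximality every continuation of the chain falls into \<open>U\<close>,
    whatever injection \<open>\<rho>\<close> is used. Differences of two continuations put all rows
    of \<open>C\<close> into \<open>U\<close>, and then \<open>U\<close> is invariant under
    \<open>A\<close>.\<close>
  have stuck: "(\<lambda>i. rm I A (r k) i + (\<Sum>p\<in>P. \<rho> p * C p i)) \<in> U" for \<rho>
  proof -
    define s where "s = (\<lambda>i. rm I A (r k) i + (\<Sum>p\<in>P. \<rho> p * C p i))"
    define r' where "r' = (\<lambda>j. if j = Suc k then s else r j)"
    have "\<not> chain (Suc k) r' (\<kappa>(k := \<rho>))" by (rule nochain)
    moreover have "r' 0 = c" by (simp add: r'_def r0)
    moreover have "r' (Suc j) i = rm I A (r' j) i + (\<Sum>p\<in>P. (\<kappa>(k := \<rho>)) j p * C p i)" if "j < Suc k" "i \<in> I" for i j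
      using that rS[of j i] by (auto simp: r'_def s_def less_Suc_eq)
    ultimately obtain x where x: "\<forall>i\<in>I. (\<Sum>j\<le>Suc k. x j * r' j i) = 0" "\<exists>j\<le>Suc k. x j \<noteq> 0"
      unfolding chain_def by blast
    have sum: "(\<Sum>j\<le>k. x j * r j i) + x (Suc k) * s i = 0" if "i \<in> I" for i
      using x(1) that by (simp add: r'_def)
    have "x (Suc k) \<noteq> 0"
    proof
      assume "x (Suc k) = 0"
      then have "\<forall>j\<le>k. x j = 0" using sum by (intro indep) auto
      then show False using x(2) \<open>x (Suc k) = 0\<close> by (auto simp: le_Suc_eq)
    qed
    have "\<forall>i\<in>I. s i = (\<Sum>j\<le>k. (- x j / x (Suc k)) * r j i)"
    proof
      fix i assume "i \<in> I"
      have "s i = - (\<Sum>j\<le>k. x j * r j i) / x (Suc k)"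
        using sum[OF \<open>i \<in> I\<close>] \<open>x (Suc k) \<noteq> 0\<close> by (simp add: field_simps eq_neg_iff_add_eq_0)
      then show "s i = (\<Sum>j\<le>k. (- x j / x (Suc k)) * r j i)"
        by (simp add: sum_negf sum_divide_distrib)
    qed
    then show ?thesis unfolding U_def s_def[symmetric] by (intro CollectI exI)
  qed
  have UC: "C p \<in> U" if "p \<in> P" for p
  proof -
    have "(\<lambda>i. (rm I A (r k) i + (\<Sum>p'\<in>P. (if p' = p then 1 else 0) * C p' i))
        + (-1) * (rm I A (r k) i + (\<Sum>p'\<in>P. 0 * C p' i))) \<in> U"
      by (intro Uadd Uscale stuck)
    then show ?thesis using P that by (simp add: if_distrib[of "\<lambda>x. x * _"] cong: if_cong)
  qed
  have Uout: "(\<lambda>i. \<Sum>p\<in>P. \<rho> p * C p i) \<in> U" for \<rho>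
  proof -
    have "(\<lambda>i. (rm I A (r k) i + (\<Sum>p\<in>P. \<rho> p * C p i))
        + (-1) * (rm I A (r k) i + (\<Sum>p'\<in>P. 0 * C p' i))) \<in> U"
      by (intro Uadd Uscale stuck)
    then show ?thesis by simp
  qed
  have UrA: "rm I A (r j) \<in> U" if "j \<le> k" for j
  proof (cases "j = k")
    case True
    then show ?thesis using stuck[of "\<lambda>_. 0"] by simp
  next
    case False
    have "(\<lambda>i. r (Suc j) i + (-1) * (\<Sum>p\<in>P. \<kappa> j p * C p i)) \<in> U"
      using that False by (intro Uadd Uscale Uout Ur) auto
    then show ?thesis by (rule Ucong) (use rS[of j] that False in auto)
  qed
  have UA: "rm I A u \<in> U" if "u \<in> U" for u
  proof -
    from that obtain x where x: "\<forall>i\<in>I. u i = (\<Sum>j\<le>k. x j * r j i)" by (auto simp: U_def)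
    have "(\<lambda>i. \<Sum>j\<in>S. x j * rm I A (r j) i) \<in> U" if "finite S" "S \<subseteq> {..k}" for S
      using that
    proof (induction S rule: finite_induct)
      case empty
      then show ?case unfolding U_def by (auto intro!: exI[of _ "\<lambda>_. 0"])
    next
      case (insert j S)
      then show ?case using Uadd[OF Uscale[OF UrA[of j], of "x j"]] by simp
    qed
    then have "(\<lambda>i. \<Sum>j\<le>k. x j * rm I A (r j) i) \<in> U" by simp
    moreover have "rm I A u i = (\<Sum>j\<le>k. x j * rm I A (r j) i)" for i
    proof -
      have "rm I A u i = (\<Sum>a\<in>I. \<Sum>j\<le>k. x j * r j a * A a i)"
        using x by (simp add: rm_def sum_distrib_right)
      then show ?thesis by (subst (asm) sum.swap) (simp add: rm_def sum_distrib_left mult.assoc)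
    qed
    ultimately show ?thesis using Ucong by blast
  qed
  have ann: "\<forall>i\<in>I. v i = 0" if v: "\<And>u. u \<in> U \<Longrightarrow> dotp I u v = 0" for v
  proof (rule obs)
    fix p t assume "p \<in> P"
    have "(rm I A ^^ t) (C p) \<in> U" by (induction t) (use UA UC \<open>p \<in> P\<close> in auto)
    from v[OF this] show "dotp I (C p) ((mv I A ^^ t) v) = 0" by (simp add: dotp_rm_pow)
  qed
  \<comment> \<open>Independence of the \<open>r j\<close> allows any prescribed values. The last
    row \<open>r k\<close> has no successor in the chain, so 0 is a default there.\<close>
  have "\<exists>y. \<forall>j\<le>k. dotp I (r j) y = (if j < k then \<kappa> j p else 0)" for p
  proof -
    define W where "W = {\<lambda>j. dotp I (r j) y |y. True}"
    have "\<exists>u\<in>W. \<forall>j\<in>{..k}. u j = (if j < k then \<kappa> j p else 0)"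
    proof (rule annihilator_dual)
      show "(\<lambda>j. 0) \<in> W" unfolding W_def by (auto intro!: exI[of _ "\<lambda>_. 0"] simp: dotp_def)
      show "(\<lambda>i. u i + w i) \<in> W" if uw: "u \<in> W" "w \<in> W" for u w
      proof -
        from uw obtain y z where "u = (\<lambda>j. dotp I (r j) y)" "w = (\<lambda>j. dotp I (r j) z)"
          by (auto simp: W_def)
        then show ?thesis unfolding W_def
          by (auto intro!: exI[of _ "\<lambda>i. y i + z i"] simp: dotp_def sum.distrib distrib_left)
      qed
      show "(\<lambda>i. s * u i) \<in> W" if "u \<in> W" for s u
        using that unfolding W_def by (auto simp: dotp_scale_right[symmetric])
      fix x assume x: "\<And>u. u \<in> W \<Longrightarrow> dotp {..k} u x = 0"
      have "\<forall>j\<le>k. x j = 0"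
      proof (rule indep, rule ballI)
        fix i assume i: "i \<in> I"
        have "dotp {..k} (\<lambda>j. dotp I (r j) (\<lambda>a. if a = i then 1 else 0)) x = 0"
          by (rule x) (auto simp: W_def)
        then show "(\<Sum>j\<le>k. x j * r j i) = 0"
          unfolding dotp_unit[OF finI i] by (simp add: dotp_def mult.commute)
      qed
      then show "dotp {..k} (\<lambda>j. if j < k then \<kappa> j p else 0) x = 0" by (simp add: dotp_def)
    qed simp
    then obtain y where "\<forall>j\<in>{..k}. dotp I (r j) y = (if j < k then \<kappa> j p else 0)"
      unfolding W_def by blast
    then show ?thesis by (intro exI[of _ y]) simp
  qed
  then obtain K where K: "\<And>p j. j \<le> k \<Longrightarrow> dotp I (r j) (K p) = (if j < k then \<kappa> j p else 0)" by metis
  define A' where "A' = (\<lambda>a b. A a b + (\<Sum>p\<in>P. K p a * C p b))"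
  have step: "rm I A' (r j) i = r (Suc j) i" if "j < k" "i \<in> I" for i j
  proof -
    have "rm I A' (r j) i = rm I A (r j) i + (\<Sum>a\<in>I. \<Sum>p\<in>P. r j a * K p a * C p i)"
      by (simp add: rm_def A'_def sum.distrib distrib_left sum_distrib_left mult.assoc)
    also have "(\<Sum>a\<in>I. \<Sum>p\<in>P. r j a * K p a * C p i) = (\<Sum>p\<in>P. dotp I (r j) (K p) * C p i)"
      by (subst sum.swap) (simp add: dotp_def sum_distrib_right)
    finally show ?thesis using that rS[of j i] K[of j] by simp
  qed
  show ?thesis
  proof (intro exI[of _ "\<lambda>a p. K p a"] allI impI)
    fix v assume v: "\<forall>t. dotp I c ((mv I (\<lambda>a b. A a b + (\<Sum>p\<in>P. K p a * C p b)) ^^ t) v) = 0"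
    have pow: "\<forall>i\<in>I. (rm I A' ^^ j) c i = r j i" if "j \<le> k" for j
      using that
    proof (induction j)
      case (Suc j)
      have "rm I A' ((rm I A' ^^ j) c) = rm I A' (r j)"
        using Suc by (intro rm_cong) auto
      then show ?case using Suc step[of j] by simp
    qed (simp add: r0)
    have rv: "dotp I (r j) v = 0" if "j \<le> k" for j
    proof -
      have "dotp I (r j) v = dotp I ((rm I A' ^^ j) c) v" using pow[OF that] by (intro dotp_cong) auto
      also have "\<dots> = 0" using v by (simp add: dotp_rm_pow A'_def)
      finally show ?thesis .
    qed
    show "\<forall>i\<in>I. v i = 0"
    proof (rule ann)
      fix u assume "u \<in> U"
      then obtain x where "\<forall>i\<in>I. u i = (\<Sum>j\<le>k. x j * r j i)" by (auto simp: U_def)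
      then have "dotp I u v = (\<Sum>i\<in>I. \<Sum>j\<le>k. x j * r j i * v i)"
        by (simp add: dotp_def sum_distrib_right)
      also have "\<dots> = (\<Sum>j\<le>k. x j * dotp I (r j) v)"
        by (subst sum.swap) (simp add: dotp_def sum_distrib_left mult.assoc)
      finally show "dotp I u v = 0" using rv by simp
    qed
  qed
qed

section \<open>Irreducible Laplacians\<close>

lemma sum_neg_nonpos_ex:
  fixes f :: "'a \<Rightarrow> real"
  assumes "finite S" "\<And>x. x \<in> S \<Longrightarrow> f x \<le> 0" "x \<in> S" "f x < 0"
  shows "sum f S < 0"
  using sum_pos2[of S x "\<lambda>x. - f x"] assms by (simp add: sum_negf)

text \<open>The last clause is strong connectivity in terms of cuts: every proper vertex set has a
  row that depends on a vertex outside. The later arguments use it on sets and on their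
  complements.\<close>

definition irreducible_laplacian :: "nat \<Rightarrow> (nat \<Rightarrow> nat \<Rightarrow> real) \<Rightarrow> bool" where
  "irreducible_laplacian m g \<longleftrightarrow> (\<forall>i<m. (\<Sum>j<m. g i j) = 0) \<and>
    (\<forall>i<m. \<forall>j<m. i \<noteq> j \<longrightarrow> g i j \<le> 0) \<and>
    (\<forall>S\<subseteq>{..<m}. S \<noteq> {} \<longrightarrow> S \<noteq> {..<m} \<longrightarrow> (\<exists>i\<in>S. \<exists>j\<in>{..<m} - S. g i j < 0))"

lemma irreducible_laplacian_subset_sum_pos:
  assumes "irreducible_laplacian m g" "S \<subseteq> {..<m}" "S \<noteq> {}" "S \<noteq> {..<m}"
  shows "\<exists>i\<in>S. (\<Sum>j\<in>S. g i j) > 0"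
proof -
  from assms obtain i j where ij: "i \<in> S" "j \<in> {..<m} - S" "g i j < 0"
    unfolding irreducible_laplacian_def by blast
  have "(\<Sum>j\<in>{..<m} - S. g i j) < 0"
    by (rule sum_neg_nonpos_ex) (use ij assms in \<open>auto simp: irreducible_laplacian_def\<close>)
  moreover have "(\<Sum>j<m. g i j) = (\<Sum>j\<in>S. g i j) + (\<Sum>j\<in>{..<m} - S. g i j)"
    using assms(2) by (metis add.commute finite_lessThan sum.subset_diff)
  moreover have "(\<Sum>j<m. g i j) = 0" using assms ij by (auto simp: irreducible_laplacian_def)
  ultimately show ?thesis using ij by (intro bexI[of _ i]) auto
qed

lemma irreducible_laplacian_subset_sum:
  assumes "irreducible_laplacian m g" "S \<subseteq> {..<m}" "i < m"
  shows "i \<in> S \<Longrightarrow> (\<Sum>j\<in>S. g i j) \<ge> 0" and "i \<notin> S \<Longrightarrow> (\<Sum>j\<in>S. g i j) \<le> 0"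
proof -
  have "(\<Sum>j<m. g i j) = (\<Sum>j\<in>S. g i j) + (\<Sum>j\<in>{..<m} - S. g i j)"
    using assms(2) by (metis add.commute finite_lessThan sum.subset_diff)
  moreover have "(\<Sum>j<m. g i j) = 0" using assms by (auto simp: irreducible_laplacian_def)
  moreover have "i \<in> S \<Longrightarrow> (\<Sum>j\<in>{..<m} - S. g i j) \<le> 0"
    by (rule sum_nonpos) (use assms in \<open>auto simp: irreducible_laplacian_def\<close>)
  ultimately show "i \<in> S \<Longrightarrow> (\<Sum>j\<in>S. g i j) \<ge> 0" by simp
  show "i \<notin> S \<Longrightarrow> (\<Sum>j\<in>S. g i j) \<le> 0"
    by (rule sum_nonpos) (use assms in \<open>auto simp: irreducible_laplacian_def\<close>)
qed

text \<open>Perron-Frobenius for Laplacians. The all-ones vector makes \<open>g\<close> singular, so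
  a left kernel vector exists; by irreducibility its set of positive entries cannot be a proper
  subset.\<close>

lemma irreducible_laplacian_positive_left_kernel:
  assumes irr: "irreducible_laplacian m g" and m: "m \<ge> 1"
  shows "\<exists>w. (\<forall>i<m. w i > 0) \<and> (\<forall>j<m. (\<Sum>i<m. w i * g i j) = 0)"
proof -
  have "\<exists>w. (\<exists>i<m. w i \<noteq> 0) \<and> (\<forall>j<m. (\<Sum>i<m. w i * g i j) = 0)"
    by (rule left_kernel_if_right_kernel[where v = "\<lambda>_. 1"])
      (use irr m in \<open>auto simp: irreducible_laplacian_def intro!: exI[of _ 0]\<close>)
  then obtain w i0 where w: "i0 < m" "w i0 \<noteq> 0" "\<And>j. j < m \<Longrightarrow> (\<Sum>i<m. w i * g i j) = 0" by blast
  define u where "u = (\<lambda>i. (if w i0 > 0 then 1 else -1) * w i)"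
  have u: "u i0 > 0" "\<And>j. j < m \<Longrightarrow> (\<Sum>i<m. u i * g i j) = 0"
    using w by (auto simp: u_def sum_negf)
  define S where "S = {i. i < m \<and> u i > 0}"
  have S: "S \<subseteq> {..<m}" "S \<noteq> {}" using w u by (auto simp: S_def)
  have "S = {..<m}"
  proof (rule ccontr)
    assume "S \<noteq> {..<m}"
    with irreducible_laplacian_subset_sum_pos[OF irr S] obtain i where
      i: "i \<in> S" "(\<Sum>j\<in>S. g i j) > 0" by blast
    \<comment> \<open>Adding the columns in \<open>S\<close> pairs each \<open>u i\<close> with a
      partial row sum of the same sign: nonnegative for \<open>i\<close> in \<open>S\<close>,
      nonpositive otherwise. One term is strictly positive.\<close>
    have "(\<Sum>j\<in>S. \<Sum>i<m. u i * g i j) = 0" by (rule sum.neutral) (use S u in blast)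
    then have "0 = (\<Sum>j\<in>S. \<Sum>i<m. u i * g i j)" by simp
    also have "\<dots> = (\<Sum>i<m. u i * (\<Sum>j\<in>S. g i j))"
      by (subst sum.swap) (simp add: sum_distrib_left)
    also have "\<dots> > 0"
    proof (rule sum_pos2[of _ i])
      show "0 \<le> u i * (\<Sum>j\<in>S. g i j)" if "i \<in> {..<m}" for i
        using irreducible_laplacian_subset_sum[OF irr S(1), of i] that
        by (cases "u i > 0") (auto simp: S_def intro!: mult_nonneg_nonneg mult_nonpos_nonpos)
    qed (use i S in \<open>auto simp: S_def\<close>)
    finally show False by simp
  qed
  then show ?thesis using u by (intro exI[of _ u]) (auto simp: S_def)
qed

lemma sum_fibre:
  fixes h :: "'a \<Rightarrow> 'c::comm_monoid_add"
  assumes "finite S"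
  shows "(\<Sum>x\<in>S. if b = snd x then h (fst x) else 0) = (\<Sum>j\<in>{j. (j, b) \<in> S}. h j)"
proof -
  have "(\<Sum>x\<in>S. if b = snd x then h (fst x) else 0) = (\<Sum>x\<in>(\<lambda>j. (j, b)) ` {j. (j, b) \<in> S}. h (fst x))"
    by (rule sum.mono_neutral_cong_right) (use assms in auto)
  also have "\<dots> = (\<Sum>j\<in>{j. (j, b) \<in> S}. h j)"
    by (subst sum.reindex) (auto simp: inj_on_def)
  finally show ?thesis .
qed

text \<open>Diagonal except at agent \<open>q\<close>, where row \<open>a0\<close> gets
  \<open>\<kappa>\<close> in every column. This is a rank-one change of a diagonal matrix, so the
  inverse of each block is explicit.\<close>

definition fast_gain :: "nat \<Rightarrow> nat \<Rightarrow> (nat \<Rightarrow> nat \<Rightarrow> real) \<Rightarrow> real \<Rightarrow> nat \<Rightarrow> nat \<Rightarrow> nat \<Rightarrow> real" where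
  "fast_gain q a0 \<alpha> \<kappa> i a b = (if a = b then \<alpha> i a else 0) + (if i = q \<and> a = a0 then \<kappa> else 0)"

text \<open>The gain \<open>\<kappa>\<close> feeds every component of the disagreement into the one component of agent \<open>q\<close>
  that \<open>c\<close> certainly sees, so that the first row \<open>\<beta>\<close> of the elimination has one sign.\<close>
lemma consensus_observable:
  fixes g :: "nat \<Rightarrow> nat \<Rightarrow> real" and c :: "nat \<Rightarrow> real"
  assumes I_def: "I = {..<m} \<times> {..<n}" and irr: "irreducible_laplacian m g" and q: "q < m" and a0: "a0 < n" "c a0 = 1"
  shows "\<exists>\<alpha> \<kappa>. (\<forall>i a. \<alpha> i a > 0) \<and> (\<forall>a. \<alpha> q a = 1) \<and> \<kappa> \<ge> 0 \<and>
    (\<forall>v. (\<forall>k. dotp I (\<lambda>(i, a). if i = q then c a else 0)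
        ((mv I (\<lambda>(i, a) (j, b). fast_gain q a0 \<alpha> \<kappa> i a b * g i j) ^^ Suc k) v) = 0) \<longrightarrow>
      (\<forall>i<m. \<forall>a<n. v (i, a) = v (q, a)))"
proof -
  \<comment> \<open>Because \<open>c a0 = 1\<close>, the row \<open>c\<close> times the gain block
    of \<open>q\<close> has entries \<open>c b + \<kappa>\<close>; this \<open>\<kappa>\<close>
    makes all of them positive.\<close>
  define \<kappa> where "\<kappa> = 1 + (\<Sum>b<n. \<bar>c b\<bar>)"
  have \<kappa>: "c b + \<kappa> > 0" if "b < n" for b
  proof -
    have "\<bar>c b\<bar> \<le> (\<Sum>b<n. \<bar>c b\<bar>)" using that by (intro member_le_sum) auto
    then show ?thesis by (simp add: \<kappa>_def)
  qed
  have \<kappa>0: "\<kappa> \<ge> 0" by (simp add: \<kappa>_def add_nonneg_nonneg sum_nonneg)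
  define Q where "Q = {q} \<times> {..<n}"
  define J where "J = ({..<m} - {q}) \<times> {..<n}"
  have IQJ: "I = Q \<union> J" using q by (auto simp: I_def Q_def J_def)
  \<comment> \<open>The fast matrix without the factors \<open>\<alpha>\<close>. Rows of agent
    \<open>q\<close> keep weight 1, which is why the scaling must be 1 on \<open>Q\<close>. The
    other rows do not mix components, so their sums reduce to vertex sets of one component
    \<open>b\<close>.\<close>
  define gg where "gg = (\<lambda>x y. if fst x = q
    then ((if snd x = snd y then 1 else 0) + (if snd x = a0 then \<kappa> else 0)) * g q (fst y)
    else if snd x = snd y then g (fst x) (fst y) else 0)"
  define \<beta> where "\<beta> = (\<lambda>y. (c (snd y) + \<kappa>) * g q (fst y))"
  have row: "(\<Sum>y\<in>S. gg x y) = (\<Sum>j\<in>{j. (j, snd x) \<in> S}. g (fst x) j)"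
    if "x \<in> J" "S \<subseteq> J" for x S
  proof -
    have "finite S" using that(2) by (rule finite_subset) (simp add: J_def)
    moreover have "fst x \<noteq> q" using that(1) by (auto simp: J_def)
    ultimately show ?thesis using sum_fibre[of S "snd x" "g (fst x)"] by (simp add: gg_def)
  qed
  have "\<exists>a. (\<forall>i. a i > 0) \<and> (\<forall>i\<in>Q. a i = 1) \<and>
    (\<forall>v. (\<forall>i\<in>Q. v i = 0) \<longrightarrow>
      (\<forall>k. dotp (Q \<union> J) \<beta> ((mv (Q \<union> J) (\<lambda>i j. a i * gg i j) ^^ k) v) = 0) \<longrightarrow> (\<forall>i\<in>J. v i = 0))"
  proof (rule observable_row_scaling)
    show "finite Q" "finite J" "Q \<inter> J = {}" by (auto simp: Q_def J_def)
    show "\<beta> y \<le> 0" if "y \<in> J" for y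
      using that irr q \<kappa>[of "snd y"] unfolding \<beta>_def
      by (intro mult_nonneg_nonpos) (auto simp: J_def irreducible_laplacian_def)
    show "gg x y \<le> 0" if "x \<in> J" "y \<in> J" "x \<noteq> y" for x y
      using that irr by (auto simp: J_def gg_def irreducible_laplacian_def)
    show "0 \<le> (\<Sum>y\<in>J. gg x y)" if x: "x \<in> J" for x
      unfolding row[OF x order_refl]
      by (rule irreducible_laplacian_subset_sum(1)[OF irr]) (use x in \<open>auto simp: J_def\<close>)
    fix S assume S: "S \<subseteq> J" "S \<noteq> {}"
    then obtain j0 b where jb: "(j0, b) \<in> S" by auto
    then have b: "b < n" using S by (auto simp: J_def)
    define T where "T = {j. (j, b) \<in> S}"
    have T: "T \<subseteq> {..<m}" "T \<noteq> {}" "q \<notin> T" using jb S by (auto simp: T_def J_def)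
    then have "T \<noteq> {..<m}" using q by auto
    from irreducible_laplacian_subset_sum_pos[OF irr T(1,2) this] obtain i where
      i: "i \<in> T" "0 < (\<Sum>j\<in>T. g i j)" by blast
    show "\<exists>x\<in>S. 0 < (\<Sum>y\<in>S. gg x y)"
    proof (rule bexI[of _ "(i, b)"])
      show "(i, b) \<in> S" using i by (simp add: T_def)
      then have "(i, b) \<in> J" using S by blast
      from row[OF this S(1)] show "0 < (\<Sum>y\<in>S. gg (i, b) y)" using i by (simp add: T_def)
    qed
    \<comment> \<open>The cut condition for the complement gives a vertex outside \<open>T\<close>
      that depends on one in \<open>T\<close>. If it is \<open>q\<close>, the set is visible in
      \<open>\<beta>\<close>; otherwise it is visible from \<open>J - S\<close>.\<close>
    have "{..<m} - T \<subseteq> {..<m}" "{..<m} - T \<noteq> {}" "{..<m} - T \<noteq> {..<m}" using T q by auto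
    with irr have "\<exists>i\<in>{..<m} - T. \<exists>j\<in>{..<m} - ({..<m} - T). g i j < 0"
      unfolding irreducible_laplacian_def by blast
    then obtain i j where ij: "i < m" "i \<notin> T" "j \<in> T" "g i j < 0" by auto
    have jS: "(j, b) \<in> S" using ij by (simp add: T_def)
    show "(\<exists>j\<in>S. \<beta> j \<noteq> 0) \<or> (\<exists>i\<in>J - S. \<exists>j\<in>S. gg i j \<noteq> 0)"
    proof (cases "i = q")
      case True
      then have "\<beta> (j, b) \<noteq> 0" using ij \<kappa>[OF b] by (simp add: \<beta>_def)
      then show ?thesis using jS by blast
    next
      case False
      then have "(i, b) \<in> J - S" "gg (i, b) (j, b) \<noteq> 0" using ij b by (auto simp: J_def T_def gg_def)
      then show ?thesis using jS by blast
    qed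
  qed
  then obtain a where a: "\<forall>i. a i > 0" "\<forall>i\<in>Q. a i = 1"
    and obs: "\<And>v. (\<forall>i\<in>Q. v i = 0) \<Longrightarrow>
      (\<forall>k. dotp I \<beta> ((mv I (\<lambda>i j. a i * gg i j) ^^ k) v) = 0) \<Longrightarrow> (\<forall>i\<in>J. v i = 0)"
    unfolding IQJ by blast
  define \<alpha> where "\<alpha> = (\<lambda>i b. if i = q then 1 else a (i, b))"
  define L where "L = (\<lambda>(i, x) (j, y). fast_gain q a0 \<alpha> \<kappa> i x y * g i j)"
  define cc where "cc = (\<lambda>(i, a). if i = q then c a else 0)"
  have mvL: "mv I (\<lambda>x y. a x * gg x y) v x = mv I L v x" if "x \<in> I" for v x
    unfolding mv_def using that a
    by (intro sum.cong) (auto simp: L_def gg_def \<alpha>_def fast_gain_def I_def Q_def)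
  have powL: "(mv I (\<lambda>x y. a x * gg x y) ^^ k) v x = (mv I L ^^ k) v x" if "x \<in> I" for k v x
    using that
  proof (induction k arbitrary: x)
    case (Suc k)
    have "mv I (\<lambda>x y. a x * gg x y) ((mv I (\<lambda>x y. a x * gg x y) ^^ k) v) x
      = mv I (\<lambda>x y. a x * gg x y) ((mv I L ^^ k) v) x"
      using Suc.IH by (intro fun_cong[OF mv_cong])
    then show ?case using mvL[OF Suc.prems] by simp
  qed simp
  have rmL: "rm I L cc y = \<beta> y" if "y \<in> I" for y
  proof -
    obtain j b where y: "y = (j, b)" "j < m" "b < n" using \<open>y \<in> I\<close> unfolding I_def by (elim SigmaE) auto
    have "rm I L cc y = (\<Sum>i<m. \<Sum>x<n. cc (i, x) * L (i, x) y)"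
      by (simp add: rm_def I_def sum.cartesian_product)
    also have "\<dots> = (\<Sum>i\<in>{q}. \<Sum>x<n. cc (i, x) * L (i, x) y)"
      by (rule sum.mono_neutral_right) (use q in \<open>auto simp: cc_def\<close>)
    also have "\<dots> = (\<Sum>x<n. c x * L (q, x) y)" by (simp add: cc_def)
    also have "\<dots> = (\<Sum>x<n. (if x = b then c x * g q j else 0) + (if x = a0 then c x * \<kappa> * g q j else 0))"
      by (intro sum.cong refl) (auto simp: L_def fast_gain_def \<alpha>_def y algebra_simps)
    also have "\<dots> = \<beta> y" using y a0 by (simp add: sum.distrib \<beta>_def algebra_simps)
    finally show ?thesis .
  qed
  show ?thesis
  proof (intro exI[of _ \<alpha>] exI[of _ \<kappa>] conjI allI impI)
    show "\<alpha> i b > 0" for i b using a by (simp add: \<alpha>_def)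
    show "\<alpha> q b = 1" for b by (simp add: \<alpha>_def)
    show "\<kappa> \<ge> 0" by (rule \<kappa>0)
    fix v i b assume v: "\<forall>k. dotp I (\<lambda>(i, a). if i = q then c a else 0)
        ((mv I (\<lambda>(i, a) (j, b). fast_gain q a0 \<alpha> \<kappa> i a b * g i j) ^^ Suc k) v) = 0"
      and i: "i < m" and b: "b < n"
    have v: "dotp I cc ((mv I L ^^ Suc k) v) = 0" for k
      using v unfolding L_def cc_def by blast
    \<comment> \<open>The fast matrix kills consensus vectors. Subtracting the copy of agent
      \<open>q\<close> therefore changes no output from the first derivative on and makes
      \<open>v'\<close> vanish on \<open>Q\<close>; this explains the exponent
      \<open>Suc k\<close>.\<close>
    define v' where "v' = (\<lambda>x. v x - v (q, snd x))"
    have Lv': "mv I L v' x = mv I L v x" if "x \<in> I" for x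
    proof -
      obtain j y where x: "x = (j, y)" "j < m" "y < n" using \<open>x \<in> I\<close> unfolding I_def by (elim SigmaE) auto
      have "mv I L v x - mv I L v' x = (\<Sum>y'\<in>I. L x y' * v (q, snd y'))"
        by (simp add: mv_def sum_subtractf[symmetric] v'_def algebra_simps)
      also have "\<dots> = (\<Sum>i<m. \<Sum>z<n. L x (i, z) * v (q, z))"
        by (simp add: I_def sum.cartesian_product split_def)
      also have "\<dots> = (\<Sum>z<n. fast_gain q a0 \<alpha> \<kappa> j y z * v (q, z) * (\<Sum>i<m. g j i))"
        by (subst sum.swap, simp only: sum_distrib_left, intro sum.cong refl) (simp add: L_def x ac_simps)
      also have "\<dots> = 0" using irr x by (simp add: irreducible_laplacian_def)
      finally show ?thesis by simp
    qed
    have "dotp I \<beta> ((mv I (\<lambda>i j. a i * gg i j) ^^ k) v') = 0" for k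
    proof -
      have "dotp I \<beta> ((mv I (\<lambda>i j. a i * gg i j) ^^ k) v') = dotp I (rm I L cc) ((mv I L ^^ k) v')"
        by (intro dotp_cong powL) (auto simp: rmL)
      also have "\<dots> = dotp I cc ((mv I L ^^ k) (mv I L v'))"
        by (simp add: dotp_rm funpow_swap1)
      also have "\<dots> = dotp I cc ((mv I L ^^ k) (mv I L v))"
        using Lv' by (intro dotp_cong mv_pow_cong) auto
      also have "\<dots> = 0" using v[of k] unfolding funpow_Suc_right by simp
      finally show ?thesis .
    qed
    then have "\<forall>i\<in>J. v' i = 0" by (intro obs) (auto simp: v'_def Q_def)
    then show "v (i, b) = v (q, b)" using i b by (cases "i = q") (auto simp: J_def v'_def)
  qed
qed

text \<open>By duality this is observability of a transposed Laplacian. Transposition destroys zero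
  row sums, but weighting with the positive left kernel vector \<open>w\<close> restores them, so
  \<open>observable_row_scaling\<close> applies to the reversed graph with
  \<open>Q = {q}\<close>.\<close>

lemma scaled_laplacian_controllable:
  assumes irr: "irreducible_laplacian m g" and q: "q < m"
  shows "\<exists>s. \<forall>r. (\<forall>k. dotp {..<m} r
    ((mv {..<m} (\<lambda>i j. s i * g i j) ^^ k) (\<lambda>i. if i = q then 1 else 0)) = 0) \<longrightarrow> (\<forall>i<m. r i = 0)"
proof -
  obtain w where w: "\<And>i. i < m \<Longrightarrow> w i > 0" "\<And>j. j < m \<Longrightarrow> (\<Sum>i<m. w i * g i j) = 0"
    using irreducible_laplacian_positive_left_kernel[OF irr] q by auto
  define h where "h = (\<lambda>i j. w j * g j i)"
  define J where "J = {..<m} - {q}"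
  have IJ: "{q} \<union> J = {..<m}" using q by (auto simp: J_def)
  have off: "h i j \<le> 0" if "i < m" "j < m" "i \<noteq> j" for i j
    using that irr w[of j] by (auto simp: h_def irreducible_laplacian_def intro!: mult_nonneg_nonpos)
  have compl: "(\<Sum>j\<in>S. h i j) = - (\<Sum>j\<in>{..<m} - S. h i j)" if "S \<subseteq> {..<m}" "i < m" for S i
  proof -
    have "(\<Sum>j<m. h i j) = (\<Sum>j\<in>S. h i j) + (\<Sum>j\<in>{..<m} - S. h i j)"
      using that(1) by (metis add.commute finite_lessThan sum.subset_diff)
    then show ?thesis using w(2)[OF that(2)] by (simp add: h_def)
  qed
  have arc: "\<exists>i\<in>S. \<exists>j\<in>{..<m} - S. h i j < 0" if "S \<subseteq> {..<m}" "S \<noteq> {}" "S \<noteq> {..<m}" for S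
  proof -
    have "{..<m} - S \<subseteq> {..<m}" "{..<m} - S \<noteq> {}" "{..<m} - S \<noteq> {..<m}" using that by auto
    with irr have "\<exists>j\<in>{..<m} - S. \<exists>i\<in>{..<m} - ({..<m} - S). g j i < 0"
      unfolding irreducible_laplacian_def by blast
    then obtain i j where "j \<in> {..<m} - S" "i \<in> S" "g j i < 0" by auto
    moreover then have "h i j < 0" using w[of j] by (auto simp: h_def intro!: mult_pos_neg)
    ultimately show ?thesis by blast
  qed
  have "\<exists>a. (\<forall>i. a i > 0) \<and> (\<forall>i\<in>{q}. a i = 1) \<and>
    (\<forall>v. (\<forall>i\<in>{q}. v i = 0) \<longrightarrow>
      (\<forall>k. dotp ({q} \<union> J) (h q) ((mv ({q} \<union> J) (\<lambda>i j. a i * h i j) ^^ k) v) = 0) \<longrightarrow> (\<forall>i\<in>J. v i = 0))"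
  proof (rule observable_row_scaling)
    show "finite {q}" "finite J" "{q} \<inter> J = {}" by (auto simp: J_def)
    show "h q j \<le> 0" if "j \<in> J" for j using that off q by (auto simp: J_def)
    show "h i j \<le> 0" if "i \<in> J" "j \<in> J" "i \<noteq> j" for i j using that off by (auto simp: J_def)
    show "0 \<le> (\<Sum>j\<in>J. h i j)" if i: "i \<in> J" for i
    proof -
      have "(\<Sum>j\<in>{..<m} - J. h i j) \<le> 0" by (rule sum_nonpos) (use i off in \<open>auto simp: J_def\<close>)
      then show ?thesis using compl[of J i] i by (auto simp: J_def)
    qed
    fix S assume S: "S \<subseteq> J" "S \<noteq> {}"
    then have S': "S \<subseteq> {..<m}" "q \<notin> S" "S \<noteq> {..<m}" using q by (auto simp: J_def)
    from arc[OF S'(1) S(2) S'(3)] obtain i j where ij: "i \<in> S" "j \<in> {..<m} - S" "h i j < 0" by blast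
    have "(\<Sum>j\<in>{..<m} - S. h i j) < 0"
      by (rule sum_neg_nonpos_ex) (use ij off S' in auto)
    then show "\<exists>i\<in>S. 0 < (\<Sum>j\<in>S. h i j)" using compl[OF S'(1), of i] ij S' by (intro bexI[of _ i]) auto
    have "{..<m} - S \<subseteq> {..<m}" "{..<m} - S \<noteq> {}" "{..<m} - S \<noteq> {..<m}" using S S' q by auto
    from arc[OF this] S' obtain i j where ij: "i < m" "i \<notin> S" "j \<in> S" "h i j < 0" by auto
    then show "(\<exists>j\<in>S. h q j \<noteq> 0) \<or> (\<exists>i\<in>J - S. \<exists>j\<in>S. h i j \<noteq> 0)"
      by (cases "i = q") (force simp: J_def)+
  qed
  then obtain a where a: "\<forall>i. a i > 0" "a q = 1"
    and obs: "\<And>v. v q = 0 \<Longrightarrow>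
      (\<forall>k. dotp {..<m} (h q) ((mv {..<m} (\<lambda>i j. a i * h i j) ^^ k) v) = 0) \<Longrightarrow> (\<forall>i\<in>J. v i = 0)"
    unfolding IJ by auto
  define s where "s = (\<lambda>i. a i * w i)"
  show ?thesis
  proof (intro exI[of _ s] allI impI)
    fix r i assume r: "\<forall>k. dotp {..<m} r
      ((mv {..<m} (\<lambda>i j. s i * g i j) ^^ k) (\<lambda>i. if i = q then 1 else 0)) = 0" and i: "i < m"
    define v where "v = (\<lambda>i. a i * r i)"
    have one: "mv {..<m} (\<lambda>i j. a i * h i j) (\<lambda>i. a i * x i) = (\<lambda>i. a i * rm {..<m} (\<lambda>i j. s i * g i j) x i)" for x
      by (simp add: mv_def rm_def h_def s_def sum_distrib_left algebra_simps)
    have pow: "(mv {..<m} (\<lambda>i j. a i * h i j) ^^ k) v = (\<lambda>i. a i * (rm {..<m} (\<lambda>i j. s i * g i j) ^^ k) r i)" for k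
    proof (induction k)
      case (Suc k)
      show ?case by (simp only: funpow.simps o_apply Suc one)
    qed (simp add: v_def)
    have powq: "(mv {..<m} (\<lambda>i j. a i * h i j) ^^ k) v q = 0" for k
      using r q unfolding pow dotp_rm_pow[symmetric] by (simp add: dotp_unit)
    \<comment> \<open>Coordinate \<open>q\<close> vanishes at all times, and by
      \<open>a q = 1\<close> its next value is the row \<open>h q\<close> applied to the current
      vector.\<close>
    have "dotp {..<m} (h q) ((mv {..<m} (\<lambda>i j. a i * h i j) ^^ k) v) = 0" for k
      using powq[of "Suc k"] a by (simp add: mv_def dotp_def)
    then have "\<forall>i\<in>J. v i = 0" using powq[of 0] by (intro obs) auto
    moreover have "v q = 0" using powq[of 0] by simp
    ultimately have "v i = 0" using i by (cases "i = q") (auto simp: J_def)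
    then show "r i = 0" using a by (auto simp: v_def less_le)
  qed
qed

section \<open>The error system without compensator\<close>

text \<open>\<open>\<Phi> j\<close> stands for \<open>B_j F_j\<close>. The blocks of row
  \<open>i\<close> add up to \<open>A + K_i C_i\<close>: on consensus vectors the coupling
  cancels.\<close>

definition error_mat :: "nat \<Rightarrow> (nat \<Rightarrow> nat \<Rightarrow> real) \<Rightarrow> (nat \<Rightarrow> nat \<Rightarrow> nat \<Rightarrow> real) \<Rightarrow> (nat \<Rightarrow> nat)
    \<Rightarrow> (nat \<Rightarrow> nat \<Rightarrow> nat \<Rightarrow> real) \<Rightarrow> (nat \<Rightarrow> nat \<Rightarrow> nat \<Rightarrow> real) \<Rightarrow> nat \<times> nat \<Rightarrow> nat \<times> nat \<Rightarrow> real" where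
  "error_mat m A \<Phi> qd C K = (\<lambda>(i, a) (j, b).
    (if i = j then A a b + (\<Sum>l<m. \<Phi> l a b) + (\<Sum>k<qd i. K i a k * C i k b) else 0) - \<Phi> j a b)"

text \<open>For large \<open>t\<close> the disagreement dynamics are fast and the consensus component evolves as
  \<open>A + \<Sum>\<^sub>i J\<^sub>i C\<^sub>i\<close>, where the coupling \<open>\<Phi>\<close> has dropped out; \<open>K\<^sub>i\<close> is \<open>J\<^sub>i\<close> rescaled by the gains.\<close>
lemma error_system_observable:
  fixes g :: "nat \<Rightarrow> nat \<Rightarrow> real" and c :: "nat \<Rightarrow> real"
  assumes I_def: "I = {..<m} \<times> {..<n}" and irr: "irreducible_laplacian m g" and q: "q < m"
    and a0: "a0 < n" "c a0 = 1"
    and obs: "\<And>v. (\<And>i k t. i < m \<Longrightarrow> k < qd i \<Longrightarrow> dotp {..<n} (C i k) ((mv {..<n} A ^^ t) v) = 0)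
      \<Longrightarrow> (\<forall>a<n. v a = 0)"
  shows "\<exists>K \<Gamma> t. \<forall>v. (\<forall>k. dotp I (\<lambda>(i, a). if i = q then c a else 0)
      ((mv I (\<lambda>x y. error_mat m A \<Phi> qd C K x y + t * (\<Gamma> (fst x) (snd x) (snd y) * g (fst x) (fst y))) ^^ k) v) = 0)
    \<longrightarrow> (\<forall>x\<in>I. v x = 0)"
proof -
  have finI: "finite I" by (simp add: I_def)
  have sumI: "(\<Sum>x\<in>I. f x) = (\<Sum>i<m. \<Sum>a<n. f (i, a))" for f :: "nat \<times> nat \<Rightarrow> real"
    by (simp add: I_def sum.cartesian_product)
  obtain \<alpha> \<kappa> where \<alpha>: "\<And>i a. \<alpha> i a > 0" "\<And>a. \<alpha> q a = 1" and \<kappa>: "\<kappa> \<ge> 0"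
    and fast: "\<And>v. (\<forall>k. dotp I (\<lambda>(i, a). if i = q then c a else 0)
        ((mv I (\<lambda>(i, a) (j, b). fast_gain q a0 \<alpha> \<kappa> i a b * g i j) ^^ Suc k) v) = 0) \<Longrightarrow>
      (\<forall>i<m. \<forall>a<n. v (i, a) = v (q, a))"
    using consensus_observable[OF I_def irr q a0(1), of c, OF a0(2)] by blast
  define \<Gamma> where "\<Gamma> = fast_gain q a0 \<alpha> \<kappa>"
  define L where "L = (\<lambda>x y. \<Gamma> (fst x) (snd x) (snd y) * g (fst x) (fst y))"
  define cc where "cc = (\<lambda>(i, a). if i = q then c a else 0)"
  have fast: "\<forall>i<m. \<forall>a<n. v (i, a) = v (q, a)"
    if "\<And>k. dotp I cc ((mv I L ^^ Suc k) v) = 0" for v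
    using fast[of v] that unfolding L_def cc_def \<Gamma>_def by (simp add: split_def)
  obtain w where w: "\<And>i. i < m \<Longrightarrow> w i > 0" "\<And>j. j < m \<Longrightarrow> (\<Sum>i<m. w i * g i j) = 0"
    using irreducible_laplacian_positive_left_kernel[OF irr] q by auto
  define P where "P = Sigma {..<m} (\<lambda>i. {..<qd i})"
  have sumP: "(\<Sum>p\<in>P. f p) = (\<Sum>i<m. \<Sum>k<qd i. f (i, k))" for f :: "nat \<times> nat \<Rightarrow> real"
    unfolding P_def by (subst sum.Sigma) auto
  have "\<exists>J. \<forall>v. (\<forall>t. dotp {..<n} c ((mv {..<n} (\<lambda>a b. A a b + (\<Sum>p\<in>P. J a p * C (fst p) (snd p) b)) ^^ t) v) = 0)
    \<longrightarrow> (\<forall>i\<in>{..<n}. v i = 0)"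
  proof (rule output_injection_observable[OF refl])
    show "finite P" by (simp add: P_def)
    show "\<exists>i\<in>{..<n}. c i \<noteq> 0" using a0 by (intro bexI[of _ a0]) auto
    fix v assume v: "\<And>p t. p \<in> P \<Longrightarrow> dotp {..<n} (C (fst p) (snd p)) ((mv {..<n} A ^^ t) v) = 0"
    have "\<forall>a<n. v a = 0" by (rule obs) (use v[of "(_, _)"] in \<open>simp add: P_def\<close>)
    then show "\<forall>i\<in>{..<n}. v i = 0" by simp
  qed
  then obtain J where J: "\<And>v. (\<And>t. dotp {..<n} c ((mv {..<n} (\<lambda>a b. A a b + (\<Sum>p\<in>P. J a p * C (fst p) (snd p) b)) ^^ t) v) = 0)
    \<Longrightarrow> (\<forall>i\<in>{..<n}. v i = 0)" by blast
  define A' where "A' = (\<lambda>a b. A a b + (\<Sum>p\<in>P. J a p * C (fst p) (snd p) b))"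
  \<comment> \<open>By the Sherman-Morrison formula the inverse of the gain block of
    \<open>q\<close> is the identity minus \<open>\<theta>\<close> in row \<open>a0\<close>.\<close>
  define \<theta> where "\<theta> = \<kappa> / (1 + \<kappa>)"
  have \<theta>: "\<theta> < 1" "\<theta> * (1 + \<kappa>) = \<kappa>" using \<kappa> by (auto simp: \<theta>_def)
  define \<sigma> where "\<sigma> = (\<lambda>b. \<Sum>i<m. w i / \<alpha> i b)"
  have \<sigma>: "\<sigma> b \<ge> w q" for b
  proof -
    have "w q / \<alpha> q b \<le> \<sigma> b" unfolding \<sigma>_def
      by (rule member_le_sum) (use q w \<alpha> in \<open>auto intro!: divide_nonneg_pos less_imp_le\<close>)
    then show ?thesis using \<alpha> by simp
  qed
  have wq: "w q > 0" using w q by simp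
  \<comment> \<open>This is the sum of \<open>w i\<close> times the inverse of
    \<open>\<Gamma> i\<close> over all agents.\<close>
  define S where "S = (\<lambda>b b'. (if b = b' then \<sigma> b else 0) - (if b = a0 then w q * \<theta> else 0))"
  \<comment> \<open>In matrix form \<open>K_i = \<Gamma>_i S J_i / w_i\<close>. For rows with
    \<open>r_i \<Gamma>_i = w_i x\<close> and \<open>z = x S\<close> this yields
    \<open>r_i K_i = z J_i\<close>, so the injections add up to the desired one on the slow
    component.\<close>
  define K where "K = (\<lambda>i a k. (\<Sum>b<n. \<Gamma> i a b * (\<Sum>b'<n. S b b' * J b' (i, k))) / w i)"
  define G where "G = error_mat m A \<Phi> qd C K"
  \<comment> \<open>The first condition places \<open>r\<close> in the left kernel of the fast
    matrix, the second prescribes its block sum. Such an \<open>r\<close> exists for every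
    \<open>z\<close> because \<open>S\<close> is invertible:
    \<open>\<sigma> a0 \<ge> w q > w q * \<theta>\<close>.\<close>
  have solve: "\<exists>r x. (\<forall>i<m. \<forall>b<n. (\<Sum>a<n. r (i, a) * \<Gamma> i a b) = w i * x b) \<and>
      (\<forall>b<n. (\<Sum>i<m. r (i, b)) = z b) \<and> (\<forall>b'<n. (\<Sum>b<n. x b * S b b') = z b')" for z
  proof -
    have d0: "\<sigma> a0 - w q * \<theta> > 0"
    proof -
      have "w q * \<theta> < w q" using \<theta> wq by simp
      then show ?thesis using \<sigma>[of a0] by simp
    qed
    define xa where "xa = z a0 / (\<sigma> a0 - w q * \<theta>)"
    define x where "x = (\<lambda>b. (z b + w q * \<theta> * xa) / \<sigma> b)"
    have \<sigma>0: "\<sigma> b > 0" for b using \<sigma>[of b] wq by simp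
    have xa: "x a0 = xa"
    proof -
      have "xa * (\<sigma> a0 - w q * \<theta>) = z a0" using d0 by (simp add: xa_def)
      then have "z a0 + w q * \<theta> * xa = xa * \<sigma> a0" by (simp add: algebra_simps)
      then show ?thesis using \<sigma>0[of a0] by (simp add: x_def)
    qed
    have xz: "x b * \<sigma> b - w q * \<theta> * x a0 = z b" for b
      using \<sigma>0[of b] unfolding xa by (simp add: x_def)
    define r where "r = (\<lambda>(i, b). w i * (x b / \<alpha> i b - (if i = q then \<theta> * x a0 else 0)))"
    have 1: "(\<Sum>a<n. r (i, a) * \<Gamma> i a b) = w i * x b" if "i < m" "b < n" for i b
    proof -
      have "(\<Sum>a<n. r (i, a) * \<Gamma> i a b)
        = (\<Sum>a<n. (if a = b then r (i, a) * \<alpha> i a else 0) + (if a = a0 then (if i = q then r (i, a) * \<kappa> else 0) else 0))"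
        by (intro sum.cong refl) (auto simp: \<Gamma>_def fast_gain_def algebra_simps)
      also have "\<dots> = r (i, b) * \<alpha> i b + (if i = q then r (i, a0) * \<kappa> else 0)"
        using that a0 by (simp add: sum.distrib)
      also have "\<dots> = w i * x b"
      proof (cases "i = q")
        case True
        have "x b - \<theta> * x a0 + (x a0 - \<theta> * x a0) * \<kappa> = x b + x a0 * (\<kappa> - \<theta> * (1 + \<kappa>))"
          by (simp add: algebra_simps)
        then have "x b - \<theta> * x a0 + (x a0 - \<theta> * x a0) * \<kappa> = x b" using \<theta> by simp
        then have "w q * (x b - \<theta> * x a0 + (x a0 - \<theta> * x a0) * \<kappa>) = w q * x b" by simp
        then show ?thesis using True \<alpha> by (simp add: r_def algebra_simps)
      next
        case False
        then show ?thesis using \<alpha>(1)[of i b] by (simp add: r_def)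
      qed
      finally show ?thesis .
    qed
    have 2: "(\<Sum>i<m. r (i, b)) = z b" for b
    proof -
      have "(\<Sum>i<m. r (i, b)) = (\<Sum>i<m. x b * (w i / \<alpha> i b)) - (\<Sum>i<m. if i = q then w q * \<theta> * x a0 else 0)"
        unfolding sum_subtractf[symmetric] by (intro sum.cong refl) (auto simp: r_def algebra_simps)
      also have "\<dots> = x b * \<sigma> b - w q * \<theta> * x a0" using q by (simp add: \<sigma>_def sum_distrib_left)
      finally show ?thesis using xz by simp
    qed
    have 3: "(\<Sum>b<n. x b * S b b') = z b'" if "b' < n" for b'
    proof -
      have "(\<Sum>b<n. x b * S b b') = (\<Sum>b<n. (if b = b' then x b * \<sigma> b else 0) - (if b = a0 then x b * (w q * \<theta>) else 0))"
        by (intro sum.cong refl) (auto simp: S_def algebra_simps)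
      also have "\<dots> = x b' * \<sigma> b' - w q * \<theta> * x a0" using that a0 by (simp add: sum_subtractf)
      finally show ?thesis using xz by simp
    qed
    show ?thesis using 1 2 3 by blast
  qed
  define V where "V = (\<lambda>\<delta>. {v. \<forall>k. dotp I cc ((mv I (\<lambda>x y. L x y + \<delta> * G x y) ^^ k) v) = 0})"
  have inv: "mv I (\<lambda>i j. L i j + \<delta> * G i j) v \<in> V \<delta>" if "v \<in> V \<delta>" for \<delta> v
  proof -
    have "dotp I cc ((mv I (\<lambda>i j. L i j + \<delta> * G i j) ^^ Suc k) v) = 0" for k
      using that unfolding V_def by blast
    then show ?thesis by (simp add: V_def funpow_Suc_right del: funpow.simps)
  qed
  have lim0: "lims I V cc"
  proof (rule lims_const)
    fix \<delta> v assume "v \<in> V \<delta>"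
    then have "dotp I cc ((mv I (\<lambda>i j. L i j + \<delta> * G i j) ^^ 0) v) = 0" unfolding V_def by blast
    then show "dotp I cc v = 0" by simp
  qed
  have limL: "lims I V ((rm I L ^^ k) cc)" for k
    by (induction k) (auto intro: lim0 lims_fast[where G = G and L = L, OF inv])
  have cons: "\<forall>i<m. \<forall>a<n. v (i, a) = v (q, a)" if v: "\<And>u. lims I V u \<Longrightarrow> dotp I u v = 0" for v
  proof (rule fast)
    show "dotp I cc ((mv I L ^^ Suc k) v) = 0" for k
      using v[OF limL[of "Suc k"]] unfolding dotp_rm_pow .
  qed
  have consdot: "dotp I u v = (\<Sum>b<n. (\<Sum>i<m. u (i, b)) * v (q, b))"
    if "\<forall>i<m. \<forall>a<n. v (i, a) = v (q, a)" for u v :: "nat \<times> nat \<Rightarrow> real"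
  proof -
    have "dotp I u v = (\<Sum>i<m. \<Sum>b<n. u (i, b) * v (q, b))" using that by (simp add: dotp_def sumI)
    then show ?thesis by (subst (asm) sum.swap) (simp add: sum_distrib_right)
  qed
  \<comment> \<open>All limits together kill only consensus vectors, and on these a functional acts
    through its block sum. So a limit may be replaced by any row with the same block sum, in
    particular by one in the left kernel of \<open>L\<close>, as a slow step requires.\<close>
  have transfer: "lims I V u'" if u: "lims I V u" "\<And>b. b < n \<Longrightarrow> (\<Sum>i<m. u' (i, b)) = (\<Sum>i<m. u (i, b))" for u u'
  proof (rule lims_dual[OF finI])
    fix v assume v: "\<And>u. lims I V u \<Longrightarrow> dotp I u v = 0"
    have cv: "\<forall>i<m. \<forall>a<n. v (i, a) = v (q, a)" by (rule cons) (rule v)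
    have "dotp I u' v = dotp I u v" unfolding consdot[OF cv] using u(2) by simp
    then show "dotp I u' v = 0" using v[OF u(1)] by simp
  qed
  have slow: "\<exists>u. lims I V u \<and> (\<forall>b<n. (\<Sum>i<m. u (i, b)) = (rm {..<n} A' ^^ k) c b)" for k
  proof (induction k)
    case 0
    have "(\<Sum>i<m. cc (i, b)) = c b" for b using q by (simp add: cc_def)
    then show ?case using lim0 by (intro exI[of _ cc]) simp
  next
    case (Suc k)
    define z where "z = (rm {..<n} A' ^^ k) c"
    from Suc obtain u where u: "lims I V u" "\<And>b. b < n \<Longrightarrow> (\<Sum>i<m. u (i, b)) = z b" by (auto simp: z_def)
    obtain r x where rx: "\<And>i b. i < m \<Longrightarrow> b < n \<Longrightarrow> (\<Sum>a<n. r (i, a) * \<Gamma> i a b) = w i * x b"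
      "\<And>b. b < n \<Longrightarrow> (\<Sum>i<m. r (i, b)) = z b" "\<And>b'. b' < n \<Longrightarrow> (\<Sum>b<n. x b * S b b') = z b'"
      using solve[of z] by auto
    have rlim: "lims I V r" by (rule transfer[OF u(1)]) (simp add: u rx)
    have rL: "rm I L r y = 0" if "y \<in> I" for y
    proof -
      have y: "fst y < m" "snd y < n" using that by (auto simp: I_def)
      have "rm I L r y = (\<Sum>i<m. (\<Sum>a<n. r (i, a) * \<Gamma> i a (snd y)) * g i (fst y))"
        by (simp add: rm_def sumI L_def sum_distrib_right mult.assoc)
      also have "\<dots> = (\<Sum>i<m. w i * x (snd y) * g i (fst y))" using rx(1) y by simp
      also have "\<dots> = x (snd y) * (\<Sum>i<m. w i * g i (fst y))"
        unfolding sum_distrib_left by (intro sum.cong refl) (simp add: ac_simps)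
      finally show ?thesis using w(2)[OF y(1)] by simp
    qed
    obtain s where s: "lims I V (\<lambda>j. rm I G r j + rm I L s j)"
      using lims_slow[where G = G and L = L, OF inv rlim rL] by blast
    \<comment> \<open>The uncontrolled correction has block sum zero because the rows of
      \<open>g\<close> sum to zero. On block sums the slow step is therefore exact.\<close>
    have Ls: "(\<Sum>j<m. rm I L s (j, b)) = 0" for b
    proof -
      have "(\<Sum>j<m. rm I L s (j, b)) = (\<Sum>j<m. \<Sum>i<m. \<Sum>a<n. s (i, a) * \<Gamma> i a b * g i j)"
        by (simp add: rm_def sumI L_def mult.assoc)
      also have "\<dots> = (\<Sum>i<m. (\<Sum>a<n. s (i, a) * \<Gamma> i a b) * (\<Sum>j<m. g i j))"
        by (subst sum.swap) (simp add: sum_product sum.swap[of _ "{..<n}"])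
      also have "\<dots> = 0" using irr by (simp add: irreducible_laplacian_def)
      finally show ?thesis .
    qed
    have Grow: "(\<Sum>j<m. G (i, a) (j, b)) = A a b + (\<Sum>k<qd i. K i a k * C i k b)" if "i < m" for i a b
      using that by (simp add: G_def error_mat_def sum_subtractf)
    have rK: "(\<Sum>a<n. r (i, a) * K i a k) = (\<Sum>b'<n. z b' * J b' (i, k))" if "i < m" for i k
    proof -
      have "(\<Sum>a<n. r (i, a) * K i a k) * w i = (\<Sum>a<n. \<Sum>b<n. r (i, a) * \<Gamma> i a b * (\<Sum>b'<n. S b b' * J b' (i, k)))"
        using w(1)[OF that] by (simp add: K_def sum_distrib_right sum_distrib_left sum_divide_distrib mult.assoc)
      also have "\<dots> = (\<Sum>b<n. (\<Sum>a<n. r (i, a) * \<Gamma> i a b) * (\<Sum>b'<n. S b b' * J b' (i, k)))"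
        by (subst sum.swap) (simp add: sum_distrib_right)
      also have "\<dots> = (\<Sum>b<n. w i * x b * (\<Sum>b'<n. S b b' * J b' (i, k)))"
        using rx(1) that by simp
      also have "\<dots> = w i * (\<Sum>b<n. \<Sum>b'<n. x b * S b b' * J b' (i, k))"
        by (simp add: sum_distrib_left mult.assoc)
      also have "(\<Sum>b<n. \<Sum>b'<n. x b * S b b' * J b' (i, k)) = (\<Sum>b'<n. (\<Sum>b<n. x b * S b b') * J b' (i, k))"
        by (subst sum.swap) (simp add: sum_distrib_right)
      also have "\<dots> = (\<Sum>b'<n. z b' * J b' (i, k))" using rx(3) by simp
      finally show ?thesis using w(1)[OF that] by simp
    qed
    have "(\<Sum>j<m. rm I G r (j, b)) = rm {..<n} A' z b" if b: "b < n" for b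
    proof -
      have "(\<Sum>j<m. rm I G r (j, b)) = (\<Sum>j<m. \<Sum>i<m. \<Sum>a<n. r (i, a) * G (i, a) (j, b))"
        by (simp add: rm_def sumI)
      also have "\<dots> = (\<Sum>i<m. \<Sum>j<m. \<Sum>a<n. r (i, a) * G (i, a) (j, b))"
        by (rule sum.swap)
      also have "\<dots> = (\<Sum>i<m. \<Sum>a<n. \<Sum>j<m. r (i, a) * G (i, a) (j, b))"
        by (rule sum.cong[OF refl sum.swap])
      also have "\<dots> = (\<Sum>i<m. \<Sum>a<n. r (i, a) * (A a b + (\<Sum>k<qd i. K i a k * C i k b)))"
        using Grow by (simp add: sum_distrib_left[symmetric])
      also have "\<dots> = (\<Sum>i<m. \<Sum>a<n. r (i, a) * A a b) + (\<Sum>i<m. \<Sum>a<n. \<Sum>k<qd i. r (i, a) * K i a k * C i k b)"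
        by (simp add: distrib_left sum.distrib sum_distrib_left mult.assoc)
      also have "(\<Sum>i<m. \<Sum>a<n. r (i, a) * A a b) = (\<Sum>a<n. z a * A a b)"
        by (subst sum.swap) (simp add: sum_distrib_right[symmetric] rx(2))
      also have "(\<Sum>i<m. \<Sum>a<n. \<Sum>k<qd i. r (i, a) * K i a k * C i k b)
          = (\<Sum>i<m. \<Sum>k<qd i. (\<Sum>a<n. r (i, a) * K i a k) * C i k b)"
        by (rule sum.cong[OF refl]) (subst sum.swap, simp add: sum_distrib_right)
      also have "\<dots> = (\<Sum>p\<in>P. (\<Sum>a<n. z a * J a p) * C (fst p) (snd p) b)"
        using rK by (simp add: sumP)
      also have "\<dots> = (\<Sum>a<n. z a * (\<Sum>p\<in>P. J a p * C (fst p) (snd p) b))"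
        by (simp add: sum_distrib_right sum_distrib_left mult.assoc) (rule sum.swap)
      finally show ?thesis by (simp add: rm_def A'_def distrib_left sum.distrib)
    qed
    then show ?case using s Ls by (intro exI[of _ "\<lambda>j. rm I G r j + rm I L s j"]) (simp add: sum.distrib z_def)
  qed
  have "\<exists>\<delta>>0. \<forall>v\<in>V \<delta>. \<forall>i\<in>I. v i = 0"
  proof (rule lims_full[OF finI])
    fix v x assume v: "\<And>u. lims I V u \<Longrightarrow> dotp I u v = 0" and x: "x \<in> I"
    have cv: "\<forall>i<m. \<forall>a<n. v (i, a) = v (q, a)" by (rule cons) (rule v)
    define y where "y = (\<lambda>b. v (q, b))"
    have "\<forall>b\<in>{..<n}. y b = 0"
    proof (rule J)
      fix k
      obtain u where u: "lims I V u" "\<And>b. b < n \<Longrightarrow> (\<Sum>i<m. u (i, b)) = (rm {..<n} A' ^^ k) c b"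
        using slow[of k] by blast
      have "dotp {..<n} ((rm {..<n} A' ^^ k) c) y = dotp I u v"
        unfolding consdot[OF cv] using u(2) by (simp add: dotp_def y_def)
      then show "dotp {..<n} c ((mv {..<n} (\<lambda>a b. A a b + (\<Sum>p\<in>P. J a p * C (fst p) (snd p) b)) ^^ k) y) = 0"
        using v[OF u(1)] unfolding dotp_rm_pow A'_def by simp
    qed
    then show "v x = 0" using cv x by (auto simp: I_def y_def)
  qed
  then obtain \<delta> where \<delta>: "\<delta> > 0" "\<And>v i. v \<in> V \<delta> \<Longrightarrow> i \<in> I \<Longrightarrow> v i = 0" by blast
  have LG: "(\<lambda>x y. L x y + \<delta> * G x y) = (\<lambda>x y. \<delta> * (G x y + (1 / \<delta>) * L x y))"
    using \<delta> by (simp add: fun_eq_iff algebra_simps)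
  show ?thesis
  proof (rule exI[of _ K], rule exI[of _ \<Gamma>], rule exI[of _ "1 / \<delta>"], intro allI impI ballI)
    fix v x assume v: "\<forall>k. dotp I (\<lambda>(i, a). if i = q then c a else 0)
      ((mv I (\<lambda>x y. error_mat m A \<Phi> qd C K x y + 1 / \<delta> * (\<Gamma> (fst x) (snd x) (snd y) * g (fst x) (fst y))) ^^ k) v) = 0"
      and x: "x \<in> I"
    have "v \<in> V \<delta>" unfolding V_def LG mv_pow_scale dotp_scale_right using v by (simp add: L_def G_def cc_def)
    then show "v x = 0" using \<delta>(2) x by blast
  qed
qed

section \<open>Generic gains: observability and controllability at once\<close>

text \<open>The determinant is a polynomial in the parameter and does not vanish at
  \<open>s0\<close>, so it has finitely many roots.\<close>

lemma finite_singular_parameters: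
  fixes P :: "nat \<Rightarrow> nat \<Rightarrow> real poly"
  assumes "\<And>v. (\<And>i. i < d \<Longrightarrow> (\<Sum>j<d. poly (P i j) s0 * v j) = 0) \<Longrightarrow> (\<forall>j<d. v j = 0)"
  shows "finite {s. \<exists>v. (\<forall>i<d. (\<Sum>j<d. poly (P i j) s * v j) = 0) \<and> (\<exists>j<d. v j \<noteq> 0)}" (is "finite ?B")
proof -
  define D where "D = det (mat d d (\<lambda>(i, j). P i j))"
  have D: "poly D s = det (mat d d (\<lambda>(i, j). poly (P i j) s))" for s
  proof -
    have hom: "comm_ring_hom (\<lambda>p. poly p s :: real)" by unfold_locales auto
    have "poly D s = det (map_mat (\<lambda>p. poly p s) (mat d d (\<lambda>(i, j). P i j)))"
      unfolding D_def by (rule comm_ring_hom.hom_det[OF hom, symmetric])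
    also have "map_mat (\<lambda>p. poly p s) (mat d d (\<lambda>(i, j). P i j)) = mat d d (\<lambda>(i, j). poly (P i j) s)"
      by (intro eq_matI) auto
    finally show ?thesis .
  qed
  have "poly D s0 \<noteq> 0" unfolding D det_nonzero_iff_kernel_trivial[of d "\<lambda>i j. poly (P i j) s0"]
    using assms by blast
  then have "D \<noteq> 0" by auto
  then have "finite {s. poly D s = 0}" by (rule poly_roots_finite)
  moreover have "?B \<subseteq> {s. poly D s = 0}"
  proof
    fix s assume "s \<in> ?B"
    then show "s \<in> {s. poly D s = 0}"
      unfolding D using det_nonzero_iff_kernel_trivial[of d "\<lambda>i j. poly (P i j) s"] by blast
  qed
  ultimately show ?thesis by (rule finite_subset[rotated])
qed

text \<open>Flat index to (agent, component), in the stacking order of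
  \<open>closed_loop_rhs\<close>.\<close>

definition unpair :: "nat \<Rightarrow> nat \<Rightarrow> nat \<times> nat" where
  "unpair n r = (r div n, r mod n)"

lemma unpair_sum:
  fixes m n :: nat
  assumes "n > 0"
  shows "(\<Sum>r<m * n. f (unpair n r)) = (\<Sum>x\<in>{..<m} \<times> {..<n}. f x)"
proof (rule sum.reindex_bij_witness[of _ "\<lambda>(i, a). i * n + a" "unpair n"])
  fix x assume "x \<in> {..<m} \<times> {..<n}"
  then obtain i a where x: "x = (i, a)" "i < m" "a < n" by auto
  have "i * n + a < Suc i * n" using x by simp
  also have "\<dots> \<le> m * n" using x by (intro mult_le_mono1) simp
  finally show "(case x of (i, a) \<Rightarrow> i * n + a) \<in> {..<m * n}" using x by simp
  show "unpair n (case x of (i, a) \<Rightarrow> i * n + a) = x" using x by (simp add: unpair_def)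
next
  fix r assume "r \<in> {..<m * n}"
  then show "unpair n r \<in> {..<m} \<times> {..<n}" using assms
    by (auto simp: unpair_def less_mult_imp_div_less)
qed (auto simp: unpair_def)

lemma unpair_mv:
  assumes "n > 0"
  shows "(mv {..<m * n} (\<lambda>r s. M (unpair n r) (unpair n s)) ^^ k) (\<lambda>r. v (unpair n r))
    = (\<lambda>r. (mv ({..<m} \<times> {..<n}) M ^^ k) v (unpair n r))"
proof (induction k)
  case (Suc k)
  have "mv {..<m * n} (\<lambda>r s. M (unpair n r) (unpair n s)) (\<lambda>r. u (unpair n r))
    = (\<lambda>r. mv ({..<m} \<times> {..<n}) M u (unpair n r))" for u
    unfolding mv_def using unpair_sum[OF assms, of "\<lambda>y. M (unpair n _) y * u y"] by simp
  then show ?case by (simp only: funpow.simps o_apply Suc)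
qed simp

lemma unpair_dotp:
  assumes "n > 0"
  shows "dotp {..<m * n} (\<lambda>r. c (unpair n r)) (\<lambda>r. v (unpair n r)) = dotp ({..<m} \<times> {..<n}) c v"
  unfolding dotp_def by (rule unpair_sum[OF assms])

lemma unpair_inverse: "a < n \<Longrightarrow> unpair n (i * n + a) = (i, a)"
  by (simp add: unpair_def)

lemma unpair_eq_iff: "b < n \<Longrightarrow> unpair n r = (i, b) \<longleftrightarrow> r = i * n + b"
  by (metis unpair_def unpair_inverse div_mult_mod_eq prod.inject)

text \<open>The matrix is the Kronecker product of \<open>h\<close> with the identity, so its powers
  move only the agent index. Controllability of \<open>h\<close> from \<open>q\<close> is thereby
  copied to each of the \<open>n\<close> components.\<close>

lemma kronecker_pow:
  fixes h :: "nat \<Rightarrow> nat \<Rightarrow> real" and q b :: nat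
  assumes "b < n" "q < m"
  shows "(mv ({..<m} \<times> {..<n}) (\<lambda>(i, a) (j, b). if a = b then h i j else 0) ^^ k) (\<lambda>x. if x = (q, b) then 1 else 0)
    = (\<lambda>(i, a). if a = b then (mv {..<m} h ^^ k) (\<lambda>i. if i = q then 1 else 0) i else 0)"
proof (induction k)
  case (Suc k)
  have "mv ({..<m} \<times> {..<n}) (\<lambda>(i, a) (j, b). if a = b then h i j else 0) (\<lambda>(i, a). if a = b then u i else 0)
    = (\<lambda>(i, a). if a = b then mv {..<m} h u i else 0)" for u
  proof
    fix x :: "nat \<times> nat"
    obtain i a where x: "x = (i, a)" by (cases x)
    have "mv ({..<m} \<times> {..<n}) (\<lambda>(i, a) (j, b). if a = b then h i j else 0) (\<lambda>(i, a). if a = b then u i else 0) x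
      = (\<Sum>j<m. \<Sum>b'<n. (if a = b' then h i j else 0) * (if b' = b then u j else 0))"
      unfolding mv_def x sum.cartesian_product split_def fst_conv snd_conv ..
    also have "\<dots> = (\<Sum>j<m. \<Sum>b'<n. if b' = b then (if a = b then h i j * u j else 0) else 0)"
      by (intro sum.cong refl) auto
    also have "\<dots> = (if a = b then mv {..<m} h u i else 0)" using assms by (simp add: mv_def)
    finally show "mv ({..<m} \<times> {..<n}) (\<lambda>(i, a) (j, b). if a = b then h i j else 0) (\<lambda>(i, a). if a = b then u i else 0) x
      = (case x of (i, a) \<Rightarrow> if a = b then mv {..<m} h u i else 0)" by (simp add: x)
  qed
  then show ?case by (simp only: funpow.simps o_apply Suc)
qed (auto simp: fun_eq_iff)

lemma poly_rm_pow:
  "(\<lambda>j. poly ((rm I (\<lambda>i j. [:X i j, Y i j:]) ^^ k) (\<lambda>i. [:c i:]) j) s) = (rm I (\<lambda>i j. X i j + s * Y i j) ^^ k) c"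
proof (induction k)
  case (Suc k)
  have "(\<lambda>j. poly (rm I (\<lambda>i j. [:X i j, Y i j:]) u j) s) = rm I (\<lambda>i j. X i j + s * Y i j) (\<lambda>i. poly (u i) s)" for u
    by (simp add: rm_def poly_sum sum.distrib algebra_simps)
  then show ?case by (simp only: funpow.simps o_apply Suc)
qed simp

lemma poly_mv_pow:
  "(\<lambda>j. poly ((mv I (\<lambda>i j. [:X i j, Y i j:]) ^^ k) (\<lambda>i. [:c i:]) j) s) = (mv I (\<lambda>i j. X i j + s * Y i j) ^^ k) c"
proof (induction k)
  case (Suc k)
  have "(\<lambda>j. poly (mv I (\<lambda>i j. [:X i j, Y i j:]) u j) s) = mv I (\<lambda>i j. X i j + s * Y i j) (\<lambda>i. poly (u i) s)" for u
    by (simp add: mv_def poly_sum sum.distrib algebra_simps)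
  then show ?case by (simp only: funpow.simps o_apply Suc)
qed simp

text \<open>Observability holds at \<open>s = 0\<close> and controllability with index \<open>m\<close> at \<open>s = \<infinity>\<close>, hence both
  hold for all but finitely many \<open>s\<close>.\<close>
lemma error_system_observable_controllable:
  fixes g :: "nat \<Rightarrow> nat \<Rightarrow> real" and c :: "nat \<Rightarrow> real" and \<Phi> qd C A
  assumes irr: "irreducible_laplacian m g" and q: "q < m"
    and a0: "a0 < n" "c a0 = 1"
    and obs: "\<And>v. (\<And>i k t. i < m \<Longrightarrow> k < qd i \<Longrightarrow> dotp {..<n} (C i k) ((mv {..<n} A ^^ t) v) = 0)
      \<Longrightarrow> (\<forall>a<n. v a = 0)"
  defines "M \<equiv> \<lambda>K \<Gamma> r s. error_mat m A \<Phi> qd C K (unpair n r) (unpair n s)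
    + \<Gamma> (r div n) (r mod n) (s mod n) * g (r div n) (s div n)"
  shows "\<exists>K \<Gamma>.
    (\<forall>v. (\<forall>k. dotp {..<m * n} (\<lambda>r. if r div n = q then c (r mod n) else 0) ((mv {..<m * n} (M K \<Gamma>) ^^ k) v) = 0)
      \<longrightarrow> (\<forall>r<m * n. v r = 0)) \<and>
    (\<forall>u. (\<forall>k<m. \<forall>b<n. dotp {..<m * n} u ((mv {..<m * n} (M K \<Gamma>) ^^ k) (\<lambda>r. if r = q * n + b then 1 else 0)) = 0)
      \<longrightarrow> (\<forall>r<m * n. u r = 0))"
proof -
  define I where "I = {..<m} \<times> {..<n}"
  have n: "n > 0" using a0 by simp
  define NN where "NN = m * n"
  define cc where "cc = (\<lambda>r. if r div n = q then c (r mod n) else 0)"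
  have cc: "cc = (\<lambda>r. (case unpair n r of (i, a) \<Rightarrow> if i = q then c a else 0))"
    by (simp add: cc_def unpair_def)
  obtain K \<Gamma> t where KG: "\<And>v. (\<forall>k. dotp I (\<lambda>(i, a). if i = q then c a else 0)
      ((mv I (\<lambda>x y. error_mat m A \<Phi> qd C K x y + t * (\<Gamma> (fst x) (snd x) (snd y) * g (fst x) (fst y))) ^^ k) v) = 0)
    \<Longrightarrow> (\<forall>x\<in>I. v x = 0)"
    using error_system_observable[where c = c and A = A and C = C and qd = qd and \<Phi> = \<Phi>,
      OF I_def irr q a0 obs] by blast
  obtain \<eta> where \<eta>: "\<And>r. (\<forall>k. dotp {..<m} r
    ((mv {..<m} (\<lambda>i j. \<eta> i * g i j) ^^ k) (\<lambda>i. if i = q then 1 else 0)) = 0) \<Longrightarrow> (\<forall>i<m. r i = 0)"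
    using scaled_laplacian_controllable[OF irr q] by blast
  define M1p where "M1p = (\<lambda>x y. error_mat m A \<Phi> qd C K x y + t * (\<Gamma> (fst x) (snd x) (snd y) * g (fst x) (fst y)))"
  define L2p where "L2p = (\<lambda>(i, a :: nat) (j, b). if a = b then \<eta> i * g i j else 0)"
  define M1 where "M1 = (\<lambda>r s. M1p (unpair n r) (unpair n s))"
  define L2 where "L2 = (\<lambda>r s. L2p (unpair n r) (unpair n s))"
  have in_I: "(r div n, r mod n) \<in> I" if "r < NN" for r
    using that n by (auto simp: I_def NN_def less_mult_imp_div_less)
  have lt: "i * n + a < NN" if "i < m" "a < n" for i a
  proof -
    have "i * n + a < Suc i * n" using that by simp
    also have "\<dots> \<le> m * n" using that by (intro mult_le_mono1) simp
    finally show ?thesis by (simp add: NN_def)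
  qed
  have repr: "\<exists>v'. v = (\<lambda>r. v' (unpair n r))" for v :: "nat \<Rightarrow> real"
    by (intro exI[of _ "\<lambda>(i, a). v (i * n + a)"]) (simp add: unpair_def)
  \<comment> \<open>By \<open>krylov_stable\<close> the first \<open>NN\<close> output rows decide
    observability, so it is nonsingularity of a square matrix that is polynomial in the
    gain.\<close>
  define P where "P = (\<lambda>k. (rm {..<NN} (\<lambda>r s. [:M1 r s, L2 r s:]) ^^ k) (\<lambda>r. [:cc r:]))"
  have P: "(\<Sum>j<NN. poly (P k j) s * v j) = dotp {..<NN} cc ((mv {..<NN} (\<lambda>i j. M1 i j + s * L2 i j) ^^ k) v)" for k s v
    unfolding dotp_rm_pow[symmetric] poly_rm_pow[symmetric] by (simp add: P_def dotp_def)
  define B1 where "B1 = {s. \<exists>v. (\<forall>i<NN. (\<Sum>j<NN. poly (P i j) s * v j) = 0) \<and> (\<exists>j<NN. v j \<noteq> 0)}"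
  have "finite B1" unfolding B1_def
  proof (rule finite_singular_parameters[where ?s0.0 = 0])
    fix v :: "nat \<Rightarrow> real" assume v: "\<And>i. i < NN \<Longrightarrow> (\<Sum>j<NN. poly (P i j) 0 * v j) = 0"
    obtain v' where v': "v = (\<lambda>r. v' (unpair n r))" using repr by blast
    have "dotp {..<NN} cc ((mv {..<NN} M1 ^^ k) v) = 0" for k
      by (rule krylov_stable) (use v in \<open>simp add: P\<close>)
    moreover have "dotp I (\<lambda>(i, a). if i = q then c a else 0) ((mv I M1p ^^ k) v')
        = dotp {..<NN} cc ((mv {..<NN} M1 ^^ k) v)" for k
      unfolding v' cc M1_def NN_def unpair_mv[OF n, where m = m and M = M1p and k = k and v = v'] I_def by (rule unpair_dotp[OF n, symmetric])
    ultimately have "dotp I (\<lambda>(i, a). if i = q then c a else 0) ((mv I M1p ^^ k) v') = 0" for k by simp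
    then have "\<forall>x\<in>I. v' x = 0" unfolding M1p_def by (intro KG) blast
    then show "\<forall>j<NN. v j = 0" using v' in_I by (simp add: unpair_def)
  qed
  \<comment> \<open>The index \<open>x < m * n\<close> encodes exponent \<open>x div n < m\<close>
    and component \<open>x mod n\<close>. The Krylov vectors of agent \<open>q\<close> thus fill a
    square matrix exactly.\<close>
  define R where "R = (\<lambda>x. (mv {..<NN} (\<lambda>r s. [:L2 r s, M1 r s:]) ^^ (x div n))
    (\<lambda>r. [:if r = q * n + x mod n then 1 else 0:]))"
  have R: "(\<Sum>j<NN. poly (R x j) \<delta> * u j)
    = dotp {..<NN} u ((mv {..<NN} (\<lambda>r s. L2 r s + \<delta> * M1 r s) ^^ (x div n)) (\<lambda>r. if r = q * n + x mod n then 1 else 0))" for x \<delta> u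
    using poly_mv_pow[where I = "{..<NN}" and X = L2 and Y = M1 and k = "x div n"
      and c = "\<lambda>r. if r = q * n + x mod n then 1 else 0" and s = \<delta>]
    by (simp add: R_def dotp_def fun_eq_iff mult.commute)
  have Rkb: "dotp {..<NN} u ((mv {..<NN} (\<lambda>r s. L2 r s + \<delta> * M1 r s) ^^ k) (\<lambda>r. if r = q * n + b then 1 else 0)) = 0"
    if "\<And>x. x < NN \<Longrightarrow> (\<Sum>j<NN. poly (R x j) \<delta> * u j) = 0" "k < m" "b < n" for u \<delta> k b
    using that(1)[OF lt[OF that(2,3)]] that(3) unfolding R by simp
  define B2 where "B2 = {\<delta>. \<exists>v. (\<forall>i<NN. (\<Sum>j<NN. poly (R i j) \<delta> * v j) = 0) \<and> (\<exists>j<NN. v j \<noteq> 0)}"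
  have "finite B2" unfolding B2_def
  proof (rule finite_singular_parameters[where ?s0.0 = 0])
    fix u :: "nat \<Rightarrow> real" assume u: "\<And>i. i < NN \<Longrightarrow> (\<Sum>j<NN. poly (R i j) 0 * u j) = 0"
    obtain u' where u': "u = (\<lambda>r. u' (unpair n r))" using repr by blast
    have e: "dotp {..<m} (\<lambda>i. u' (i, b)) ((mv {..<m} (\<lambda>i j. \<eta> i * g i j) ^^ k) (\<lambda>i. if i = q then 1 else 0)) = 0"
      if b: "b < n" and k: "k < m" for b k
    proof -
      have "0 = dotp {..<NN} u ((mv {..<NN} L2 ^^ k) (\<lambda>r. if unpair n r = (q, b) then 1 else 0))"
        using Rkb[OF u k b] by (simp add: unpair_eq_iff[OF b])
      also have "\<dots> = dotp I u' ((mv I L2p ^^ k) (\<lambda>x. if x = (q, b) then 1 else 0))"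
        unfolding u' L2_def NN_def unpair_mv[OF n, where m = m and M = L2p and k = k and v = "\<lambda>x. if x = (q, b) then 1 else 0"] I_def
        by (rule unpair_dotp[OF n])
      also have "\<dots> = dotp I u' (\<lambda>(i, a). if a = b then (mv {..<m} (\<lambda>i j. \<eta> i * g i j) ^^ k) (\<lambda>i. if i = q then 1 else 0) i else 0)"
        unfolding I_def L2p_def kronecker_pow[OF b q] ..
      also have "\<dots> = (\<Sum>i<m. \<Sum>a<n. if a = b then u' (i, a) * (mv {..<m} (\<lambda>i j. \<eta> i * g i j) ^^ k) (\<lambda>i. if i = q then 1 else 0) i else 0)"
        unfolding dotp_def I_def sum.cartesian_product by (intro sum.cong refl) auto
      also have "\<dots> = dotp {..<m} (\<lambda>i. u' (i, b)) ((mv {..<m} (\<lambda>i j. \<eta> i * g i j) ^^ k) (\<lambda>i. if i = q then 1 else 0))"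
        using b by (simp add: dotp_def)
      finally show ?thesis by simp
    qed
    have "\<forall>i<m. u' (i, b) = 0" if b: "b < n" for b
      by (rule \<eta>) (use krylov_stable e[OF b] in blast)
    then show "\<forall>j<NN. u j = 0" using u' in_I by (auto simp: unpair_def I_def)
  qed
  \<comment> \<open>Controllability is tested at \<open>\<delta> = inverse s\<close>, where
    \<open>L2 + \<delta> M1\<close> is the error matrix up to the factor \<open>s\<close>; hence 0
    is excluded too.\<close>
  have "finite (B1 \<union> {0} \<union> inverse ` B2)" using \<open>finite B1\<close> \<open>finite B2\<close> by simp
  from ex_new_if_finite[OF infinite_UNIV_char_0 this] obtain s where "s \<notin> B1 \<union> {0} \<union> inverse ` B2" ..
  moreover have "s \<in> inverse ` B2" if "inverse s \<in> B2" using imageI[OF that, of inverse] by simp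
  ultimately have s: "s \<notin> B1" "s \<noteq> 0" "inverse s \<notin> B2" by blast+
  define \<Gamma>' where "\<Gamma>' = (\<lambda>i a b. t * \<Gamma> i a b + (if a = b then s * \<eta> i else 0))"
  have M: "M K \<Gamma>' = (\<lambda>i j. M1 i j + s * L2 i j)"
    by (auto simp: fun_eq_iff M_def M1_def M1p_def L2_def L2p_def \<Gamma>'_def unpair_def algebra_simps)
  have M': "M K \<Gamma>' = (\<lambda>i j. s * (L2 i j + inverse s * M1 i j))"
    unfolding M using s by (simp add: fun_eq_iff algebra_simps)
  show ?thesis unfolding NN_def[symmetric] cc_def[symmetric]
  proof (rule exI[of _ K], rule exI[of _ \<Gamma>'], intro conjI allI impI)
    fix v r assume "\<forall>k. dotp {..<NN} cc ((mv {..<NN} (M K \<Gamma>') ^^ k) v) = 0" and r: "r < NN"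
    then have "\<forall>i<NN. (\<Sum>j<NN. poly (P i j) s * v j) = 0" unfolding M P by blast
    then show "v r = 0" using s(1) r unfolding B1_def by blast
  next
    fix u r assume u: "\<forall>k<m. \<forall>b<n. dotp {..<NN} u ((mv {..<NN} (M K \<Gamma>') ^^ k) (\<lambda>r. if r = q * n + b then 1 else 0)) = 0"
      and r: "r < NN"
    have "(\<Sum>j<NN. poly (R x j) (inverse s) * u j) = 0" if "x < NN" for x
    proof -
      have "x div n < m" "x mod n < n" using in_I[OF that] by (auto simp: I_def)
      then show ?thesis using u s(2) unfolding R M' mv_pow_scale dotp_scale_right by simp
    qed
    then show "u r = 0" using s(3) r unfolding B2_def by blast
  qed
qed

section \<open>Pole placement by a dynamic compensator\<close>

text \<open>The first row has only two nonzero entries. The minor of the first is the same matrix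
  with \<open>c\<close> shifted; that of the last is triangular with diagonal \<open>-1\<close>, and
  its sign cancels that of the cofactor.\<close>

lemma det_companion:
  fixes x :: "'a::{comm_ring_1,idom}"
  shows "det (mat (Suc d) (Suc d) (\<lambda>(i, j). (if i = j then x else 0) - (if i = Suc j then 1 else 0) + (if j = d then c i else 0)))
    = x ^ Suc d + (\<Sum>i\<le>d. c i * x ^ i)"
proof (induction d arbitrary: c)
  case 0
  show ?case by (subst det_single) auto
next
  case (Suc d)
  let ?f = "\<lambda>d c (i, j). (if i = j then x else 0) - (if i = Suc j then 1 else 0) + (if j = d then c i else 0)"
  let ?A = "mat (Suc (Suc d)) (Suc (Suc d)) (?f (Suc d) c)"
  have A: "?A \<in> carrier_mat (Suc (Suc d)) (Suc (Suc d))" by simp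
  have "det ?A = (\<Sum>j<Suc (Suc d). ?A $$ (0, j) * cofactor ?A 0 j)"
    by (rule laplace_expansion_row[OF A]) simp
  also have "\<dots> = (\<Sum>j\<in>{0, Suc d}. ?A $$ (0, j) * cofactor ?A 0 j)"
    by (rule sum.mono_neutral_right) auto
  also have "\<dots> = x * cofactor ?A 0 0 + c 0 * cofactor ?A 0 (Suc d)" by simp
  also have "cofactor ?A 0 0 = x ^ Suc d + (\<Sum>i\<le>d. c (Suc i) * x ^ i)"
  proof -
    have "mat_delete ?A 0 0 = mat (Suc d) (Suc d) (?f d (\<lambda>i. c (Suc i)))"
      by (intro eq_matI) (auto simp: mat_delete_def)
    then show ?thesis using Suc[of "\<lambda>i. c (Suc i)"] by (simp add: cofactor_def)
  qed
  also have "cofactor ?A 0 (Suc d) = 1"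
  proof -
    have D: "mat_delete ?A 0 (Suc d) = mat (Suc d) (Suc d) (\<lambda>(i, j). (if Suc i = j then x else 0) - (if i = j then 1 else 0))"
      by (intro eq_matI) (auto simp: mat_delete_def)
    have "upper_triangular (mat_delete ?A 0 (Suc d))" unfolding D by (auto simp: upper_triangular_def)
    then have "det (mat_delete ?A 0 (Suc d)) = prod_list (diag_mat (mat_delete ?A 0 (Suc d)))"
      by (rule det_upper_triangular[where n = "Suc d"]) (simp add: D)
    also have "diag_mat (mat_delete ?A 0 (Suc d)) = replicate (Suc d) (- 1)"
      unfolding D by (auto simp: diag_mat_def list_eq_iff_nth_eq simp del: replicate_Suc upt_Suc)
    finally show ?thesis by (simp add: cofactor_def power_mult_distrib[symmetric] del: replicate_Suc)
  qed
  finally show ?case by (simp only: sum.atMost_Suc_shift) (simp add: sum_distrib_left algebra_simps)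
qed

lemma char_poly_companion:
  fixes p :: "'a::field poly"
  assumes p: "monic p" "degree p = d" and d: "d > 0"
  shows "char_poly (mat d d (\<lambda>(i, j). (if i = Suc j then 1 else 0) - (if j = d - 1 then coeff p i else 0))) = p"
proof -
  obtain e where e: "d = Suc e" using d by (cases d) auto
  have "char_poly (mat d d (\<lambda>(i, j). (if i = Suc j then 1 else 0) - (if j = d - 1 then coeff p i else 0)))
    = det (mat (Suc e) (Suc e) (\<lambda>(i, j). (if i = j then [:0, 1:] else 0) - (if i = Suc j then 1 else 0) + (if j = e then [:coeff p i:] else 0)))"
    unfolding char_poly_def char_poly_matrix_def e
    by (intro arg_cong[of _ _ det] eq_matI) (auto simp: one_pCons)
  also have "\<dots> = (\<Sum>i\<le>d. monom (coeff p i) i)"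
    using p unfolding e by (simp add: det_companion monom_altdef)
  also have "\<dots> = p" using poly_as_sum_of_monoms[of p] p by simp
  finally show ?thesis .
qed

text \<open>\<open>G\<close> is injective, hence invertible, and the relation is a similarity. In
  this form a change of basis is checked entrywise on \<open>G\<close> alone.\<close>

lemma char_poly_intertwine:
  fixes G R E :: "nat \<Rightarrow> nat \<Rightarrow> 'a::field"
  assumes inj: "\<And>v. (\<And>i. i < d \<Longrightarrow> (\<Sum>j<d. G i j * v j) = 0) \<Longrightarrow> (\<forall>j<d. v j = 0)"
    and eq: "\<And>i j. i < d \<Longrightarrow> j < d \<Longrightarrow> (\<Sum>t<d. G i t * R t j) = (\<Sum>t<d. E i t * G t j)"
  shows "char_poly (mat d d (\<lambda>(i, j). R i j)) = char_poly (mat d d (\<lambda>(i, j). E i j))"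
proof -
  let ?G = "mat d d (\<lambda>(i, j). G i j)" and ?R = "mat d d (\<lambda>(i, j). R i j)" and ?E = "mat d d (\<lambda>(i, j). E i j)"
  have "det ?G \<noteq> 0" unfolding det_nonzero_iff_kernel_trivial using inj by blast
  then have "?G \<in> Units (ring_mat TYPE('a) d ())" by (intro det_non_zero_imp_unit) auto
  then obtain H where H: "H \<in> carrier_mat d d" "H * ?G = 1\<^sub>m d" "?G * H = 1\<^sub>m d"
    by (auto simp: Units_def ring_mat_def)
  have "?G * ?R = ?E * ?G"
    by (intro eq_matI) (auto simp: scalar_prod_def lessThan_atLeast0[symmetric] eq)
  moreover have "?R = H * (?G * ?R)"
    using H by (simp add: assoc_mult_mat[symmetric, of H d d ?G d ?R d])
  ultimately have "?R = H * ?E * ?G"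
    using H by (simp add: assoc_mult_mat[of H d d ?E d ?G d])
  then have "similar_mat ?R ?E"
    using H by (intro similar_matI[of _ _ H ?G d]) auto
  then show ?thesis by (rule char_poly_similar)
qed

text \<open>The rows \<open>g\<^sub>j = \<Sum>\<^sub>i \<alpha>\<^sub>i\<^sub>+\<^sub>j\<^sub>+\<^sub>1 \<zeta> E\<^sup>i\<close> (Horner's scheme for an annihilating polynomial) satisfy
  \<open>g\<^sub>j E = g\<^sub>j\<^sub>-\<^sub>1 - \<alpha>\<^sub>j \<zeta>\<close>, so \<open>E\<close> is a companion matrix in this basis and \<open>l\<close> changes only its last
  column.\<close>
lemma pole_placement:
  fixes E :: "nat \<Rightarrow> nat \<Rightarrow> 'a::field"
  assumes obs: "\<And>v. (\<And>k. dotp {..<d} \<zeta> ((mv {..<d} E ^^ k) v) = 0) \<Longrightarrow> (\<forall>j<d. v j = 0)"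
    and p: "monic p" "degree p = d"
  shows "\<exists>l. char_poly (mat d d (\<lambda>(i, j). E i j + l i * \<zeta> j)) = p"
proof (cases "d = 0")
  case True
  then have "p = 1" using p monic_degree_0 by blast
  then show ?thesis using True by (simp add: char_poly_def char_poly_matrix_def)
next
  case False
  define r where "r = (\<lambda>k. (rm {..<d} E ^^ k) \<zeta>)"
  have rS: "rm {..<d} E (r k) = r (Suc k)" for k by (simp add: r_def)
  have rv: "dotp {..<d} (r k) v = dotp {..<d} \<zeta> ((mv {..<d} E ^^ k) v)" for k v
    unfolding r_def by (rule dotp_rm_pow)
  have inj: "\<forall>j<d. v j = 0" if "\<And>k. k < d \<Longrightarrow> dotp {..<d} (r k) v = 0" for v
    by (rule obs, rule krylov_stable) (use that in \<open>simp add: rv\<close>)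
  obtain a where a: "\<exists>j\<le>d. a j \<noteq> 0" "\<forall>i<d. (\<Sum>j\<le>d. a j * r j i) = 0"
    using linear_dependence[of d r] by blast
  \<comment> \<open>Otherwise the first \<open>d\<close> rows would be dependent, against
    observability. So the annihilating polynomial can be normalised to be monic.\<close>
  have "a d \<noteq> 0"
  proof
    assume "a d = 0"
    then have z: "\<forall>i<d. (\<Sum>j<d. r j i * a j) = 0" and nz: "\<exists>j<d. a j \<noteq> 0"
      using a by (auto simp: lessThan_Suc_atMost[symmetric] mult.commute less_Suc_eq_le le_less)
    then obtain w where w: "\<exists>i<d. w i \<noteq> 0" "\<forall>j<d. (\<Sum>i<d. w i * r j i) = 0"
      using left_kernel_if_right_kernel[of d "\<lambda>i j. r j i" a] by blast
    have "\<forall>j<d. w j = 0" by (rule inj) (use w(2) in \<open>simp add: dotp_def mult.commute\<close>)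
    then show False using w(1) by blast
  qed
  define \<alpha> where "\<alpha> = (\<lambda>j. a j / a d)"
  have \<alpha>d: "\<alpha> d = 1" using \<open>a d \<noteq> 0\<close> by (simp add: \<alpha>_def)
  have \<alpha>: "(\<Sum>j\<le>d. \<alpha> j * r j i) = 0" if "i < d" for i
    using a(2) that by (simp add: \<alpha>_def sum_divide_distrib[symmetric])
  define g where "g = (\<lambda>j s. \<Sum>i<d - j. \<alpha> (i + j + 1) * r i s)"
  have gdot: "dotp {..<d} (g j) v = (\<Sum>i<d - j. \<alpha> (i + j + 1) * dotp {..<d} (r i) v)" for j v
    unfolding dotp_def g_def sum_distrib_right sum_distrib_left mult.assoc by (rule sum.swap)
  have ginj: "\<forall>j<d. v j = 0" if v: "\<And>i. i < d \<Longrightarrow> (\<Sum>j<d. g i j * v j) = 0" for v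
  proof (rule inj)
    fix k assume "k < d"
    then show "dotp {..<d} (r k) v = 0"
    proof (induction k rule: less_induct)
      case (less k)
      \<comment> \<open>The family \<open>g\<close> is triangular over \<open>r\<close> with
        diagonal \<open>\<alpha> d = 1\<close>: the row \<open>g (d - 1 - k)\<close> is
        \<open>r k\<close> plus multiples of earlier rows.\<close>
      have dk: "d - (d - 1 - k) = Suc k" using less.prems by simp
      have "0 = dotp {..<d} (g (d - 1 - k)) v" using v[of "d - 1 - k"] less.prems by (simp add: dotp_def)
      also have "\<dots> = (\<Sum>i<Suc k. \<alpha> (i + (d - 1 - k) + 1) * dotp {..<d} (r i) v)"
        unfolding gdot dk ..
      also have "\<dots> = \<alpha> (k + (d - 1 - k) + 1) * dotp {..<d} (r k) v"
        using less by simp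
      finally show ?case using less.prems \<alpha>d by simp
    qed
  qed
  have gE: "rm {..<d} E (g j) s = (if j = 0 then 0 else g (j - 1) s) - \<alpha> j * \<zeta> s" if "j < d" "s < d" for j s
  proof -
    have "rm {..<d} E (g j) s = (\<Sum>i<d - j. \<alpha> (i + j + 1) * r (Suc i) s)"
    proof -
      have "rm {..<d} E (g j) s = (\<Sum>i<d - j. \<alpha> (i + j + 1) * rm {..<d} E (r i) s)"
        unfolding rm_def g_def sum_distrib_right sum_distrib_left mult.assoc by (rule sum.swap)
      then show ?thesis by (simp add: rS)
    qed
    also have "\<dots> = (\<Sum>i<Suc (d - j). \<alpha> (i + j) * r i s) - \<alpha> j * r 0 s"
      by (subst sum.lessThan_Suc_shift) simp
    also have "(\<Sum>i<Suc (d - j). \<alpha> (i + j) * r i s) = (if j = 0 then 0 else g (j - 1) s)"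
    proof (cases "j = 0")
      case True
      then show ?thesis using \<alpha>[OF that(2)] by (simp add: lessThan_Suc_atMost)
    next
      case False
      then have "Suc (d - j) = d - (j - 1)" "\<And>i. i + (j - 1) + 1 = i + j" using that by auto
      then show ?thesis using False by (simp add: g_def)
    qed
    finally show ?thesis by (simp add: r_def)
  qed
  \<comment> \<open>The \<open>g j\<close> form a basis, so the numbers \<open>g_j l\<close> can be
    prescribed. These values turn the last column \<open>- \<alpha>\<close> of the companion matrix
    into minus the coefficients of \<open>p\<close>.\<close>
  have "\<exists>l\<in>UNIV. \<forall>j\<in>{..<d}. dotp {..<d} (g j) l = \<alpha> j - coeff p j"
  proof -
    define U where "U = range (\<lambda>l j. dotp {..<d} (g j) l)"
    have "\<exists>u\<in>U. \<forall>j\<in>{..<d}. u j = \<alpha> j - coeff p j"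
    proof (rule annihilator_dual)
      show "(\<lambda>i. 0) \<in> U" unfolding U_def by (auto intro!: image_eqI[of _ _ "\<lambda>_. 0"] simp: dotp_def)
      show "(\<lambda>i. u i + w i) \<in> U" if uw: "u \<in> U" "w \<in> U" for u w
      proof -
        from uw obtain y z where "u = (\<lambda>j. dotp {..<d} (g j) y)" "w = (\<lambda>j. dotp {..<d} (g j) z)"
          by (auto simp: U_def)
        then show ?thesis unfolding U_def
          by (auto intro!: image_eqI[of _ _ "\<lambda>i. y i + z i"] simp: dotp_def sum.distrib distrib_left)
      qed
      show "(\<lambda>i. s * u i) \<in> U" if "u \<in> U" for s u
        using that unfolding U_def by (auto simp: dotp_scale_right[symmetric])
      fix y assume y: "\<And>u. u \<in> U \<Longrightarrow> dotp {..<d} u y = 0"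
      have left: "\<forall>i<d. (\<Sum>j<d. g j i * y j) = 0"
      proof (intro allI impI)
        fix i assume i: "i < d"
        have "dotp {..<d} (\<lambda>j. dotp {..<d} (g j) (\<lambda>s. if s = i then 1 else 0)) y = 0"
          by (rule y) (simp add: U_def)
        then show "(\<Sum>j<d. g j i * y j) = 0" using i by (simp add: dotp_unit dotp_def[of _ _ y])
      qed
      have "\<forall>j<d. y j = 0"
      proof (rule ccontr)
        assume "\<not> ?thesis"
        then obtain w where w: "\<exists>i<d. w i \<noteq> 0" "\<forall>j<d. (\<Sum>i<d. w i * g j i) = 0"
          using left_kernel_if_right_kernel[of d "\<lambda>i j. g j i" y] left by blast
        have "\<forall>j<d. w j = 0" by (rule ginj) (use w(2) in \<open>simp add: mult.commute\<close>)
        then show False using w(1) by blast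
      qed
      then show "dotp {..<d} (\<lambda>j. \<alpha> j - coeff p j) y = 0" by (simp add: dotp_def)
    qed simp
    then show ?thesis by (auto simp: U_def)
  qed
  then obtain l where l: "\<And>j. j < d \<Longrightarrow> dotp {..<d} (g j) l = \<alpha> j - coeff p j" by auto
  have gd: "g (d - 1) s = \<zeta> s" for s
    using False \<alpha>d by (simp add: g_def r_def)
  have "char_poly (mat d d (\<lambda>(i, j). E i j + l i * \<zeta> j))
    = char_poly (mat d d (\<lambda>(i, j). (if i = Suc j then 1 else 0) - (if j = d - 1 then coeff p i else 0)))"
  proof (rule char_poly_intertwine[where G = g, OF ginj])
    fix i j assume ij: "i < d" "j < d"
    have "(\<Sum>t<d. g i t * (E t j + l t * \<zeta> j)) = rm {..<d} E (g i) j + dotp {..<d} (g i) l * \<zeta> j"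
      by (simp add: rm_def dotp_def distrib_left sum.distrib sum_distrib_right mult.assoc)
    also have "\<dots> = (if i = 0 then 0 else g (i - 1) j) - coeff p i * \<zeta> j"
      unfolding gE[OF ij] l[OF ij(1)] by (simp add: left_diff_distrib)
    also have "\<dots> = (\<Sum>t<d. (if t = i - 1 then (if i = 0 then 0 else g t j) else 0)) - (\<Sum>t<d. if t = d - 1 then coeff p i * g t j else 0)"
      using ij gd by auto
    also have "\<dots> = (\<Sum>t<d. ((if i = Suc t then 1 else 0) - (if t = d - 1 then coeff p i else 0)) * g t j)"
      unfolding sum_subtractf[symmetric] by (intro sum.cong refl) (auto simp: left_diff_distrib)
    finally show "(\<Sum>t<d. g i t * (E t j + l t * \<zeta> j))
      = (\<Sum>t<d. ((if i = Suc t then 1 else 0) - (if t = d - 1 then coeff p i else 0)) * g t j)" .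
  qed
  also have "\<dots> = p" using False p by (intro char_poly_companion) auto
  finally show ?thesis by blast
qed

section \<open>The Sylvester equation and the compensator\<close>

lemma sum_lessThan_add: "(\<Sum>t<N + \<mu>. f t) = (\<Sum>t<N. f t) + (\<Sum>j<\<mu>. f (N + j :: nat) :: 'a::comm_monoid_add)"
  by (induction \<mu>) (simp_all add: add.assoc)

text \<open>\<open>B b\<close> is the \<open>b\<close>-th column, so the column index comes first.
  Only coordinates below \<open>N\<close> count.\<close>

definition in_range :: "nat \<Rightarrow> nat \<Rightarrow> (nat \<Rightarrow> nat \<Rightarrow> real) \<Rightarrow> (nat \<Rightarrow> real) \<Rightarrow> bool" where
  "in_range N n B w \<longleftrightarrow> (\<exists>\<eta>. \<forall>r<N. w r = (\<Sum>b<n. B b r * \<eta> b))"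

lemma in_range_add: "in_range N n B v \<Longrightarrow> in_range N n B w \<Longrightarrow> in_range N n B (\<lambda>r. v r + w r)"
proof -
  assume "in_range N n B v" "in_range N n B w"
  then obtain \<eta> \<theta> where "\<forall>r<N. v r = (\<Sum>b<n. B b r * \<eta> b)" "\<forall>r<N. w r = (\<Sum>b<n. B b r * \<theta> b)"
    by (auto simp: in_range_def)
  then show ?thesis unfolding in_range_def
    by (intro exI[of _ "\<lambda>b. \<eta> b + \<theta> b"]) (simp add: distrib_left sum.distrib)
qed

lemma in_range_scale: "in_range N n B v \<Longrightarrow> in_range N n B (\<lambda>r. s * v r)"
proof -
  assume "in_range N n B v"
  then obtain \<eta> where "\<forall>r<N. v r = (\<Sum>b<n. B b r * \<eta> b)" by (auto simp: in_range_def)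
  then show ?thesis unfolding in_range_def
    by (intro exI[of _ "\<lambda>b. s * \<eta> b"]) (simp add: sum_distrib_left mult.left_commute)
qed

lemma in_range_zero: "in_range N n B (\<lambda>r. 0)"
  unfolding in_range_def by (intro exI[of _ "\<lambda>b. 0"]) simp

lemma in_range_column: "b < n \<Longrightarrow> in_range N n B (B b)"
  unfolding in_range_def
  by (intro exI[of _ "\<lambda>b'. if b' = b then 1 else 0"]) (simp add: if_distrib[of "\<lambda>x. _ * x"] cong: if_cong)

text \<open>The chains \<open>x\<^sub>0, \<dots>, x\<^sub>\<mu>\<^sub>-\<^sub>1\<close> solve the Sylvester equation \<open>M X - X Z = \<tau> e\<^sup>T\<close> modulo the range of
  \<open>B\<close> for the companion matrix \<open>Z\<close> with last column \<open>cf\<close>. A functional vanishing on all attainable \<open>\<tau>\<close>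
  kills \<open>M\<^sup>k B\<close>, by induction on \<open>k\<close>: start the chain at index \<open>\<mu> - k\<close>.\<close>
lemma sylvester_chain:
  assumes ctrl: "\<And>u. (\<And>k b. k \<le> \<mu> \<Longrightarrow> b < n \<Longrightarrow> dotp {..<N} u ((mv {..<N} M ^^ k) (B b)) = 0) \<Longrightarrow> (\<forall>r<N. u r = 0)"
    and \<mu>: "\<mu> > 0"
  shows "\<exists>x. in_range N n B (x 0) \<and> (\<forall>j. Suc j < \<mu> \<longrightarrow> in_range N n B (\<lambda>r. x (Suc j) r - mv {..<N} M (x j) r)) \<and>
    in_range N n B (\<lambda>r. mv {..<N} M (x (\<mu> - 1)) r - (\<Sum>j<\<mu>. cf j * x j r) - \<tau> r)"
proof -
  define U where "U = {\<tau>. \<exists>x. in_range N n B (x 0) \<and>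
    (\<forall>j. Suc j < \<mu> \<longrightarrow> in_range N n B (\<lambda>r. x (Suc j) r - mv {..<N} M (x j) r)) \<and>
    in_range N n B (\<lambda>r. mv {..<N} M (x (\<mu> - 1)) r - (\<Sum>j<\<mu>. cf j * x j r) - \<tau> r)}"
  have mv0: "mv {..<N} M (\<lambda>r. 0) = (\<lambda>r. 0)" by (simp add: mv_def)
  have mvadd: "mv {..<N} M (\<lambda>r. v r + w r) = (\<lambda>r. mv {..<N} M v r + mv {..<N} M w r)" for v w
    by (simp add: mv_def distrib_left sum.distrib)
  have "\<exists>u\<in>U. \<forall>r\<in>{..<N}. u r = \<tau> r"
  proof (rule annihilator_dual)
    show "(\<lambda>r. 0) \<in> U" unfolding U_def
      by (intro CollectI exI[of _ "\<lambda>_ _. 0"]) (simp add: mv0 in_range_zero)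
    show "(\<lambda>r. u r + w r) \<in> U" if uw: "u \<in> U" "w \<in> U" for u w
    proof -
      from uw(1) obtain x where x: "in_range N n B (x 0)"
        "\<And>j. Suc j < \<mu> \<Longrightarrow> in_range N n B (\<lambda>r. x (Suc j) r - mv {..<N} M (x j) r)"
        "in_range N n B (\<lambda>r. mv {..<N} M (x (\<mu> - 1)) r - (\<Sum>j<\<mu>. cf j * x j r) - u r)"
        unfolding U_def by blast
      from uw(2) obtain y where y: "in_range N n B (y 0)"
        "\<And>j. Suc j < \<mu> \<Longrightarrow> in_range N n B (\<lambda>r. y (Suc j) r - mv {..<N} M (y j) r)"
        "in_range N n B (\<lambda>r. mv {..<N} M (y (\<mu> - 1)) r - (\<Sum>j<\<mu>. cf j * y j r) - w r)"
        unfolding U_def by blast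
      show ?thesis unfolding U_def
      proof (intro CollectI exI[of _ "\<lambda>j r. x j r + y j r"] conjI allI impI)
        show "in_range N n B (\<lambda>r. x 0 r + y 0 r)" by (rule in_range_add[OF x(1) y(1)])
        show "in_range N n B (\<lambda>r. x (Suc j) r + y (Suc j) r - mv {..<N} M (\<lambda>r. x j r + y j r) r)" if "Suc j < \<mu>" for j
          using in_range_add[OF x(2)[OF that] y(2)[OF that]] by (simp add: mvadd algebra_simps)
        show "in_range N n B (\<lambda>r. mv {..<N} M (\<lambda>r. x (\<mu> - 1) r + y (\<mu> - 1) r) r - (\<Sum>j<\<mu>. cf j * (x j r + y j r)) - (u r + w r))"
          using in_range_add[OF x(3) y(3)] by (simp add: mvadd sum.distrib algebra_simps)
      qed
    qed
    show "(\<lambda>r. s * u r) \<in> U" if u: "u \<in> U" for s u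
    proof -
      from u obtain x where x: "in_range N n B (x 0)"
        "\<And>j. Suc j < \<mu> \<Longrightarrow> in_range N n B (\<lambda>r. x (Suc j) r - mv {..<N} M (x j) r)"
        "in_range N n B (\<lambda>r. mv {..<N} M (x (\<mu> - 1)) r - (\<Sum>j<\<mu>. cf j * x j r) - u r)"
        unfolding U_def by blast
      show ?thesis unfolding U_def
      proof (intro CollectI exI[of _ "\<lambda>j r. s * x j r"] conjI allI impI)
        show "in_range N n B (\<lambda>r. s * x 0 r)" by (rule in_range_scale[OF x(1)])
        show "in_range N n B (\<lambda>r. s * x (Suc j) r - mv {..<N} M (\<lambda>r. s * x j r) r)" if "Suc j < \<mu>" for j
          using in_range_scale[OF x(2)[OF that], of s] by (simp add: mv_vscale right_diff_distrib)
        show "in_range N n B (\<lambda>r. mv {..<N} M (\<lambda>r. s * x (\<mu> - 1) r) r - (\<Sum>j<\<mu>. cf j * (s * x j r)) - s * u r)"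
          using in_range_scale[OF x(3), of s]
          by (simp add: mv_vscale right_diff_distrib sum_distrib_left mult.left_commute)
      qed
    qed
    fix u assume u: "\<And>v. v \<in> U \<Longrightarrow> dotp {..<N} v u = 0"
    have "dotp {..<N} u ((mv {..<N} M ^^ k) (B b)) = 0" if "k \<le> \<mu>" "b < n" for k b
      using that(1)
    proof (induction k rule: less_induct)
      case (less k)
      show ?case
      proof (cases "k = 0")
        case True
        \<comment> \<open>The zero chain leaves \<open>- \<tau>\<close> in the last condition, so
          every column of \<open>B\<close> is attainable.\<close>
        have "B b \<in> U" unfolding U_def
          using in_range_scale[OF in_range_column[OF that(2)], where s = "-1"]
          by (intro CollectI exI[of _ "\<lambda>_ _. 0"]) (simp add: mv0 in_range_zero)
        from u[OF this] show ?thesis using True by (simp add: dotp_def mult.commute)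
      next
        case False
        \<comment> \<open>The chain is zero before index \<open>\<mu> - k\<close>, jumps to
          \<open>B b\<close> there and then follows \<open>M\<close> exactly, ending in
          \<open>M^k B b\<close> after the last application of \<open>M\<close>. The
          \<open>cf\<close> terms contain only lower powers, which the induction hypothesis removes.
          For \<open>k = \<mu>\<close> it starts at index 0, where a column of \<open>B\<close> is
          admissible.\<close>
        define x where "x = (\<lambda>j r. if j < \<mu> - k then 0 else (mv {..<N} M ^^ (j - (\<mu> - k))) (B b) r)"
        define v where "v = (\<lambda>r. mv {..<N} M (x (\<mu> - 1)) r - (\<Sum>j<\<mu>. cf j * x j r))"
        have x0: "x j = (\<lambda>r. 0)" if "j < \<mu> - k" for j using that by (simp add: x_def)
        have x1: "x j = (mv {..<N} M ^^ (j - (\<mu> - k))) (B b)" if "\<not> j < \<mu> - k" for j using that by (simp add: x_def)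
        have "v \<in> U" unfolding U_def
        proof (intro CollectI exI[of _ x] conjI allI impI)
          show "in_range N n B (x 0)"
            using x0[of 0] x1[of 0] in_range_zero in_range_column[OF that(2)] by (cases "0 < \<mu> - k") auto
          show "in_range N n B (\<lambda>r. mv {..<N} M (x (\<mu> - 1)) r - (\<Sum>j<\<mu>. cf j * x j r) - v r)"
            by (simp add: v_def in_range_zero)
          fix j assume "Suc j < \<mu>"
          consider "Suc j < \<mu> - k" | "Suc j = \<mu> - k" | "\<not> j < \<mu> - k" by linarith
          then show "in_range N n B (\<lambda>r. x (Suc j) r - mv {..<N} M (x j) r)"
          proof cases
            case 1
            then show ?thesis by (simp add: x0 mv0 in_range_zero)
          next
            case 2
            then show ?thesis using in_range_column[OF that(2)] by (simp add: x0 x1 mv0)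
          next
            case 3
            then show ?thesis by (simp add: x1 Suc_diff_le in_range_zero)
          qed
        qed
        then have "0 = dotp {..<N} u v" using u[of v] by (simp add: dotp_def mult.commute)
        also have "\<dots> = dotp {..<N} u (mv {..<N} M (x (\<mu> - 1))) - (\<Sum>j<\<mu>. cf j * dotp {..<N} u (x j))"
        proof -
          have "dotp {..<N} u (\<lambda>r. \<Sum>j<\<mu>. cf j * x j r) = (\<Sum>j<\<mu>. cf j * dotp {..<N} u (x j))"
            unfolding dotp_def sum_distrib_left by (subst sum.swap) (simp add: mult.left_commute)
          then show ?thesis unfolding v_def dotp_diff_right by simp
        qed
        also have "(\<Sum>j<\<mu>. cf j * dotp {..<N} u (x j)) = 0"
        proof (rule sum.neutral, rule ballI)
          fix j assume j: "j \<in> {..<\<mu>}"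
          show "cf j * dotp {..<N} u (x j) = 0"
          proof (cases "j < \<mu> - k")
            case True
            then show ?thesis by (simp add: x0 dotp_def)
          next
            case False
            then show ?thesis using less.IH[of "j - (\<mu> - k)"] less.prems j by (simp add: x1)
          qed
        qed
        also have "mv {..<N} M (x (\<mu> - 1)) = (mv {..<N} M ^^ k) (B b)"
        proof -
          have "Suc (\<mu> - 1 - (\<mu> - k)) = k" using False less.prems by simp
          moreover have "\<not> \<mu> - 1 < \<mu> - k" using False less.prems by simp
          ultimately show ?thesis using x1[of "\<mu> - 1"] by (metis funpow.simps(2) o_apply)
        qed
        finally show ?thesis by simp
      qed
    qed
    then have "\<forall>r<N. u r = 0" using ctrl by blast
    then show "dotp {..<N} \<tau> u = 0" by (simp add: dotp_def)
  qed simp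
  then obtain v where v: "v \<in> U" "\<And>r. r < N \<Longrightarrow> v r = \<tau> r" by auto
  from v(1) obtain x where x: "in_range N n B (x 0)"
    "\<And>j. Suc j < \<mu> \<Longrightarrow> in_range N n B (\<lambda>r. x (Suc j) r - mv {..<N} M (x j) r)"
    "in_range N n B (\<lambda>r. mv {..<N} M (x (\<mu> - 1)) r - (\<Sum>j<\<mu>. cf j * x j r) - v r)"
    unfolding U_def by blast
  have "in_range N n B (\<lambda>r. mv {..<N} M (x (\<mu> - 1)) r - (\<Sum>j<\<mu>. cf j * x j r) - \<tau> r)"
    using x(3) v(2) unfolding in_range_def by auto
  then show ?thesis using x by blast
qed

text \<open>Block matrix of plant and compensator. One scalar \<open>c\<close> drives both the
  static feedback \<open>B d\<close> and the compensator, whose state enters the plant only through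
  \<open>B\<close>.\<close>

definition loop_mat :: "nat \<Rightarrow> nat \<Rightarrow> (nat \<Rightarrow> nat \<Rightarrow> real) \<Rightarrow> (nat \<Rightarrow> nat \<Rightarrow> real) \<Rightarrow> (nat \<Rightarrow> real)
    \<Rightarrow> (nat \<Rightarrow> real) \<Rightarrow> (nat \<Rightarrow> nat \<Rightarrow> real) \<Rightarrow> (nat \<Rightarrow> real) \<Rightarrow> (nat \<Rightarrow> nat \<Rightarrow> real) \<Rightarrow> nat \<Rightarrow> nat \<Rightarrow> real" where
  "loop_mat N n M B c d Cz kz Az r s =
    (if r < N then if s < N then M r s + (\<Sum>b<n. B b r * d b) * c s else (\<Sum>b<n. B b r * Cz b (s - N))
     else if s < N then kz (r - N) * c s else Az (r - N) (s - N))"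

text \<open>Delaying the scalar output \<open>c e\<close> through a chain of \<open>\<mu>\<close> integrators gives an observable pair, so
  output injection from the end of the chain assigns the spectrum; the change of coordinates
  \<open>e = e' + X z\<close> moves the injection into \<open>e\<close> to the range of \<open>B\<close>.\<close>
lemma compensator_spectrum:
  assumes obs: "\<And>v. (\<And>k. dotp {..<N} c ((mv {..<N} M ^^ k) v) = 0) \<Longrightarrow> (\<forall>r<N. v r = 0)"
    and ctrl: "\<And>u. (\<And>k b. k \<le> \<mu> \<Longrightarrow> b < n \<Longrightarrow> dotp {..<N} u ((mv {..<N} M ^^ k) (B b)) = 0) \<Longrightarrow> (\<forall>r<N. u r = 0)"
    and p: "monic p" "degree p = N + \<mu>"
  shows "\<exists>d Cz kz Az. char_poly (mat (N + \<mu>) (N + \<mu>) (\<lambda>(r, s). loop_mat N n M B c d Cz kz Az r s)) = p"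
proof (cases "\<mu> = 0")
  case True
  from pole_placement[where p = p, OF obs] p True obtain l where
    l: "char_poly (mat N N (\<lambda>(i, j). M i j + l i * c j)) = p" by auto
  \<comment> \<open>Without compensator states \<open>ctrl\<close> concerns \<open>k = 0\<close>
    only, so the columns of \<open>B\<close> span everything and any injection has the form
    \<open>B d\<close>.\<close>
  have "\<exists>u\<in>Collect (in_range N n B). \<forall>r\<in>{..<N}. u r = l r"
  proof (rule annihilator_dual)
    fix u assume u: "\<And>v. v \<in> Collect (in_range N n B) \<Longrightarrow> dotp {..<N} v u = 0"
    have "\<forall>r<N. u r = 0"
    proof (rule ctrl)
      fix k b assume "k \<le> \<mu>" "b < n"
      then show "dotp {..<N} u ((mv {..<N} M ^^ k) (B b)) = 0"
        using u[of "B b"] in_range_column[of b n N B] True by (simp add: dotp_def mult.commute)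
    qed
    then show "dotp {..<N} l u = 0" by (simp add: dotp_def)
  qed (auto intro: in_range_zero in_range_add in_range_scale)
  then obtain u where u: "in_range N n B u" "\<And>r. r < N \<Longrightarrow> u r = l r" by auto
  from u(1) obtain d where "\<And>r. r < N \<Longrightarrow> u r = (\<Sum>b<n. B b r * d b)" unfolding in_range_def by blast
  with u(2) have d: "l r = (\<Sum>b<n. B b r * d b)" if "r < N" for r using that by simp
  have "mat (N + \<mu>) (N + \<mu>) (\<lambda>(r, s). loop_mat N n M B c d Cz kz Az r s) = mat N N (\<lambda>(i, j). M i j + l i * c j)" for Cz kz Az
    using True d by (intro eq_matI) (auto simp: loop_mat_def)
  then have "char_poly (mat (N + \<mu>) (N + \<mu>) (\<lambda>(r, s). loop_mat N n M B c d (\<lambda>_ _. 0) (\<lambda>_. 0) (\<lambda>_ _. 0) r s)) = p"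
    using l by simp
  then show ?thesis by blast
next
  case False
  then have \<mu>: "\<mu> > 0" by simp
  define dd where "dd = N + \<mu>"
  \<comment> \<open>The plant followed by the chain: position \<open>N\<close> integrates the
    output, each later position integrates its predecessor, and \<open>\<zeta>\<close> reads the
    end.\<close>
  define E where "E = (\<lambda>r s. if r < N then (if s < N then M r s else 0)
    else if r = N then (if s < N then c s else 0) else (if N \<le> s \<and> Suc s = r then 1 else 0))"
  define \<zeta> where "\<zeta> = (\<lambda>s. if s = N + (\<mu> - 1) then 1 else 0 :: real)"
  have E1: "mv {..<dd} E v r = mv {..<N} M v r" if "r < N" for v r
    using that by (simp add: mv_def E_def dd_def sum_lessThan_add)
  have E2: "mv {..<dd} E v N = dotp {..<N} c v" for v
    by (simp add: mv_def dotp_def E_def dd_def sum_lessThan_add)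
  have E3: "mv {..<dd} E v (Suc (N + j)) = v (N + j)" if "Suc j < \<mu>" for v j
  proof -
    have "(\<Sum>t<N. E (Suc (N + j)) t * v t) = 0" by (rule sum.neutral) (auto simp: E_def)
    moreover have "(\<Sum>i<\<mu>. E (Suc (N + j)) (N + i) * v (N + i)) = (\<Sum>i<\<mu>. if i = j then v (N + i) else 0)"
      by (intro sum.cong refl) (auto simp: E_def)
    ultimately show ?thesis using that by (simp add: mv_def dd_def sum_lessThan_add)
  qed
  have "\<forall>j<dd. v j = 0" if v: "\<And>k. dotp {..<dd} \<zeta> ((mv {..<dd} E ^^ k) v) = 0" for v
  proof -
    define w where "w = (\<lambda>k. (mv {..<dd} E ^^ k) v)"
    have wS: "w (Suc k) = mv {..<dd} E (w k)" for k by (simp add: w_def)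
    have last: "w k (N + (\<mu> - 1)) = 0" for k
      using v[of k] \<mu> unfolding \<zeta>_def w_def by (subst (asm) dotp_unit_left) (auto simp: dd_def)
    \<comment> \<open>Backwards along the chain: a state that is zero at all times forces its
      predecessor to be zero at all times.\<close>
    have z: "w k (N + (\<mu> - 1 - i)) = 0" if "i < \<mu>" for i k
      using that
    proof (induction i arbitrary: k)
      case (Suc i)
      have "Suc (N + (\<mu> - 1 - Suc i)) = N + (\<mu> - 1 - i)" using Suc.prems by simp
      then show ?case using E3[of "\<mu> - 1 - Suc i" "w k"] Suc.IH[of "Suc k"] Suc.prems
        by (simp add: wS)
    qed (use last in simp)
    have z: "w k (N + j) = 0" if "j < \<mu>" for j k using z[of "\<mu> - 1 - j" k] that by simp
    have top: "w k r = (mv {..<N} M ^^ k) v r" if "r < N" for k r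
      using that
    proof (induction k arbitrary: r)
      case (Suc k)
      have "w (Suc k) r = mv {..<N} M (w k) r" using E1[OF Suc.prems] by (simp add: wS)
      also have "mv {..<N} M (w k) = mv {..<N} M ((mv {..<N} M ^^ k) v)"
        using Suc.IH by (intro mv_cong) auto
      finally show ?case by simp
    qed (simp add: w_def)
    have "\<forall>r<N. v r = 0"
    proof (rule obs)
      fix k
      have "dotp {..<N} c ((mv {..<N} M ^^ k) v) = dotp {..<N} c (w k)"
        by (rule dotp_cong) (use top in auto)
      also have "\<dots> = w (Suc k) N" by (simp add: wS E2)
      also have "\<dots> = 0" using z[of 0 "Suc k"] \<mu> by simp
      finally show "dotp {..<N} c ((mv {..<N} M ^^ k) v) = 0" .
    qed
    moreover have "v (N + j) = 0" if "j < \<mu>" for j using z[OF that, of 0] by (simp add: w_def)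
    ultimately show ?thesis unfolding dd_def by (metis add_diff_inverse_nat nat_add_left_cancel_less)
  qed
  from pole_placement[where p = p, OF this] p obtain l where
    l: "char_poly (mat dd dd (\<lambda>(i, j). E i j + l i * \<zeta> j)) = p" by (auto simp: dd_def)
  \<comment> \<open>The injections into the chain become the last column of \<open>Z\<close>;
    \<open>\<tau> = - l\<close> cancels the injection into \<open>e\<close> up to the range of
    \<open>B\<close>.\<close>
  from sylvester_chain[where N = N and n = n and B = B and M = M and cf = "\<lambda>j. l (N + j)" and \<tau> = "\<lambda>r. - l r", OF ctrl \<mu>]
  obtain x where x0: "in_range N n B (x 0)"
    and xS: "\<And>j. Suc j < \<mu> \<Longrightarrow> in_range N n B (\<lambda>r. x (Suc j) r - mv {..<N} M (x j) r)"
    and xl: "in_range N n B (\<lambda>r. mv {..<N} M (x (\<mu> - 1)) r - (\<Sum>j<\<mu>. l (N + j) * x j r) + l r)"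
    by auto
  define Z where "Z = (\<lambda>i j. (if i = Suc j then 1 else 0) + (if j = \<mu> - 1 then l (N + i) else 0))"
  define XZ where "XZ = (\<lambda>r j. \<Sum>i<\<mu>. x i r * Z i j)"
  \<comment> \<open>The upper right block in the new coordinates,
    \<open>M X + l e^T - x_0 c X - X Z\<close>. The Sylvester relations put each column into the
    range of \<open>B\<close>, so it can be realised as \<open>B Cz\<close>.\<close>
  define T where "T = (\<lambda>r j. mv {..<N} M (x j) r + (if j = \<mu> - 1 then l r else 0) - x 0 r * dotp {..<N} c (x j) - XZ r j)"
  have inT: "in_range N n B (\<lambda>r. T r j)" if j: "j < \<mu>" for j
  proof (cases "j = \<mu> - 1")
    case True
    then have "XZ r j = (\<Sum>i<\<mu>. l (N + i) * x i r)" for r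
      unfolding XZ_def by (intro sum.cong refl) (auto simp: Z_def)
    then have "T r j = (mv {..<N} M (x (\<mu> - 1)) r - (\<Sum>j<\<mu>. l (N + j) * x j r) + l r) + (- dotp {..<N} c (x j)) * x 0 r" for r
      using True by (simp add: T_def)
    then show ?thesis using in_range_add[OF xl in_range_scale[OF x0, of "- dotp {..<N} c (x j)"]] by simp
  next
    case False
    then have "XZ r j = (\<Sum>i<\<mu>. if i = Suc j then x i r else 0)" for r
      unfolding XZ_def by (intro sum.cong refl) (auto simp: Z_def)
    then have "XZ r j = x (Suc j) r" for r using False j by simp
    then have "T r j = (-1) * (x (Suc j) r - mv {..<N} M (x j) r) + (- dotp {..<N} c (x j)) * x 0 r" for r
      using False by (simp add: T_def)
    moreover have xj: "in_range N n B (\<lambda>r. x (Suc j) r - mv {..<N} M (x j) r)" using False j by (intro xS) simp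
    ultimately show ?thesis
      using in_range_add[OF in_range_scale[OF xj, of "-1"] in_range_scale[OF x0, of "- dotp {..<N} c (x j)"]] by simp
  qed
  have "\<forall>j. \<exists>\<eta>. j < \<mu> \<longrightarrow> (\<forall>r<N. T r j = (\<Sum>b<n. B b r * \<eta> b))"
    using inT unfolding in_range_def by blast
  then obtain Cz where Cz: "\<And>j r. j < \<mu> \<Longrightarrow> r < N \<Longrightarrow> T r j = (\<Sum>b<n. B b r * Cz j b)" by metis
  from in_range_scale[OF x0, of "-1"] obtain d where d: "\<And>r. r < N \<Longrightarrow> - x 0 r = (\<Sum>b<n. B b r * d b)"
    by (auto simp: in_range_def)
  define kz where "kz = (\<lambda>i::nat. if i = 0 then 1 else 0 :: real)"
  define Az where "Az = (\<lambda>i j. (if i = 0 then dotp {..<N} c (x j) else 0) + Z i j)"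
  define R where "R = loop_mat N n M B c d (\<lambda>b j. Cz j b) kz Az"
  \<comment> \<open>The block matrix with identity diagonal blocks and \<open>X\<close> in the upper
    right corner, which realises \<open>e = e' + X z\<close>.\<close>
  define G where "G = (\<lambda>r s. (if r = s then 1 else 0) + (if r < N \<and> N \<le> s then x (s - N) r else 0))"
  have Gsum: "(\<Sum>t<dd. G r t * f t) = f r + (if r < N then \<Sum>j<\<mu>. x j r * f (N + j) else 0)" if "r < dd" for r f
  proof -
    have "(\<Sum>t<dd. G r t * f t) = (\<Sum>t<dd. if t = r then f t else 0) + (\<Sum>t<dd. if r < N \<and> N \<le> t then x (t - N) r * f t else 0)"
      unfolding sum.distrib[symmetric] by (intro sum.cong refl) (auto simp: G_def algebra_simps)
    also have "(\<Sum>t<dd. if r < N \<and> N \<le> t then x (t - N) r * f t else 0) = (if r < N then \<Sum>j<\<mu>. x j r * f (N + j) else 0)"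
      unfolding dd_def sum_lessThan_add by simp
    finally show ?thesis using that by simp
  qed
  have Ginj: "\<forall>j<dd. v j = 0" if v: "\<And>i. i < dd \<Longrightarrow> (\<Sum>j<dd. G i j * v j) = 0" for v
  proof -
    have low: "v (N + j) = 0" if "j < \<mu>" for j
      using v[of "N + j"] Gsum[of "N + j" v] that by (simp add: dd_def)
    have "v r = 0" if "r < N" for r
      using v[of r] Gsum[of r v] that low by (simp add: dd_def)
    then show ?thesis using low unfolding dd_def by (metis add_diff_inverse_nat nat_add_left_cancel_less)
  qed
  have "char_poly (mat dd dd (\<lambda>(i, j). R i j)) = char_poly (mat dd dd (\<lambda>(i, j). E i j + l i * \<zeta> j))"
  proof (rule char_poly_intertwine[where G = G, OF Ginj])
    fix r s assume r: "r < dd" and s: "s < dd"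
    have lhs: "(\<Sum>t<dd. G r t * R t s) = R r s + (if r < N then \<Sum>j<\<mu>. x j r * R (N + j) s else 0)"
      by (rule Gsum[OF r])
    have rhs: "(\<Sum>t<dd. (E r t + l r * \<zeta> t) * G t s)
      = (if s < N then E r s else (\<Sum>t<N. E r t * x (s - N) t) + E r s + l r * \<zeta> s)"
    proof -
      have "(\<Sum>t<dd. (E r t + l r * \<zeta> t) * G t s) = (\<Sum>t<dd. if t = s then E r t + l r * \<zeta> t else 0)
          + (\<Sum>t<dd. if t < N \<and> N \<le> s then (E r t + l r * \<zeta> t) * x (s - N) t else 0)"
        unfolding sum.distrib[symmetric] by (intro sum.cong refl) (auto simp: G_def algebra_simps)
      also have "(\<Sum>t<dd. if t < N \<and> N \<le> s then (E r t + l r * \<zeta> t) * x (s - N) t else 0)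
          = (if N \<le> s then \<Sum>t<N. E r t * x (s - N) t else 0)"
        unfolding dd_def sum_lessThan_add by (auto simp: \<zeta>_def intro!: sum.cong)
      finally show ?thesis using s \<mu> by (auto simp: \<zeta>_def)
    qed
    consider "r < N" "s < N" | i where "r = N + i" "i < \<mu>" "s < N" | j where "r < N" "s = N + j" "j < \<mu>"
      | i j where "r = N + i" "i < \<mu>" "s = N + j" "j < \<mu>"
      using r s unfolding dd_def by (metis add_diff_inverse_nat nat_add_left_cancel_less)
    then show "(\<Sum>t<dd. G r t * R t s) = (\<Sum>t<dd. (E r t + l r * \<zeta> t) * G t s)"
    proof cases
      case 1
      have "(\<Sum>j<\<mu>. x j r * R (N + j) s) = (\<Sum>j<\<mu>. if j = 0 then x j r * c s else 0)"
        using 1 by (intro sum.cong refl) (simp add: R_def loop_mat_def kz_def)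
      then show ?thesis using 1 \<mu> unfolding lhs rhs
        by (simp add: R_def loop_mat_def d[symmetric] E_def)
    next
      case 2
      then show ?thesis unfolding lhs rhs by (auto simp: R_def loop_mat_def kz_def E_def)
    next
      case 3
      have "(\<Sum>i<\<mu>. x i r * R (N + i) s) = (\<Sum>i<\<mu>. (if i = 0 then x i r * dotp {..<N} c (x j) else 0) + x i r * Z i j)"
        using 3 by (intro sum.cong refl) (simp add: R_def loop_mat_def Az_def algebra_simps)
      also have "\<dots> = x 0 r * dotp {..<N} c (x j) + XZ r j" using \<mu> by (simp add: sum.distrib XZ_def)
      finally have "(\<Sum>t<dd. G r t * R t s) = T r j + x 0 r * dotp {..<N} c (x j) + XZ r j"
        using 3 unfolding lhs by (simp add: R_def loop_mat_def Cz)
      also have "\<dots> = mv {..<N} M (x j) r + (if j = \<mu> - 1 then l r else 0)" by (simp add: T_def)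
      finally have "(\<Sum>t<dd. G r t * R t s) = mv {..<N} M (x j) r + (if j = \<mu> - 1 then l r else 0)" .
      moreover have "\<zeta> s = (if j = \<mu> - 1 then 1 else 0)" using 3(2) by (simp only: \<zeta>_def add_left_cancel)
      ultimately show ?thesis using 3 unfolding rhs by (simp add: mv_def E_def)
    next
      case 4
      then have "(\<Sum>t<dd. G r t * R t s) = (if i = 0 then dotp {..<N} c (x j) else 0) + Z i j"
        unfolding lhs by (simp add: R_def loop_mat_def Az_def)
      moreover have "(\<Sum>t<N. E r t * x (s - N) t) = (if i = 0 then dotp {..<N} c (x j) else 0)"
        using 4 by (simp add: E_def dotp_def)
      moreover have "\<zeta> s = (if j = \<mu> - 1 then 1 else 0)" using 4(3) by (simp only: \<zeta>_def add_left_cancel)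
      ultimately show ?thesis using 4 unfolding rhs by (auto simp: E_def Z_def)
    qed
  qed
  then have "char_poly (mat dd dd (\<lambda>(i, j). R i j)) = p" using l by simp
  then show ?thesis unfolding R_def dd_def by blast
qed

section \<open>Transfer to the matrix statement\<close>

text \<open>Conjugating the coefficients conjugates the roots, so the coefficients of the product
  are fixed by \<open>cnj\<close> and hence real.\<close>

lemma real_poly_of_conjugation_invariant_roots:
  assumes "image_mset cnj \<Lambda> = \<Lambda>"
  shows "\<exists>p :: real poly. monic p \<and> degree p = size \<Lambda> \<and> map_poly complex_of_real p = (\<Prod>\<mu>\<in>#\<Lambda>. [:- \<mu>, 1:])"
proof -
  let ?P = "\<lambda>\<Lambda>. \<Prod>\<mu>\<in>#\<Lambda>. [:- \<mu>, 1:]"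
  have cnj_mult: "map_poly cnj (p * r) = map_poly cnj p * map_poly cnj r" for p r
    by (rule poly_eqI) (simp add: coeff_map_poly coeff_mult)
  have cnj: "map_poly cnj (?P M) = ?P (image_mset cnj M)" for M
    by (induction M) (simp_all add: cnj_mult map_poly_pCons del: mult_pCons_left)
  have deg: "monic (?P M) \<and> degree (?P M) = size M" for M :: "complex multiset"
  proof (induction M)
    case (add \<mu> M)
    then have "?P M \<noteq> 0" by auto
    then have "degree ([:- \<mu>, 1:] * ?P M) = Suc (size M)"
      using add by (subst degree_mult_eq) auto
    moreover have "monic ([:- \<mu>, 1:] * ?P M)"
      unfolding lead_coeff_mult conjunct1[OF add] by simp
    ultimately show ?case by simp
  qed simp
  have "cnj (coeff (?P \<Lambda>) i) = coeff (?P \<Lambda>) i" for i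
    using cnj[of \<Lambda>] assms by (metis coeff_map_poly complex_cnj_zero)
  then have real: "complex_of_real (Re (coeff (?P \<Lambda>) i)) = coeff (?P \<Lambda>) i" for i
    by (metis Reals_cnj_iff of_real_Re)
  define p where "p = map_poly Re (?P \<Lambda>)"
  have p: "map_poly complex_of_real p = ?P \<Lambda>"
    by (rule poly_eqI) (simp add: p_def coeff_map_poly real)
  have "degree p = degree (?P \<Lambda>)" unfolding p[symmetric] by simp
  moreover have "complex_of_real (lead_coeff p) = lead_coeff (?P \<Lambda>)"
    unfolding p[symmetric] by (simp add: coeff_map_poly)
  ultimately show ?thesis using deg[of \<Lambda>] p by (intro exI[of _ p]) auto
qed

text \<open>The degree leaves out \<open>i\<close> itself, in agreement with the vanishing term
  \<open>e_i - e_i\<close> in the coupling.\<close>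

definition graph_laplacian :: "(nat \<Rightarrow> nat set) \<Rightarrow> nat \<Rightarrow> nat \<Rightarrow> real" where
  "graph_laplacian N i j = (if i = j then real (card (N i - {i})) else if j \<in> N i then - 1 else 0)"

lemma graph_laplacian_sum:
  assumes "i < m" "N i \<subseteq> {0..<m}"
  shows "(\<Sum>j<m. graph_laplacian N i j * f j) = (\<Sum>j\<in>N i. f i - f j)"
proof -
  have fin: "finite (N i)" using assms(2) by (rule finite_subset) simp
  have "(\<Sum>j<m. graph_laplacian N i j * f j)
      = graph_laplacian N i i * f i + (\<Sum>j\<in>{..<m} - {i}. graph_laplacian N i j * f j)"
    using assms(1) by (intro sum.remove) auto
  also have "(\<Sum>j\<in>{..<m} - {i}. graph_laplacian N i j * f j) = (\<Sum>j\<in>N i - {i}. - f j)"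
    by (rule sum.mono_neutral_cong_right) (use assms(2) in \<open>auto simp: graph_laplacian_def\<close>)
  also have "graph_laplacian N i i * f i = (\<Sum>j\<in>N i - {i}. f i)" by (simp add: graph_laplacian_def)
  also have "(\<Sum>j\<in>N i - {i}. f i) + (\<Sum>j\<in>N i - {i}. - f j) = (\<Sum>j\<in>N i - {i}. f i - f j)"
    by (simp add: sum_subtractf sum_negf)
  also have "\<dots> = (\<Sum>j\<in>N i. f i - f j)"
    by (rule sum.mono_neutral_left) (use fin in auto)
  finally show ?thesis .
qed

lemma rtrancl_enters_set:
  assumes "(a, b) \<in> E\<^sup>*" "a \<notin> S" "b \<in> S"
  shows "\<exists>u v. (u, v) \<in> E \<and> u \<notin> S \<and> v \<in> S"
  using assms by (induction rule: rtrancl_induct) auto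

lemma irreducible_graph_laplacian:
  assumes N: "\<And>i. i < m \<Longrightarrow> N i \<subseteq> {0..<m}"
    and conn: "strongly_connected_graph m (neighbor_arcs m N)"
  shows "irreducible_laplacian m (graph_laplacian N)"
  unfolding irreducible_laplacian_def
proof (intro conjI allI impI)
  show "(\<Sum>j<m. graph_laplacian N i j) = 0" if "i < m" for i
    using graph_laplacian_sum[where N = N and f = "\<lambda>_. 1", OF that N[OF that]] by simp
  show "graph_laplacian N i j \<le> 0" if "i \<noteq> j" for i j
    using that by (simp add: graph_laplacian_def)
  fix S assume S: "S \<subseteq> {..<m}" "S \<noteq> {}" "S \<noteq> {..<m}"
  then obtain a b where "a < m" "a \<notin> S" "b \<in> S" by auto
  moreover from this have "(a, b) \<in> (neighbor_arcs m N)\<^sup>*"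
    using conn S by (auto simp: strongly_connected_graph_def)
  \<comment> \<open>An arc from \<open>u\<close> to \<open>v\<close> means that \<open>v\<close>
    listens to \<open>u\<close>, so the negative entry is in row \<open>v\<close> and column
    \<open>u\<close>: the path enters \<open>S\<close>, the dependence leaves it.\<close>
  ultimately obtain u v where "(u, v) \<in> neighbor_arcs m N" "u \<notin> S" "v \<in> S"
    using rtrancl_enters_set by metis
  then show "\<exists>i\<in>S. \<exists>j\<in>{..<m} - S. graph_laplacian N i j < 0"
    by (intro bexI[of _ v] bexI[of _ u]) (auto simp: neighbor_arcs_def graph_laplacian_def)
qed

section \<open>Entrywise reading of the hypotheses and of the error system\<close>

lemma mult_mat_vec_entry:
  assumes "A \<in> carrier_mat nr nc" "i < nr"
  shows "(A *\<^sub>v vec nc v) $ i = (\<Sum>j<nc. A $$ (i, j) * v j)"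
  using assms by (simp add: scalar_prod_def lessThan_atLeast0)

lemma pow_mat_mult_vec:
  assumes "A \<in> carrier_mat n n"
  shows "(A ^\<^sub>m k) *\<^sub>v vec n v = vec n ((mv {..<n} (\<lambda>a b. A $$ (a, b)) ^^ k) v)"
proof (induction k arbitrary: v)
  case (Suc k)
  have "A *\<^sub>v vec n v = vec n (mv {..<n} (\<lambda>a b. A $$ (a, b)) v)"
    using assms by (intro eq_vecI) (auto simp: mult_mat_vec_entry[OF assms] mv_def simp del: index_mult_mat_vec)
  moreover have "(A ^\<^sub>m Suc k) *\<^sub>v vec n v = (A ^\<^sub>m k) *\<^sub>v (A *\<^sub>v vec n v)"
    using assms by (simp add: assoc_mult_mat_vec[of _ n n _ n])
  ultimately show ?case by (simp add: Suc funpow_swap1)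
qed (use assms in auto)

text \<open>A maximal independent set of columns has \<open>n\<close> elements and is a basis, so
  orthogonality extends from the columns to the whole space.\<close>

lemma (in vec_space) orthogonal_to_full_rank_cols:
  assumes A: "A \<in> carrier_mat n nc" and rank: "rank A = n"
    and x: "x \<in> carrier_vec n" "\<And>y. y \<in> set (cols A) \<Longrightarrow> x \<bullet> y = 0" and z: "z \<in> carrier_vec n"
  shows "x \<bullet> z = 0"
proof -
  have carr: "set (cols A) \<subseteq> carrier_vec n" using cols_dim A by blast
  obtain S where S: "finite S" "maximal S (\<lambda>T. T \<subseteq> set (cols A) \<and> lin_indpt T)"
    using maximal_exists_superset[of "set (cols A)" "\<lambda>T. T \<subseteq> set (cols A) \<and> lin_indpt T" "{}"]
    by (auto simp: lin_dep_def)
  then have Sc: "S \<subseteq> set (cols A)" "lin_indpt S" by (auto simp: maximal_def)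
  have "card S = n" using rank_card_indpt[OF A S(2)] rank by simp
  then have "basis S" using S Sc carr by (intro dim_li_is_basis) (auto simp: dim_is_n)
  then have "span S = carrier_vec n" by (simp add: basis_def)
  moreover have "x \<in> orthogonal_complement S" using x Sc by (auto simp: orthogonal_complement_def)
  ultimately have "x \<in> orthogonal_complement (carrier_vec n)"
    using in_orthogonal_complement_span[of S] Sc carr by auto
  then show ?thesis using z by (simp add: orthogonal_complement_def)
qed

lemma jointly_observable_kernel:
  assumes A: "A \<in> carrier_mat n n" and C: "\<And>i. i < m \<Longrightarrow> C i \<in> carrier_mat (qd i) n"
    and obs: "jointly_observable n m A C"
    and v: "\<And>i k t. i < m \<Longrightarrow> k < qd i \<Longrightarrow>
      dotp {..<n} (\<lambda>b. C i $$ (k, b)) ((mv {..<n} (\<lambda>a b. A $$ (a, b)) ^^ t) v) = 0"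
  shows "\<forall>a<n. v a = 0"
proof -
  define rs where "rs = concat [rows (C i * A ^\<^sub>m k). k \<leftarrow> [0..<n], i \<leftarrow> [0..<m]]"
  have CA: "C i * A ^\<^sub>m k \<in> carrier_mat (qd i) n" if "i < m" for i k using C[OF that] A by simp
  have rsc: "set rs \<subseteq> carrier_vec n"
  proof
    fix y assume "y \<in> set rs"
    then obtain i k where "i < m" "y \<in> set (rows (C i * A ^\<^sub>m k))" by (auto simp: rs_def)
    then show "y \<in> carrier_vec n" by (metis CA carrier_matD(2) rows_carrier subsetD)
  qed
  have O: "obsv_mat n m A C = mat_of_rows n rs" by (simp add: obsv_mat_def rs_def)
  have cols: "cols (transpose_mat (obsv_mat n m A C)) = rs"
    unfolding O using rsc by (simp add: rows_mat_of_rows)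
  have orth: "vec n v \<bullet> y = 0" if "y \<in> set rs" for y
  proof -
    from that obtain i t where i: "i < m" "y \<in> set (rows (C i * A ^\<^sub>m t))" by (auto simp: rs_def)
    then obtain k where k: "k < qd i" "y = row (C i * A ^\<^sub>m t) k"
      using CA[OF i(1)] C[OF i(1)] by (auto simp: rows_def)
    have "vec n v \<bullet> y = y \<bullet> vec n v" using that rsc by (intro comm_scalar_prod) auto
    also have "\<dots> = ((C i * A ^\<^sub>m t) *\<^sub>v vec n v) $ k" using k CA[OF i(1)] C[OF i(1)] by simp
    also have "(C i * A ^\<^sub>m t) *\<^sub>v vec n v = C i *\<^sub>v (A ^\<^sub>m t *\<^sub>v vec n v)"
      using C[OF i(1)] A by (intro assoc_mult_mat_vec) auto
    also have "(C i *\<^sub>v (A ^\<^sub>m t *\<^sub>v vec n v)) $ k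
        = dotp {..<n} (\<lambda>b. C i $$ (k, b)) ((mv {..<n} (\<lambda>a b. A $$ (a, b)) ^^ t) v)"
      unfolding pow_mat_mult_vec[OF A] mult_mat_vec_entry[OF C[OF i(1)] k(1)] by (simp add: dotp_def)
    finally show ?thesis using v[OF i(1) k(1)] by simp
  qed
  interpret vec_space "TYPE(real)" n .
  have "vec n v \<bullet> unit_vec n a = 0" if "a < n" for a
  proof (rule orthogonal_to_full_rank_cols)
    show "transpose_mat (obsv_mat n m A C) \<in> carrier_mat n (length rs)" unfolding O by simp
    show "rank (transpose_mat (obsv_mat n m A C)) = n"
      using obs by (simp add: jointly_observable_def rank_real_def)
  qed (use orth cols in auto)
  then show ?thesis by (auto simp: scalar_prod_right_unit)
qed

lemma vsum_entry:
  assumes "finite S" "a < n" "\<And>j. j \<in> S \<Longrightarrow> f j \<in> carrier_vec n"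
  shows "vsum n f S $ a = (\<Sum>j\<in>S. f j $ a)"
  unfolding vsum_def using assms by (intro index_finsum_vec) auto

lemma vsum_carrier: "(\<And>j. j \<in> S \<Longrightarrow> f j \<in> carrier_vec n) \<Longrightarrow> vsum n f S \<in> carrier_vec n"
  unfolding vsum_def by (rule finsum_vec_closed) auto

text \<open>The Laplacian turns the gain into the differences \<open>e_i - e_j\<close> over the
  neighbours. The sum of all \<open>\<Phi> l\<close> on the diagonal combines with the blocks
  \<open>- \<Phi> j\<close> into the coupling differences over all agents.\<close>

lemma error_mat_gain_sum:
  assumes n: "n > 0" and i: "i < m" and N: "N i \<subseteq> {0..<m}"
  shows "(\<Sum>s<m * n. (error_mat m A \<Phi> qd C K (i, a) (unpair n s)
      + \<Gamma> i a (s mod n) * graph_laplacian N i (s div n)) * X s)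
    = (\<Sum>b<n. (A a b + (\<Sum>k<qd i. K i a k * C i k b)) * X (i * n + b))
      + (\<Sum>j\<in>N i. \<Sum>b<n. \<Gamma> i a b * (X (i * n + b) - X (j * n + b)))
      + (\<Sum>j<m. \<Sum>b<n. \<Phi> j a b * (X (i * n + b) - X (j * n + b)))"
proof -
  define Y where "Y = (\<lambda>j b. X (j * n + b))"
  have X: "X s = Y (s div n) (s mod n)" for s by (simp add: Y_def)
  have "(\<Sum>s<m * n. (error_mat m A \<Phi> qd C K (i, a) (unpair n s)
      + \<Gamma> i a (s mod n) * graph_laplacian N i (s div n)) * X s)
    = (\<Sum>j<m. \<Sum>b<n. (error_mat m A \<Phi> qd C K (i, a) (j, b) + \<Gamma> i a b * graph_laplacian N i j) * Y j b)"
    using unpair_sum[OF n, where m = m and f = "\<lambda>(j, b). (error_mat m A \<Phi> qd C K (i, a) (j, b) + \<Gamma> i a b * graph_laplacian N i j) * Y j b"]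
    unfolding sum.cartesian_product X by (simp add: unpair_def)
  also have "\<dots> = (\<Sum>j<m. \<Sum>b<n. (if j = i then (A a b + (\<Sum>l<m. \<Phi> l a b) + (\<Sum>k<qd i. K i a k * C i k b)) * Y j b else 0))
      - (\<Sum>j<m. \<Sum>b<n. \<Phi> j a b * Y j b) + (\<Sum>j<m. \<Sum>b<n. \<Gamma> i a b * (graph_laplacian N i j * Y j b))"
    unfolding sum_subtractf[symmetric] sum.distrib[symmetric]
    by (intro sum.cong refl) (auto simp: error_mat_def algebra_simps)
  also have "(\<Sum>j<m. \<Sum>b<n. (if j = i then (A a b + (\<Sum>l<m. \<Phi> l a b) + (\<Sum>k<qd i. K i a k * C i k b)) * Y j b else 0))
      = (\<Sum>j<m. if j = i then \<Sum>b<n. (A a b + (\<Sum>l<m. \<Phi> l a b) + (\<Sum>k<qd i. K i a k * C i k b)) * Y j b else 0)"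
    by (intro sum.cong refl) auto
  also have "\<dots> = (\<Sum>b<n. (A a b + (\<Sum>l<m. \<Phi> l a b) + (\<Sum>k<qd i. K i a k * C i k b)) * Y i b)"
    using i by simp
  also have "\<dots> = (\<Sum>b<n. (A a b + (\<Sum>k<qd i. K i a k * C i k b)) * Y i b) + (\<Sum>b<n. \<Sum>l<m. \<Phi> l a b * Y i b)"
    unfolding sum.distrib[symmetric] by (intro sum.cong refl) (simp add: distrib_right sum_distrib_right)
  also have "(\<Sum>b<n. \<Sum>l<m. \<Phi> l a b * Y i b) = (\<Sum>l<m. \<Sum>b<n. \<Phi> l a b * Y i b)" by (rule sum.swap)
  also have "(\<Sum>j<m. \<Sum>b<n. \<Gamma> i a b * (graph_laplacian N i j * Y j b))
      = (\<Sum>b<n. \<Gamma> i a b * (\<Sum>j<m. graph_laplacian N i j * Y j b))"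
    by (subst sum.swap) (simp add: sum_distrib_left)
  also have "\<dots> = (\<Sum>b<n. \<Gamma> i a b * (\<Sum>j\<in>N i. Y i b - Y j b))"
    using graph_laplacian_sum[where N = N and f = "\<lambda>j. Y j _", OF i N] by simp
  also have "\<dots> = (\<Sum>j\<in>N i. \<Sum>b<n. \<Gamma> i a b * (Y i b - Y j b))"
    by (subst sum.swap) (simp add: sum_distrib_left)
  finally show ?thesis unfolding Y_def
    by (simp add: sum_subtractf right_diff_distrib)
qed

theorem theorem1:
  fixes n m q :: nat
    and p qd :: "nat \<Rightarrow> nat"
    and A :: "real mat" and B C F :: "nat \<Rightarrow> real mat"
    and N :: "nat \<Rightarrow> nat set"
    and \<Lambda> :: "complex multiset"
  assumes "m \<ge> 1"
    and "A \<in> carrier_mat n n"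
    and "\<And>i. i < m \<Longrightarrow> B i \<in> carrier_mat n (p i)"
    and "\<And>i. i < m \<Longrightarrow> C i \<in> carrier_mat (qd i) n"
    and "\<And>i. i < m \<Longrightarrow> B i \<noteq> 0\<^sub>m n (p i)"
    and "\<And>i. i < m \<Longrightarrow> C i \<noteq> 0\<^sub>m (qd i) n"
    and "jointly_controllable n m A B"
    and "jointly_observable n m A C"
    and "\<And>i. i < m \<Longrightarrow> i \<in> N i \<and> N i \<subseteq> {0..<m}"
    and "strongly_connected_graph m (neighbor_arcs m N)"
    and "\<And>i. i < m \<Longrightarrow> F i \<in> carrier_mat (p i) n"
    and "q < m"
    and "image_mset cnj \<Lambda> = \<Lambda>"
    and "size \<Lambda> = m * n + (m - 1)"
  shows "\<exists>K H Abar Cbar Kbar Hbar.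
           (\<forall>i<m. K i \<in> carrier_mat n (qd i)) \<and>
           (\<forall>i<m. \<forall>j\<in>N i. H i j \<in> carrier_mat n n) \<and>
           Abar \<in> carrier_mat (m - 1) (m - 1) \<and>
           Cbar \<in> carrier_mat n (m - 1) \<and>
           Kbar \<in> carrier_mat (m - 1) (qd q) \<and>
           (\<forall>j\<in>N q. Hbar j \<in> carrier_mat (m - 1) n) \<and>
           (\<exists>M \<in> carrier_mat (m * n + (m - 1)) (m * n + (m - 1)).
              (\<forall>x \<in> carrier_vec (m * n + (m - 1)).
                 M *\<^sub>v x = closed_loop_rhs n m q A B C F N K H Abar Cbar Kbar Hbar x) \<and>
              char_poly (map_mat complex_of_real M) = (\<Prod>\<mu>\<in>#\<Lambda>. [:- \<mu>, 1:]))"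
proof -
  note m = assms(1) and A = assms(2) and B = assms(3) and C = assms(4) and C0 = assms(6)
    and obs = assms(8) and N = assms(9) and conn = assms(10) and F = assms(11) and q = assms(12)
  define g where "g = graph_laplacian N"
  have irr: "irreducible_laplacian m g" unfolding g_def
    by (rule irreducible_graph_laplacian[OF _ conn]) (use N in blast)
  have Cq: "C q \<in> carrier_mat (qd q) n" "C q \<noteq> 0\<^sub>m (qd q) n" using C C0 q by auto
  \<comment> \<open>Row \<open>k0\<close> of \<open>C q\<close>, divided by its nonzero entry
    \<open>\<gamma>\<close> in column \<open>a0\<close>, is the scalar output \<open>c\<close>; the
    division gives the normalisation \<open>c a0 = 1\<close>.\<close>
  then obtain k0 a0 where ka: "k0 < qd q" "a0 < n" "C q $$ (k0, a0) \<noteq> 0"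
    by (metis carrier_matD eq_matI index_zero_mat)
  then have n: "n > 0" by simp
  define \<gamma> where "\<gamma> = C q $$ (k0, a0)"
  have \<gamma>: "\<gamma> \<noteq> 0" using ka by (simp add: \<gamma>_def)
  define c where "c = (\<lambda>b. C q $$ (k0, b) / \<gamma>)"
  have c0: "c a0 = 1" using \<gamma> by (simp add: c_def \<gamma>_def)
  define Af where "Af = (\<lambda>a b. A $$ (a, b))"
  define Cf where "Cf = (\<lambda>i k b. C i $$ (k, b))"
  define \<Phi> where "\<Phi> = (\<lambda>j a b. (B j * F j) $$ (a, b))"
  have obsf: "\<forall>a<n. v a = 0"
    if "\<And>i k t. i < m \<Longrightarrow> k < qd i \<Longrightarrow> dotp {..<n} (Cf i k) ((mv {..<n} Af ^^ t) v) = 0" for v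
    by (rule jointly_observable_kernel[OF A C obs]) (use that in \<open>simp_all add: Af_def Cf_def\<close>)
  define NN where "NN = m * n"
  define \<mu> where "\<mu> = m - 1"
  define D where "D = NN + \<mu>"
  define cc where "cc = (\<lambda>r. if r div n = q then c (r mod n) else 0)"
  define MM where "MM = (\<lambda>K \<Gamma> r s. error_mat m Af \<Phi> qd Cf K (unpair n r) (unpair n s)
      + \<Gamma> (r div n) (r mod n) (s mod n) * g (r div n) (s div n))"
  have "\<exists>K \<Gamma>. (\<forall>v. (\<forall>k. dotp {..<NN} cc ((mv {..<NN} (MM K \<Gamma>) ^^ k) v) = 0) \<longrightarrow> (\<forall>r<NN. v r = 0)) \<and>
    (\<forall>u. (\<forall>k<m. \<forall>b<n. dotp {..<NN} u ((mv {..<NN} (MM K \<Gamma>) ^^ k) (\<lambda>r. if r = q * n + b then 1 else 0)) = 0)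
      \<longrightarrow> (\<forall>r<NN. u r = 0))"
    unfolding NN_def cc_def MM_def
    by (rule error_system_observable_controllable[where c = c and A = Af and C = Cf and qd = qd and \<Phi> = \<Phi>,
      OF irr q ka(2) c0 obsf])
  then obtain K \<Gamma> where
    obsM: "\<And>v. (\<forall>k. dotp {..<NN} cc ((mv {..<NN} (MM K \<Gamma>) ^^ k) v) = 0) \<Longrightarrow> (\<forall>r<NN. v r = 0)"
    and ctrlM: "\<And>u. (\<forall>k<m. \<forall>b<n. dotp {..<NN} u ((mv {..<NN} (MM K \<Gamma>) ^^ k) (\<lambda>r. if r = q * n + b then 1 else 0)) = 0)
      \<Longrightarrow> (\<forall>r<NN. u r = 0)"
    by blast
  define M where "M = MM K \<Gamma>"
  \<comment> \<open>The unit vectors of the block of agent \<open>q\<close>: injection and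
    compensator can both push \<open>e_q\<close> in any direction of \<open>n\<close>-space.\<close>
  define Bq where "Bq = (\<lambda>b r. if r = q * n + b then 1 else 0 :: real)"
  obtain \<chi> where p: "monic \<chi>" "degree \<chi> = D" "map_poly complex_of_real \<chi> = (\<Prod>\<mu>\<in>#\<Lambda>. [:- \<mu>, 1:])"
    using real_poly_of_conjugation_invariant_roots[OF assms(13)] assms(14)
    by (auto simp: D_def NN_def \<mu>_def)
  have "\<exists>d Cz kz Az. char_poly (mat (NN + \<mu>) (NN + \<mu>) (\<lambda>(r, s). loop_mat NN n M Bq cc d Cz kz Az r s)) = \<chi>"
  proof (rule compensator_spectrum)
    show "\<forall>r<NN. v r = 0" if "\<And>k. dotp {..<NN} cc ((mv {..<NN} M ^^ k) v) = 0" for v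
      using that obsM unfolding M_def by blast
    show "\<forall>r<NN. u r = 0"
      if "\<And>k b. k \<le> \<mu> \<Longrightarrow> b < n \<Longrightarrow> dotp {..<NN} u ((mv {..<NN} M ^^ k) (Bq b)) = 0" for u
    proof (rule ctrlM, intro allI impI)
      fix k b assume "k < m" "b < n"
      then show "dotp {..<NN} u ((mv {..<NN} (MM K \<Gamma>) ^^ k) (\<lambda>r. if r = q * n + b then 1 else 0)) = 0"
        using that[of k b] unfolding M_def Bq_def \<mu>_def by simp
    qed
  qed (use p in \<open>auto simp: D_def\<close>)
  then obtain d Cz kz Az where
    char: "char_poly (mat D D (\<lambda>(r, s). loop_mat NN n M Bq cc d Cz kz Az r s)) = \<chi>"
    unfolding D_def by blast
  define Mat where "Mat = mat D D (\<lambda>(r, s). loop_mat NN n M Bq cc d Cz kz Az r s)"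
  \<comment> \<open>The static part \<open>d\<close> uses the output entry \<open>k0\<close>, and
    dividing by \<open>\<gamma>\<close> undoes the scaling in \<open>c\<close>; \<open>Kbar\<close>
    below is built likewise. \<open>H i j\<close> is the gain block of \<open>i\<close>, the same
    for all neighbours \<open>j\<close>.\<close>
  define K' where "K' = (\<lambda>i. mat n (qd i) (\<lambda>(a, k). K i a k + (if i = q \<and> k = k0 then d a / \<gamma> else 0)))"
  define H where "H = (\<lambda>i j :: nat. mat n n (\<lambda>(a, b). \<Gamma> i a b))"
  define Abar where "Abar = mat (m - 1) (m - 1) (\<lambda>(i, j). Az i j)"
  define Cbar where "Cbar = mat n (m - 1) (\<lambda>(b, j). Cz b j)"
  define Kbar where "Kbar = mat (m - 1) (qd q) (\<lambda>(i, k). if k = k0 then kz i / \<gamma> else 0)"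
  \<comment> \<open>The compensator is driven by the scalar output alone, so zero is chosen
    here.\<close>
  define Hbar where "Hbar = (\<lambda>j :: nat. 0\<^sub>m (m - 1) n :: real mat)"
  have BF: "B j * F j \<in> carrier_mat n n" if "j < m" for j using mult_carrier_mat[OF B F] that by blast
  have lt: "i * n + a < NN" if "i < m" "a < n" for i a
  proof -
    have "i * n + a < Suc i * n" using that by simp
    also have "\<dots> \<le> m * n" using that by (intro mult_le_mono1) simp
    finally show ?thesis by (simp add: NN_def)
  qed
  have "Mat *\<^sub>v x = closed_loop_rhs n m q A B C F N K' H Abar Cbar Kbar Hbar x"
    if x: "x \<in> carrier_vec D" for x
  proof -
    define X where "X = (\<lambda>r. x $ r)"
    define e where "e = (\<lambda>i. vec n (\<lambda>a. X (i * n + a)))"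
    define z where "z = vec (m - 1) (\<lambda>a. X (NN + a))"
    define de where "de = (\<lambda>i. (A + K' i * C i) *\<^sub>v e i + vsum n (\<lambda>j. H i j *\<^sub>v (e i - e j)) (N i)
      + (if i = q then Cbar *\<^sub>v z else 0\<^sub>v n) + vsum n (\<lambda>j. (B j * F j) *\<^sub>v (e i - e j)) {0..<m})"
    define dz where "dz = Abar *\<^sub>v z + (Kbar * C q) *\<^sub>v e q + vsum (m - 1) (\<lambda>j. Hbar j *\<^sub>v (e q - e j)) (N q)"
    have rhs: "closed_loop_rhs n m q A B C F N K' H Abar Cbar Kbar Hbar x
      = vec D (\<lambda>r. if r < NN then de (r div n) $ (r mod n) else dz $ (r - NN))"
      unfolding closed_loop_rhs_def Let_def de_def dz_def e_def z_def X_def D_def NN_def \<mu>_def ..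
    have ed: "e i - e j = vec n (\<lambda>b. X (i * n + b) - X (j * n + b))" for i j
      unfolding e_def by (intro eq_vecI) auto
    have cdot: "(\<Sum>s<NN. cc s * X s) = (\<Sum>b<n. c b * X (q * n + b))"
    proof -
      have "(\<Sum>s<NN. cc s * X s) = (\<Sum>i<m. \<Sum>b<n. (if i = q then c b else 0) * X (i * n + b))"
        using unpair_sum[OF n, where m = m and f = "\<lambda>(i, b). (if i = q then c b else 0) * X (i * n + b)"]
        unfolding sum.cartesian_product NN_def by (simp add: unpair_def cc_def)
      also have "\<dots> = (\<Sum>i<m. if i = q then \<Sum>b<n. c b * X (i * n + b) else 0)"
        by (intro sum.cong refl) auto
      finally show ?thesis using q by simp
    qed
    have Bsum: "(\<Sum>b<n. Bq b (i * n + a) * f b) = (if i = q then f a else 0)" if "a < n" for i a f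
    proof -
      have "i * n + a = q * n + b \<longleftrightarrow> i = q \<and> b = a" if "b < n" for b
        using unpair_inverse[OF \<open>a < n\<close>, of i] unpair_eq_iff[OF that, of "i * n + a" q] by auto
      then have "(\<Sum>b<n. Bq b (i * n + a) * f b) = (\<Sum>b<n. if b = a then (if i = q then f b else 0) else 0)"
        by (intro sum.cong refl) (auto simp: Bq_def)
      then show ?thesis using that by simp
    qed
    have Matx: "(Mat *\<^sub>v x) $ r = (\<Sum>s<NN. loop_mat NN n M Bq cc d Cz kz Az r s * X s)
        + (\<Sum>j<\<mu>. loop_mat NN n M Bq cc d Cz kz Az r (NN + j) * X (NN + j))" if "r < D" for r
    proof -
      have "(Mat *\<^sub>v x) $ r = (\<Sum>s<D. loop_mat NN n M Bq cc d Cz kz Az r s * X s)"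
        using that x by (simp add: Mat_def scalar_prod_def lessThan_atLeast0 X_def)
      then show ?thesis unfolding D_def sum_lessThan_add .
    qed
    have top: "(Mat *\<^sub>v x) $ (i * n + a) = de i $ a" if i: "i < m" and a: "a < n" for i a
    proof -
      have r: "i * n + a < NN" "i * n + a < D" using lt[OF i a] by (auto simp: D_def)
      have Ni: "N i \<subseteq> {0..<m}" "finite (N i)" using N[OF i] finite_subset by auto
      have "(Mat *\<^sub>v x) $ (i * n + a) = (\<Sum>s<NN. M (i * n + a) s * X s) + (if i = q then d a * (\<Sum>s<NN. cc s * X s) else 0)
          + (if i = q then \<Sum>j<\<mu>. Cz a j * X (NN + j) else 0)"
        unfolding Matx[OF r(2)] using r(1)
        by (simp add: loop_mat_def Bsum[OF a] distrib_right sum.distrib sum_distrib_left mult.assoc)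
      also have "(\<Sum>s<NN. M (i * n + a) s * X s)
        = (\<Sum>b<n. (Af a b + (\<Sum>k<qd i. K i a k * Cf i k b)) * X (i * n + b))
        + (\<Sum>j\<in>N i. \<Sum>b<n. \<Gamma> i a b * (X (i * n + b) - X (j * n + b)))
        + (\<Sum>j<m. \<Sum>b<n. \<Phi> j a b * (X (i * n + b) - X (j * n + b)))"
        using error_mat_gain_sum[where N = N and A = Af and \<Phi> = \<Phi> and qd = qd and C = Cf and K = K and a = a
          and \<Gamma> = \<Gamma> and X = X, OF n i Ni(1)] a
        by (simp add: M_def MM_def g_def NN_def unpair_inverse)
      finally have Mx: "(Mat *\<^sub>v x) $ (i * n + a) = \<dots> + (if i = q then d a * (\<Sum>b<n. c b * X (q * n + b)) else 0)
          + (if i = q then \<Sum>j<\<mu>. Cz a j * X (NN + j) else 0)" unfolding cdot .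
      have K'c: "K' i \<in> carrier_mat n (qd i)" by (simp add: K'_def)
      have KC: "(A + K' i * C i) \<in> carrier_mat n n"
        by (rule add_carrier_mat[OF mult_carrier_mat[OF K'c C[OF i]]])
      have KCe: "(A + K' i * C i) $$ (a, b) = Af a b + (\<Sum>k<qd i. K i a k * Cf i k b) + (if i = q then d a * c b else 0)"
        if b: "b < n" for b
      proof -
        have "(A + K' i * C i) $$ (a, b) = Af a b + (\<Sum>k<qd i. (K i a k + (if i = q \<and> k = k0 then d a / \<gamma> else 0)) * Cf i k b)"
          using A C[OF i] a b by (simp add: K'_def Af_def Cf_def scalar_prod_def lessThan_atLeast0)
        also have "(\<Sum>k<qd i. (K i a k + (if i = q \<and> k = k0 then d a / \<gamma> else 0)) * Cf i k b)
          = (\<Sum>k<qd i. K i a k * Cf i k b) + (\<Sum>k<qd i. if k = k0 then (if i = q then d a / \<gamma> * Cf i k b else 0) else 0)"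
          unfolding sum.distrib[symmetric] by (intro sum.cong refl) (auto simp: distrib_right)
        finally show ?thesis using ka by (auto simp: c_def Cf_def)
      qed
      have e1: "((A + K' i * C i) *\<^sub>v e i) $ a
        = (\<Sum>b<n. (Af a b + (\<Sum>k<qd i. K i a k * Cf i k b)) * X (i * n + b))
        + (if i = q then d a * (\<Sum>b<n. c b * X (q * n + b)) else 0)"
        unfolding e_def mult_mat_vec_entry[OF KC a]
        by (simp add: KCe distrib_right sum.distrib sum_distrib_left mult.assoc)
      have e2: "vsum n (\<lambda>j. H i j *\<^sub>v (e i - e j)) (N i) $ a = (\<Sum>j\<in>N i. \<Sum>b<n. \<Gamma> i a b * (X (i * n + b) - X (j * n + b)))"
      proof (subst vsum_entry[OF Ni(2) a])
        show "H i j *\<^sub>v (e i - e j) \<in> carrier_vec n" for j unfolding H_def by (intro mult_mat_vec_carrier) (auto simp: e_def)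
        have "H i j \<in> carrier_mat n n" for j by (simp add: H_def)
        then show "(\<Sum>j\<in>N i. (H i j *\<^sub>v (e i - e j)) $ a) = (\<Sum>j\<in>N i. \<Sum>b<n. \<Gamma> i a b * (X (i * n + b) - X (j * n + b)))"
          unfolding ed using a by (simp add: mult_mat_vec_entry[OF _ a] del: index_mult_mat_vec) (simp add: H_def)
      qed
      have e3: "(if i = q then Cbar *\<^sub>v z else 0\<^sub>v n) $ a = (if i = q then \<Sum>j<\<mu>. Cz a j * X (NN + j) else 0)"
      proof -
        have "Cbar \<in> carrier_mat n (m - 1)" by (simp add: Cbar_def)
        then have "(Cbar *\<^sub>v z) $ a = (\<Sum>j<m - 1. Cbar $$ (a, j) * X (NN + j))"
          unfolding z_def by (rule mult_mat_vec_entry[OF _ a])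
        then show ?thesis using a by (simp add: Cbar_def \<mu>_def)
      qed
      have e4: "vsum n (\<lambda>j. (B j * F j) *\<^sub>v (e i - e j)) {0..<m} $ a = (\<Sum>j<m. \<Sum>b<n. \<Phi> j a b * (X (i * n + b) - X (j * n + b)))"
      proof (subst vsum_entry[OF _ a])
        show "(B j * F j) *\<^sub>v (e i - e j) \<in> carrier_vec n" if "j \<in> {0..<m}" for j
          using BF[of j] that by (intro mult_mat_vec_carrier) (auto simp: e_def)
        show "(\<Sum>j = 0..<m. ((B j * F j) *\<^sub>v (e i - e j)) $ a) = (\<Sum>j<m. \<Sum>b<n. \<Phi> j a b * (X (i * n + b) - X (j * n + b)))"
          unfolding ed lessThan_atLeast0[symmetric] \<Phi>_def
          by (intro sum.cong refl mult_mat_vec_entry[OF BF a]) simp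
      qed simp
      have c1: "vsum n (\<lambda>j. H i j *\<^sub>v (e i - e j)) (N i) \<in> carrier_vec n"
        by (intro vsum_carrier mult_mat_vec_carrier[of _ n n]) (auto simp: H_def e_def)
      have c2: "vsum n (\<lambda>j. (B j * F j) *\<^sub>v (e i - e j)) {0..<m} \<in> carrier_vec n"
        using BF by (intro vsum_carrier mult_mat_vec_carrier) (auto simp: e_def)
      have "Cbar *\<^sub>v z \<in> carrier_vec n"
        by (rule mult_mat_vec_carrier[of _ n "m - 1"]) (simp_all add: Cbar_def z_def)
      then have c3: "(if i = q then Cbar *\<^sub>v z else 0\<^sub>v n) \<in> carrier_vec n" by simp
      have c4: "(A + K' i * C i) *\<^sub>v e i \<in> carrier_vec n"
        using KC by (intro mult_mat_vec_carrier) (auto simp: e_def)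
      have "de i $ a = ((A + K' i * C i) *\<^sub>v e i) $ a + vsum n (\<lambda>j. H i j *\<^sub>v (e i - e j)) (N i) $ a
        + (if i = q then Cbar *\<^sub>v z else 0\<^sub>v n) $ a + vsum n (\<lambda>j. (B j * F j) *\<^sub>v (e i - e j)) {0..<m} $ a"
        unfolding de_def using a c1 c2 c3 c4
        by (simp only: index_add_vec carrier_vecD add_carrier_vec)
      then show ?thesis unfolding Mx e1 e2 e3 e4 by simp
    qed
    have bot: "(Mat *\<^sub>v x) $ (NN + i) = dz $ i" if i: "i < \<mu>" for i
    proof -
      have i': "i < m - 1" using i by (simp add: \<mu>_def)
      have "(Mat *\<^sub>v x) $ (NN + i) = kz i * (\<Sum>s<NN. cc s * X s) + (\<Sum>j<\<mu>. Az i j * X (NN + j))"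
        using Matx[of "NN + i"] i by (simp add: loop_mat_def D_def sum_distrib_left mult.assoc)
      then have Mx: "(Mat *\<^sub>v x) $ (NN + i) = kz i * (\<Sum>b<n. c b * X (q * n + b)) + (\<Sum>j<\<mu>. Az i j * X (NN + j))"
        unfolding cdot .
      have Ac: "Abar \<in> carrier_mat (m - 1) (m - 1)" by (simp add: Abar_def)
      have e1: "(Abar *\<^sub>v z) $ i = (\<Sum>j<\<mu>. Az i j * X (NN + j))"
        unfolding z_def mult_mat_vec_entry[OF Ac i'] using i' by (simp add: Abar_def \<mu>_def)
      have KC: "Kbar * C q \<in> carrier_mat (m - 1) n"
        by (rule mult_carrier_mat[OF _ Cq(1)]) (simp add: Kbar_def)
      have KCe: "(Kbar * C q) $$ (i, b) = kz i * c b" if b: "b < n" for b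
      proof -
        have "(Kbar * C q) $$ (i, b) = (\<Sum>k<qd q. (if k = k0 then kz i / \<gamma> else 0) * C q $$ (k, b))"
          using Cq b i' by (simp add: Kbar_def scalar_prod_def lessThan_atLeast0)
        also have "\<dots> = (\<Sum>k<qd q. if k = k0 then kz i / \<gamma> * C q $$ (k, b) else 0)"
          by (intro sum.cong refl) auto
        finally show ?thesis using ka by (simp add: c_def)
      qed
      have e2: "((Kbar * C q) *\<^sub>v e q) $ i = kz i * (\<Sum>b<n. c b * X (q * n + b))"
        unfolding e_def mult_mat_vec_entry[OF KC i'] by (simp add: KCe sum_distrib_left mult.assoc)
      have Nq: "finite (N q)" using N[OF q] finite_subset by auto
      have Hc: "Hbar j *\<^sub>v (e q - e j) = 0\<^sub>v (m - 1)" for j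
        unfolding Hbar_def by (intro eq_vecI) (auto simp: e_def scalar_prod_def)
      have e3: "vsum (m - 1) (\<lambda>j. Hbar j *\<^sub>v (e q - e j)) (N q) $ i = 0"
        unfolding Hc using i' Nq by (subst vsum_entry) auto
      have "vsum (m - 1) (\<lambda>j. Hbar j *\<^sub>v (e q - e j)) (N q) \<in> carrier_vec (m - 1)"
        unfolding Hc by (rule vsum_carrier) simp
      moreover have "(Kbar * C q) *\<^sub>v e q \<in> carrier_vec (m - 1)"
        using KC by (intro mult_mat_vec_carrier) (auto simp: e_def)
      moreover have "Abar *\<^sub>v z \<in> carrier_vec (m - 1)" using Ac by (intro mult_mat_vec_carrier) (auto simp: z_def)
      ultimately have "dz $ i = (Abar *\<^sub>v z) $ i + ((Kbar * C q) *\<^sub>v e q) $ i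
        + vsum (m - 1) (\<lambda>j. Hbar j *\<^sub>v (e q - e j)) (N q) $ i"
        unfolding dz_def using i' by (simp only: index_add_vec carrier_vecD add_carrier_vec)
      then show ?thesis unfolding Mx e1 e2 e3 by simp
    qed
    show ?thesis unfolding rhs
    proof (rule eq_vecI)
      fix r assume "r < dim_vec (vec D (\<lambda>r. if r < NN then de (r div n) $ (r mod n) else dz $ (r - NN)))"
      then have r: "r < D" by simp
      show "(Mat *\<^sub>v x) $ r = vec D (\<lambda>r. if r < NN then de (r div n) $ (r mod n) else dz $ (r - NN)) $ r"
      proof (cases "r < NN")
        case True
        then have "r div n < m" "r mod n < n" using n by (auto simp: NN_def less_mult_imp_div_less)
        from top[OF this] show ?thesis using True r by simp
      next
        case False
        then have "r - NN < \<mu>" using r by (simp add: D_def)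
        from bot[OF this] show ?thesis using False r by simp
      qed
    qed (simp add: Mat_def)
  qed
  moreover have "char_poly (map_mat complex_of_real Mat) = (\<Prod>\<mu>\<in>#\<Lambda>. [:- \<mu>, 1:])"
  proof -
    have Mc: "Mat \<in> carrier_mat D D" by (simp add: Mat_def)
    have hom: "comm_ring_hom complex_of_real" by unfold_locales auto
    show ?thesis unfolding comm_ring_hom.char_poly_hom[OF hom Mc] using char p(3) by (simp add: Mat_def)
  qed
  moreover have "Mat \<in> carrier_mat D D" by (simp add: Mat_def)
  moreover have D: "D = m * n + (m - 1)" by (simp add: D_def NN_def \<mu>_def)
  ultimately show ?thesis unfolding D
    by (intro exI[of _ K'] exI[of _ H] exI[of _ Abar] exI[of _ Cbar] exI[of _ Kbar] exI[of _ Hbar] conjI allI impI ballI bexI[of _ Mat])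
      (auto simp: K'_def H_def Abar_def Cbar_def Kbar_def Hbar_def)
qed

end
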